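(* Let $\mathfrak{g}=\langle e_0,\dots,e_7\rangle$ be an $8$-dimensional real Lie algebra such that $\mathbb{R}^7=\langle e_1,\dots,e_7\rangle$ is an abelian ideal, endowed with the canonical metric (making $(e_0,\dots,e_7)$ orthonormal) and the canonical volume form. Let $\mathcal{E}=\mathrm{ad}(e_0)|_{\mathbb{R}^7}$ and let $\mathcal{E}_{13}$ and $\mathcal{E}_{24}$ be the symmetric and skew-symmetric parts of $\mathcal{E}$. Then $\mathfrak{g}$ admits a $\mathrm{Spin}(7)$ structure of type: 1. parallel, if and only if $\mathcal{E}_{13}=0$ and the eigenvalues of $\mathcal{E}_{24}$ are $0,\pm\lambda_1 i,\pm\lambda_2 i,\pm(\lambda_1+\lambda_2)i$ for some $0\le\lambda_1\le\lambda_2$; 2. locally conformally parallel and non-parallel, if and only if $\mathcal{E}_{13}=h\,\mathrm{Id}$ with $h\neq0$ and the eigenvalues of $\mathcal{E}_{24}$ are $0,\pm\lambda_1 i,\pm\lambda_2 i,\pm(\lambda_1+\lambda_2)i$ for some $0\le\lambda_1\le\lambda_2$; 3. balanced, if and only if $\mathfrak{g}$ is unimodular and the eigenvalues of $\mathcal{E}_{24}$ are $0,\pm\lambda_1 i,\pm\lambda_2 i,\pm(\lambda_1+\lambda_2)i$ for some $0\le\lambda_1\le\lambda_2$. Moreover, if $\mathcal{E}_{24}\neq0$ then $\mathfrak{g}$ admits a $\mathrm{Spin}(7)$ structure of mixed type.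
   Context: Eigenvalues are listed with multiplicity ($7$ eigenvalues in $\mathbb{C}$). A Lie algebra is unimodular if its volume form is not exact; here this is equivalent to $\mathcal{E}$ being traceless. With $e^{ijkl}=e^i\wedge e^j\wedge e^k\wedge e^l$, the standard $\mathrm{Spin}(7)$ form on $\mathbb{R}^8$ is $\Omega_0=e^{0123}-e^{0145}-e^{0167}-e^{0246}+e^{0257}-e^{0347}-e^{0356}+e^{4567}-e^{2367}-e^{2345}-e^{1357}+e^{1346}-e^{1256}-e^{1247}.$ A $\mathrm{Spin}(7)$ structure on $\mathfrak{g}$ (with its given metric and orientation) is a $4$-form $\Omega\in\Lambda^4\mathfrak{g}^*$ of the form $\Omega=\varphi^*\Omega_0$ with $\varphi\in\mathrm{SO}(8)$; it is identified with a left-invariant $\mathrm{Spin}(7)$ structure on the simply connected Lie group with Lie algebra $\mathfrak{g}$, and $d$ is the exterior derivative of left-invariant forms. Put $\Lambda^3_8=\{i(X)\Omega: X\in\mathfrak{g}\}$ and $\Lambda^3_{48}=\ker(\cdot\wedge\Omega:\Lambda^3\mathfrak{g}^*\to\Lambda^7\mathfrak{g}^* )$, so that $\Lambda^3\mathfrak{g}^*=\Lambda^3_8\oplus\Lambda^3_{48}$. The structure $\Omega$ is parallel if $*d\Omega=0$, locally conformally parallel if $*d\Omega\in\Lambda^3_8$, balanced if $*d\Omega\in\Lambda^3_{48}$, and mixed if it satisfies none of these three conditions. *)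

theory Defs
  imports
    "HOL-Analysis.Analysis"
    "HOL-Computational_Algebra.Computational_Algebra"
    "Jordan_Normal_Form.Char_Poly"
begin

section \<open>Exterior forms\<close>

text \<open>
  A form takes the list of its arguments. A \<open>k\<close>-form vanishes by convention on every list whose
  length is not \<open>k\<close>, so that equality of forms is equality of functions, and the
  operations below need no degree parameter.
\<close>

type_synonym 'v form = "'v list \<Rightarrow> real"

definition forms :: "nat \<Rightarrow> 'v::real_vector form set" where
  "forms k = {\<omega>.
     (\<forall>xs. length xs \<noteq> k \<longrightarrow> \<omega> xs = 0) \<and>
     (\<forall>xs i. length xs = k \<and> i < k \<longrightarrow> linear (\<lambda>x. \<omega> (xs[i := x]))) \<and>
     (\<forall>xs. length xs = k \<and> \<not> distinct xs \<longrightarrow> \<omega> xs = 0)}"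

text \<open>
  The sign of the permutation of \<open>{..<n}\<close> that lists the elements of \<open>A\<close> in increasing order,
  followed by those of the complement in increasing order.
\<close>

definition shuffle_sign :: "nat \<Rightarrow> nat set \<Rightarrow> real" where
  "shuffle_sign n A = (- 1) ^ card {(i, j). i \<in> A \<and> j \<in> {..<n} - A \<and> j < i}"

text \<open>
  The sum over shuffles, without a factorial factor: \<open>e\<^sup>1 \<and> \<dots> \<and> e\<^sup>k\<close> has value \<open>1\<close> on \<open>(e\<^sub>1, \<dots>, e\<^sub>k)\<close>.
  For a \<open>p\<close>-form \<open>\<alpha>\<close> only the summands with \<open>card A = p\<close> are nonzero.
\<close>

definition wedge :: "'v form \<Rightarrow> 'v form \<Rightarrow> 'v form" where
  "wedge \<alpha> \<beta> = (\<lambda>xs. \<Sum>A\<in>Pow {..<length xs}.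
     shuffle_sign (length xs) A * \<alpha> (nths xs A) * \<beta> (nths xs (- A)))"

definition interior_product :: "'v \<Rightarrow> 'v form \<Rightarrow> 'v form" where
  "interior_product x \<omega> = (\<lambda>xs. \<omega> (x # xs))"

definition pullback :: "('v \<Rightarrow> 'w) \<Rightarrow> 'w form \<Rightarrow> 'v form" where
  "pullback f \<omega> = (\<lambda>xs. \<omega> (map f xs))"


section \<open>Euclidean 8-space with its standard basis\<close>

definition basis8 :: "nat \<Rightarrow> real^8" where
  "basis8 i = axis (of_nat i) 1"

definition dual8 :: "nat \<Rightarrow> (real^8) form" where
  "dual8 i = (\<lambda>xs. if length xs = 1 then inner (basis8 i) (hd xs) else 0)"

definition one_form0 :: "'v form" where
  "one_form0 = (\<lambda>xs. if xs = [] then 1 else 0)"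

text \<open>\<open>wedge8 [i, j, \<dots>]\<close> is \<open>e\<^sup>i \<and> e\<^sup>j \<and> \<dots>\<close>.\<close>

definition wedge8 :: "nat list \<Rightarrow> (real^8) form" where
  "wedge8 is = foldr (\<lambda>i \<omega>. wedge (dual8 i) \<omega>) is one_form0"

definition vol8 :: "(real^8) form" where
  "vol8 = wedge8 [0, 1, 2, 3, 4, 5, 6, 7]"

text \<open>
  The Hodge star of the standard metric and of \<^const>\<open>vol8\<close>, characterised by
  \<open>\<alpha> \<and> \<star>\<beta> = \<langle>\<alpha>, \<beta>\<rangle> vol\<close>: the contraction of the volume form with \<open>\<omega>\<close>, summed over
  the increasing tuples of basis vectors.
\<close>

definition hodge8 :: "(real^8) form \<Rightarrow> (real^8) form" where
  "hodge8 \<omega> = (\<lambda>ys. \<Sum>A\<in>Pow {..<8}.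
     (let xs = map basis8 (nths [0..<8] A) in \<omega> xs * vol8 (xs @ ys)))"


section \<open>Lie algebras\<close>

definition lie_bracket :: "('v::real_vector \<Rightarrow> 'v \<Rightarrow> 'v) \<Rightarrow> bool" where
  "lie_bracket br \<longleftrightarrow> bilinear br \<and> (\<forall>x. br x x = 0) \<and>
     (\<forall>x y z. br x (br y z) + br y (br z x) + br z (br x y) = 0)"

definition abelian_ideal :: "('v::real_vector \<Rightarrow> 'v \<Rightarrow> 'v) \<Rightarrow> 'v set \<Rightarrow> bool" where
  "abelian_ideal br V \<longleftrightarrow> subspace V \<and> (\<forall>x. \<forall>y\<in>V. br x y \<in> V) \<and> (\<forall>x\<in>V. \<forall>y\<in>V. br x y = 0)"

text \<open>
  The exterior derivative of left-invariant forms (Chevalley-Eilenberg differential):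
  \<open>d\<omega>(x\<^sub>0, \<dots>, x\<^sub>k) = \<Sum>\<^bsub>i<j\<^esub> (-1)\<^bsup>i+j\<^esup> \<omega>([x\<^sub>i, x\<^sub>j], x\<^sub>0, \<dots>, x\<^sub>k)\<close>, with \<open>x\<^sub>i\<close> and \<open>x\<^sub>j\<close> omitted
  from the last arguments.
\<close>

definition ext_deriv :: "('v \<Rightarrow> 'v \<Rightarrow> 'v) \<Rightarrow> 'v form \<Rightarrow> 'v form" where
  "ext_deriv br \<omega> = (\<lambda>xs. \<Sum>j<length xs. \<Sum>i<j.
     (- 1) ^ (i + j) * \<omega> (br (xs ! i) (xs ! j) # nths xs (- {i, j})))"

definition unimodular8 :: "(real^8 \<Rightarrow> real^8 \<Rightarrow> real^8) \<Rightarrow> bool" where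
  "unimodular8 br \<longleftrightarrow> \<not> (\<exists>\<eta>\<in>forms 7. ext_deriv br \<eta> = vol8)"

text \<open>
  The matrix of \<open>ad(e\<^sub>0)\<close> restricted to \<open>\<langle>e\<^sub>1, \<dots>, e\<^sub>7\<rangle>\<close>; matrix indices start at \<open>0\<close>, whence the shifts.
\<close>

definition ad0_mat :: "(real^8 \<Rightarrow> real^8 \<Rightarrow> real^8) \<Rightarrow> real mat" where
  "ad0_mat br =
     Matrix.mat 7 7 (\<lambda>(i, j). inner (basis8 (i + 1)) (br (basis8 0) (basis8 (j + 1))))"

definition sym_part :: "real mat \<Rightarrow> real mat" where
  "sym_part A = (1/2) \<cdot>\<^sub>m (A + transpose_mat A)"

definition skew_part :: "real mat \<Rightarrow> real mat" where
  "skew_part A = (1/2) \<cdot>\<^sub>m (A - transpose_mat A)"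

definition complex_eigenvalues :: "real mat \<Rightarrow> complex multiset" where
  "complex_eigenvalues A = proots (char_poly (map_mat complex_of_real A))"


section \<open>Spin(7) structures\<close>

definition Omega0 :: "(real^8) form" where
  "Omega0 = (\<lambda>xs.
       wedge8 [0,1,2,3] xs - wedge8 [0,1,4,5] xs - wedge8 [0,1,6,7] xs - wedge8 [0,2,4,6] xs
     + wedge8 [0,2,5,7] xs - wedge8 [0,3,4,7] xs - wedge8 [0,3,5,6] xs + wedge8 [4,5,6,7] xs
     - wedge8 [2,3,6,7] xs - wedge8 [2,3,4,5] xs - wedge8 [1,3,5,7] xs + wedge8 [1,3,4,6] xs
     - wedge8 [1,2,5,6] xs - wedge8 [1,2,4,7] xs)"

definition spin7_structure :: "(real^8) form \<Rightarrow> bool" where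
  "spin7_structure \<Omega> \<longleftrightarrow>
     (\<exists>\<phi> :: real^8^8. rotation_matrix \<phi> \<and> \<Omega> = pullback (\<lambda>x. \<phi> *v x) Omega0)"

definition Lambda3_8 :: "(real^8) form \<Rightarrow> (real^8) form set" where
  "Lambda3_8 \<Omega> = {interior_product x \<Omega> | x. True}"

definition Lambda3_48 :: "(real^8) form \<Rightarrow> (real^8) form set" where
  "Lambda3_48 \<Omega> = {\<alpha> \<in> forms 3. wedge \<alpha> \<Omega> = (\<lambda>_. 0)}"

definition spin7_parallel :: "(real^8 \<Rightarrow> real^8 \<Rightarrow> real^8) \<Rightarrow> (real^8) form \<Rightarrow> bool" where
  "spin7_parallel br \<Omega> \<longleftrightarrow> hodge8 (ext_deriv br \<Omega>) = (\<lambda>_. 0)"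

definition spin7_lcp :: "(real^8 \<Rightarrow> real^8 \<Rightarrow> real^8) \<Rightarrow> (real^8) form \<Rightarrow> bool" where
  "spin7_lcp br \<Omega> \<longleftrightarrow> hodge8 (ext_deriv br \<Omega>) \<in> Lambda3_8 \<Omega>"

definition spin7_balanced :: "(real^8 \<Rightarrow> real^8 \<Rightarrow> real^8) \<Rightarrow> (real^8) form \<Rightarrow> bool" where
  "spin7_balanced br \<Omega> \<longleftrightarrow> hodge8 (ext_deriv br \<Omega>) \<in> Lambda3_48 \<Omega>"

definition spin7_mixed :: "(real^8 \<Rightarrow> real^8 \<Rightarrow> real^8) \<Rightarrow> (real^8) form \<Rightarrow> bool" where
  "spin7_mixed br \<Omega> \<longleftrightarrow>
     \<not> spin7_parallel br \<Omega> \<and> \<not> spin7_lcp br \<Omega> \<and> \<not> spin7_balanced br \<Omega>"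

definition spin7_eigenvalues :: "real \<Rightarrow> real \<Rightarrow> complex multiset" where
  "spin7_eigenvalues l1 l2 =
     {#0, l1 * \<i>, - (l1 * \<i>), l2 * \<i>, - (l2 * \<i>), (l1 + l2) * \<i>, - ((l1 + l2) * \<i>)#}"

end

theory Submission
  imports Defs "HOL-Combinatorics.Multiset_Permutations"
begin

no_notation Matrix.scalar_prod (infix "\<bullet>" 70)
no_notation Matrix.vec_index (infixl "$" 100)
unbundle no fps_syntax

text \<open>
  A bracket with abelian ideal \<open>\<real>\<^sup>7\<close> is \<open>[x, y] = x\<^sub>0 T y - y\<^sub>0 T x\<close> with \<open>T = ad(e\<^sub>0)\<close>. The group
  \<open>Spin(7)\<close>, generated by left multiplications by imaginary unit octonions, acts transitively on
  \<open>S\<^sup>7\<close>, so every \<open>Spin(7)\<close> structure is \<open>h\<^sup>*\<Omega>\<^sub>0\<close> with \<open>h\<close> orthogonal and \<open>h e\<^sub>0 = e\<^sub>0\<close>; pulling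
  back replaces \<open>T\<close> by \<open>h T h\<^sup>-\<^sup>1\<close> and fixes the form. For \<open>\<Omega>\<^sub>0\<close> one has \<open>d\<Omega>\<^sub>0 = - e\<^sup>0 \<and> T\<cdot>\<Omega>\<^sub>0\<close>,
  and the three conditions become linear in the entries of \<open>T\<close>: its skew part lies in \<open>\<gg>\<^sub>2\<close>, and
  its symmetric part is \<open>0\<close>, scalar, or traceless. A skew matrix with eigenvalues \<open>0, \<plusminus>i m\<^sub>1, \<plusminus>i
  m\<^sub>2, \<plusminus>i m\<^sub>3\<close>, \<open>m\<^sub>j \<ge> 0\<close>, is orthogonally conjugate into \<open>\<gg>\<^sub>2\<close> iff one \<open>m\<^sub>j\<close> is the sum of the
  other two: elements of \<open>\<gg>\<^sub>2\<close> satisfy \<open>4 tr C\<^sup>4 = (tr C\<^sup>2)\<^sup>2\<close>, which factors as \<open>(m\<^sub>1 + m\<^sub>2 +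
  m\<^sub>3) (m\<^sub>2 + m\<^sub>3 - m\<^sub>1) (m\<^sub>1 + m\<^sub>3 - m\<^sub>2) (m\<^sub>1 + m\<^sub>2 - m\<^sub>3) = 0\<close>. Finally, a nonzero skew matrix
  and all its conjugates by coordinate reflections cannot simultaneously lie in \<open>\<gg>\<^sub>2\<close>.
\<close>


subsection \<open>Alternating forms\<close>

text \<open>The identity 4 tr C^4 = (tr C^2)^2 has a conceptual source: the invariant polynomials of
  g2 are generated in degrees 2 and 6, so the quartic trace must be a multiple of the square of the
  quadratic one, and an element with eigenvalues 0, 0, 0, +-i, +-i fixes the factor 4. Used in place
  of a maximal torus of G2, it makes the necessity of the eigenvalue condition a polynomial
  computation. The quartic in the m's is that of Heron's formula, hence its factorisation.
  Orientation is the other obstacle: a Spin(7) structure comes from a rotation, while normal forms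
  and reflections produce isometries of either determinant. The map -1 on R^7 has determinant -1 and
  commutes with T, so composing with it restores the orientation without changing the conjugate of
  T. Each of the three types requires the skew part of the conjugate to lie in g2; hence a conjugate
  outside g2 gives a mixed structure. The other conditions are invariant under conjugation.\<close>

text \<open>
  Alternation is only required for adjacent equal arguments, a condition that survives the recursions
  over argument lists below.
\<close>

definition altform :: "nat \<Rightarrow> 'v::real_vector form \<Rightarrow> bool" where
  "altform k \<omega> \<longleftrightarrow> (\<forall>xs. length xs \<noteq> k \<longrightarrow> \<omega> xs = 0) \<and>
     (\<forall>us vs. linear (\<lambda>x. \<omega> (us @ x # vs))) \<and> (\<forall>us a vs. \<omega> (us @ a # a # vs) = 0)"

lemma altformI:
  assumes "\<And>xs. length xs \<noteq> k \<Longrightarrow> \<omega> xs = 0" "\<And>us vs. linear (\<lambda>x. \<omega> (us @ x # vs))"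
    "\<And>us a vs. \<omega> (us @ a # a # vs) = 0"
  shows "altform k \<omega>"
  using assms unfolding altform_def by blast

lemma altform_length: "altform k \<omega> \<Longrightarrow> length xs \<noteq> k \<Longrightarrow> \<omega> xs = 0"
  and altform_linear: "altform k \<omega> \<Longrightarrow> linear (\<lambda>x. \<omega> (us @ x # vs))"
  and altform_adjacent: "altform k \<omega> \<Longrightarrow> \<omega> (us @ a # a # vs) = 0"
  unfolding altform_def by blast+

lemma altform_linear_hd: "altform k \<omega> \<Longrightarrow> linear (\<lambda>x. \<omega> (x # vs))"
  using altform_linear[of k \<omega> "[]" vs] by simp

lemma altform_adjacent_hd: "altform k \<omega> \<Longrightarrow> \<omega> (a # a # vs) = 0"
  using altform_adjacent[of k \<omega> "[]" a vs] by simp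

lemma altform_zero: "altform k (\<lambda>_. 0)"
  by (rule altformI) (auto simp: linear_iff)

text \<open>For \<open>k = 0\<close> the contraction is the zero form, which is alternating in every
  degree, so the truncated \<open>k - 1\<close> stays correct. Contraction in the first slot drives
  the inductions for \<open>wedge\<close>, \<open>act\<close> and \<open>ext_deriv\<close>.\<close>

lemma altform_contract:
  assumes "altform k \<omega>"
  shows "altform (k - 1) (\<lambda>ys. \<omega> (x # ys))"
proof (cases "k = 0")
  case True
  then have "(\<lambda>ys. \<omega> (x # ys)) = (\<lambda>_. 0)"
    using altform_length[OF assms] by auto
  then show ?thesis by (simp add: altform_zero)
next
  case False
  show ?thesis
  proof (rule altformI)
    fix xs :: "'a list" assume "length xs \<noteq> k - 1"
    then show "\<omega> (x # xs) = 0" using altform_length[OF assms, of "x # xs"] False by simp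
  next
    fix us vs show "linear (\<lambda>y. \<omega> (x # us @ y # vs))"
      using altform_linear[OF assms, of "x # us" vs] by simp
  next
    fix us a vs show "\<omega> (x # us @ a # a # vs) = 0"
      using altform_adjacent[OF assms, of "x # us" a vs] by simp
  qed
qed

lemma altform_add: "altform k \<alpha> \<Longrightarrow> altform k \<beta> \<Longrightarrow> altform k (\<lambda>xs. \<alpha> xs + \<beta> xs)"
  by (rule altformI)
    (auto simp: altform_length altform_adjacent intro: linear_compose_add[OF altform_linear altform_linear])

text \<open>The factor may depend on the length of the list because replacing an entry leaves the
  length fixed; this covers the sign \<open>(- 1) ^ length ys\<close> in
  \<open>wedge_Cons\<close>.\<close>

lemma altform_scale:
  assumes "altform k \<alpha>"
  shows "altform k (\<lambda>xs. c (length xs) * \<alpha> xs)"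
proof (rule altformI)
  fix us vs
  show "linear (\<lambda>x. c (length (us @ x # vs)) * \<alpha> (us @ x # vs))"
    using altform_linear[OF assms, of us vs] unfolding linear_iff by (simp add: algebra_simps)
qed (use assms in \<open>auto simp: altform_length altform_adjacent\<close>)

lemma altform_diff:
  assumes "altform k \<alpha>" "altform k \<beta>" shows "altform k (\<lambda>xs. \<alpha> xs - \<beta> xs)"
  using altform_add[OF assms(1) altform_scale[OF assms(2), of "\<lambda>_. - 1"]] by simp

lemma altform_sum:
  "(\<And>i. i \<in> I \<Longrightarrow> altform k (\<alpha> i)) \<Longrightarrow> altform k (\<lambda>xs. \<Sum>i\<in>I. \<alpha> i xs)"
  by (induction I rule: infinite_finite_induct) (auto simp: altform_zero altform_add)

lemma altform_swap:
  assumes "altform k \<omega>"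
  shows "\<omega> (us @ a # b # vs) = - \<omega> (us @ b # a # vs)"
proof -
  have add: "\<omega> (us' @ (x + y) # vs') = \<omega> (us' @ x # vs') + \<omega> (us' @ y # vs')" for us' x y vs'
    using linear_add[OF altform_linear[OF assms]] by blast
  have "0 = \<omega> (us @ (a + b) # (a + b) # vs)"
    by (simp add: altform_adjacent[OF assms])
  also have "\<dots> = \<omega> (us @ a # (a + b) # vs) + \<omega> (us @ b # (a + b) # vs)"
    by (rule add)
  also have "\<dots> = \<omega> (us @ a # b # vs) + \<omega> (us @ b # a # vs)"
    using add[of "us @ [a]" a b vs] add[of "us @ [b]" a b vs] by (simp add: altform_adjacent[OF assms])
  finally show ?thesis by simp
qed

lemma altform_swap_hd: "altform k \<omega> \<Longrightarrow> \<omega> (a # b # vs) = - \<omega> (b # a # vs)"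
  using altform_swap[of k \<omega> "[]" a b vs] by simp

text \<open>Adjacent transpositions generate all permutations: the head of \<open>xs\<close> is
  located in \<open>ys\<close> and moved to the front by swaps. The prefix \<open>us\<close> absorbs
  each settled entry during the induction.\<close>

lemma swap_invariant_mset:
  assumes swap: "\<And>us a b vs. G (us @ a # b # vs) = G (us @ b # a # vs)"
  shows "mset xs = mset ys \<Longrightarrow> G (us @ xs) = G (us @ ys)"
proof (induction xs arbitrary: us ys)
  case Nil
  then show ?case by simp
next
  case (Cons a xs)
  then have "a \<in> set ys" by (metis list.set_intros(1) mset_eq_setD)
  then obtain vs ws where ys: "ys = vs @ a # ws" by (meson split_list)
  have front: "G (us' @ vs' @ a # ws) = G (us' @ a # vs' @ ws)" for us' vs'
  proof (induction vs' arbitrary: us')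
    case Nil
    then show ?case by simp
  next
    case (Cons v vs')
    show ?case using Cons[of "us' @ [v]"] swap[of us' v a "vs' @ ws"] by simp
  qed
  have "mset xs = mset (vs @ ws)" using Cons.prems ys by simp
  then have "G ((us @ [a]) @ xs) = G ((us @ [a]) @ vs @ ws)" by (rule Cons.IH)
  then show ?case using front[of us vs] ys by simp
qed

text \<open>The absolute value turns antisymmetry into the invariance asked for by
  \<open>swap_invariant_mset\<close>, so no sign of a permutation has to be computed; this is enough
  where only vanishing is at stake.\<close>

lemma altform_abs_mset:
  assumes "altform k \<omega>" "mset xs = mset ys"
  shows "\<bar>\<omega> xs\<bar> = \<bar>\<omega> ys\<bar>"
  using swap_invariant_mset[of "\<lambda>xs. \<bar>\<omega> xs\<bar>" xs ys "[]"] altform_swap[OF assms(1)] assms(2)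
  by (metis abs_minus_cancel append_Nil)

lemma altform_not_distinct:
  assumes "altform k \<omega>" "\<not> distinct xs"
  shows "\<omega> xs = 0"
proof -
  obtain us a vs ws where "xs = us @ [a] @ vs @ [a] @ ws"
    using not_distinct_decomp[OF assms(2)] by blast
  then have "mset xs = mset (a # a # us @ vs @ ws)" by simp
  then have "\<bar>\<omega> xs\<bar> = \<bar>\<omega> (a # a # us @ vs @ ws)\<bar>" by (rule altform_abs_mset[OF assms(1)])
  then show ?thesis using altform_adjacent_hd[OF assms(1)] by simp
qed

lemma forms_eq_altform: "forms k = {\<omega>. altform k \<omega>}"
proof (rule equalityI; rule subsetI)
  fix \<omega> :: "'a form" assume \<omega>: "\<omega> \<in> forms k"
  have len: "length xs \<noteq> k \<Longrightarrow> \<omega> xs = 0" for xs using \<omega> unfolding forms_def by blast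
  have lin: "length xs = k \<Longrightarrow> i < k \<Longrightarrow> linear (\<lambda>x. \<omega> (xs[i := x]))" for xs i
    using \<omega> unfolding forms_def by blast
  have "altform k \<omega>"
  proof (rule altformI)
    fix us vs
    show "linear (\<lambda>x. \<omega> (us @ x # vs))"
    proof (cases "length us + Suc (length vs) = k")
      case True
      have "linear (\<lambda>x. \<omega> ((us @ 0 # vs)[length us := x]))"
        by (rule lin) (use True in auto)
      then show ?thesis by simp
    next
      case False
      then show ?thesis using len by (simp add: linear_iff)
    qed
  next
    fix us a vs show "\<omega> (us @ a # a # vs) = 0"
      using \<omega> unfolding forms_def
      by (cases "length (us @ a # a # vs) = k") (fastforce, blast)
  qed (rule len)
  then show "\<omega> \<in> {\<omega>. altform k \<omega>}" by simp
next
  fix \<omega> :: "'a form" assume "\<omega> \<in> {\<omega>. altform k \<omega>}"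
  then have \<omega>: "altform k \<omega>" by simp
  have "linear (\<lambda>x. \<omega> (xs[i := x]))" if "length xs = k" "i < k" for xs i
    using altform_linear[OF \<omega>, of "take i xs" "drop (Suc i) xs"] that
    by (simp add: upd_conv_take_nth_drop)
  then show "\<omega> \<in> forms k"
    unfolding forms_def using altform_length[OF \<omega>] altform_not_distinct[OF \<omega>] by auto
qed

lemma pullback_altform:
  assumes "altform k \<omega>" "linear g"
  shows "altform k (pullback g \<omega>)"
proof (rule altformI)
  fix us vs
  show "linear (\<lambda>x. pullback g \<omega> (us @ x # vs))"
    using linear_compose[OF assms(2) altform_linear[OF assms(1), of "map g us" "map g vs"]]
    by (simp add: pullback_def o_def)
qed (use assms in \<open>auto simp: pullback_def altform_length altform_adjacent\<close>)


subsection \<open>Wedge products\<close>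

text \<open>Position 0 is now unchosen and precedes all \<open>card A\<close> chosen positions,
  which adds exactly the inversions \<open>(Suc i, 0)\<close>.\<close>

lemma shuffle_sign_Suc_image:
  assumes "A \<subseteq> {..<n}"
  shows "shuffle_sign (Suc n) (Suc ` A) = (- 1) ^ card A * shuffle_sign n A"
proof -
  let ?I = "{(i, j). i \<in> A \<and> j \<in> {..<n} - A \<and> j < i}"
  have fin: "finite A" using assms finite_subset by blast
  have finI: "finite ?I" by (rule finite_subset[of _ "A \<times> {..<n}"]) (use fin in auto)
  have "{(i, j). i \<in> Suc ` A \<and> j \<in> {..<Suc n} - Suc ` A \<and> j < i} =
      (\<lambda>(i, j). (Suc i, Suc j)) ` ?I \<union> (\<lambda>i. (Suc i, 0)) ` A" (is "?L = ?R")
  proof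
    show "?L \<subseteq> ?R"
    proof
      fix p assume "p \<in> ?L"
      then obtain i j where p: "p = (Suc i, j)" "i \<in> A" "j < Suc n" "j \<notin> Suc ` A" "j < Suc i" by auto
      then show "p \<in> ?R" by (cases j) (auto simp: image_iff)
    qed
  qed auto
  moreover have "card ?R = card ?I + card A"
    by (subst card_Un_disjoint) (use fin finI in \<open>auto simp: card_image inj_on_def\<close>)
  ultimately show ?thesis unfolding shuffle_sign_def by (simp add: power_add)
qed

lemma shuffle_sign_insert_0:
  "shuffle_sign (Suc n) (insert 0 (Suc ` A)) = shuffle_sign n A"
proof -
  let ?I = "{(i, j). i \<in> A \<and> j \<in> {..<n} - A \<and> j < i}"
  have "{(i, j). i \<in> insert 0 (Suc ` A) \<and> j \<in> {..<Suc n} - insert 0 (Suc ` A) \<and> j < i} =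
      (\<lambda>(i, j). (Suc i, Suc j)) ` ?I" (is "?L = ?R")
  proof
    show "?L \<subseteq> ?R"
    proof
      fix p assume "p \<in> ?L"
      then obtain i j where p: "p = (Suc i, j)" "i \<in> A" "j < Suc n" "j \<notin> insert 0 (Suc ` A)" "j < Suc i"
        by auto
      then show "p \<in> ?R" by (cases j) (auto simp: image_iff)
    qed
  qed auto
  then show ?thesis unfolding shuffle_sign_def by (simp add: card_image inj_on_def)
qed

lemma sum_Pow_lessThan_Suc:
  "(\<Sum>A\<in>Pow {..<Suc n}. f A) = (\<Sum>A\<in>Pow {..<n}. f (insert 0 (Suc ` A)) + f (Suc ` A))"
proof -
  have inj: "inj_on (image Suc) (Pow {..<n})" "inj_on (insert 0) (Pow (Suc ` {..<n}))"
    by (auto simp: inj_on_def)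
  have "Pow {..<Suc n} = Pow (Suc ` {..<n}) \<union> insert 0 ` Pow (Suc ` {..<n})"
    by (simp add: lessThan_Suc_eq_insert_0 Pow_insert)
  then have "(\<Sum>A\<in>Pow {..<Suc n}. f A) =
      (\<Sum>A\<in>Pow (Suc ` {..<n}). f A) + (\<Sum>A\<in>insert 0 ` Pow (Suc ` {..<n}). f A)"
    by (subst sum.union_disjoint[symmetric]) auto
  also have "\<dots> = (\<Sum>A\<in>Pow (Suc ` {..<n}). f (insert 0 A) + f A)"
    using inj by (simp add: sum.reindex sum.distrib add.commute)
  also have "Pow (Suc ` {..<n}) = image Suc ` Pow {..<n}" by (simp add: image_Pow_surj)
  also have "(\<Sum>A\<in>image Suc ` Pow {..<n}. f (insert 0 A) + f A) =
      (\<Sum>A\<in>Pow {..<n}. f (insert 0 (Suc ` A)) + f (Suc ` A))"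
    using inj by (subst sum.reindex) auto
  finally show ?thesis .
qed

text \<open>Contraction is an antiderivation: the first argument goes either to \<alpha> or past it
  to \<beta>, the latter with sign (-1)^p. The sign is read off the list length, which keeps the
  rule free of degrees.\<close>

lemma wedge_Cons:
  "wedge \<alpha> \<beta> (x # xs) = wedge (\<lambda>ys. \<alpha> (x # ys)) \<beta> xs +
     wedge (\<lambda>ys. (- 1) ^ length ys * \<alpha> ys) (\<lambda>ys. \<beta> (x # ys)) xs"
proof -
  have c: "{j. Suc j \<in> insert 0 (Suc ` A)} = A" "{j. Suc j \<in> Suc ` A} = A"
    "{j. Suc j \<notin> insert 0 (Suc ` A)} = - A" "{j. Suc j \<notin> Suc ` A} = - A" for A
    by auto
  have len: "length (nths xs A) = card A" if "A \<subseteq> {..<length xs}" for A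
    unfolding length_nths by (rule arg_cong[where f = card]) (use that in auto)
  show ?thesis
    unfolding wedge_def length_Cons sum_Pow_lessThan_Suc sum.distrib[symmetric]
    by (rule sum.cong) (auto simp: nths_Cons c len shuffle_sign_Suc_image shuffle_sign_insert_0)
qed

lemma wedge_Nil: "wedge \<alpha> \<beta> [] = \<alpha> [] * \<beta> []"
  by (simp add: wedge_def shuffle_sign_def)

lemma wedge_zero_left: "wedge (\<lambda>_. 0) \<beta> xs = 0"
  and wedge_zero_right: "wedge \<alpha> (\<lambda>_. 0) xs = 0"
  by (simp_all add: wedge_def)

lemma wedge_linear_left:
  assumes "\<And>ys. linear (\<lambda>x. \<alpha> x ys)"
  shows "linear (\<lambda>x. wedge (\<alpha> x) \<beta> xs)"
  unfolding linear_iff wedge_def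
  by (simp add: linear_add[OF assms] linear_cmul[OF assms] algebra_simps sum.distrib sum_distrib_left)

lemma wedge_linear_right:
  assumes "\<And>ys. linear (\<lambda>x. \<beta> x ys)"
  shows "linear (\<lambda>x. wedge \<alpha> (\<beta> x) xs)"
  unfolding linear_iff wedge_def
  by (simp add: linear_add[OF assms] linear_cmul[OF assms] algebra_simps sum.distrib sum_distrib_left)

lemma wedge_altform:
  fixes \<alpha> \<beta> :: "'v::real_vector form"
  assumes "altform p \<alpha>" "altform q \<beta>"
  shows "altform (p + q) (wedge \<alpha> \<beta>)"
proof (rule altformI)
  note sgn = altform_scale[of _ _ "\<lambda>n. (- 1) ^ n"]
  fix xs :: "'v list" assume len: "length xs \<noteq> p + q"
  show "wedge \<alpha> \<beta> xs = 0"
    unfolding wedge_def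
  proof (rule sum.neutral, rule ballI)
    fix A assume "A \<in> Pow {..<length xs}"
    then have "length (nths xs A) + length (nths xs (- A)) = length xs"
      unfolding length_nths
      by (subst card_Un_disjoint[symmetric]) (auto intro!: trans[OF arg_cong[where f = card] card_lessThan])
    then show "shuffle_sign (length xs) A * \<alpha> (nths xs A) * \<beta> (nths xs (- A)) = 0"
      using len altform_length[OF assms(1)] altform_length[OF assms(2)]
      by (cases "length (nths xs A) = p") auto
  qed
next
  note sgn = altform_scale[of _ _ "\<lambda>n. (- 1) ^ n"]
  fix us vs :: "'v list"
  show "linear (\<lambda>x. wedge \<alpha> \<beta> (us @ x # vs))"
    using assms
  proof (induction us arbitrary: p q \<alpha> \<beta>)
    case Nil
    then show ?case
      by (auto simp: wedge_Cons intro!: linear_compose_add wedge_linear_left wedge_linear_right altform_linear_hd)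
  next
    case (Cons u us)
    show ?case
      by (auto simp: wedge_Cons intro!: linear_compose_add
          intro: Cons.IH[OF altform_contract Cons.prems(2)] Cons.IH[OF sgn altform_contract] Cons.prems)
  qed
next
  note sgn = altform_scale[of _ _ "\<lambda>n. (- 1) ^ n"]
  fix us vs :: "'v list" and a
  show "wedge \<alpha> \<beta> (us @ a # a # vs) = 0"
    using assms
  proof (induction us arbitrary: p q \<alpha> \<beta>)
    case Nil
    \<comment> \<open>Two contractions with \<open>a\<close> leave two mixed terms, with one
      \<open>a\<close> in each factor; they differ by one sign, from the longer argument list of
      \<alpha>, and cancel.\<close>
    have "wedge (\<lambda>ys. (- 1) ^ length ys * - \<alpha> (a # ys)) (\<lambda>ys. \<beta> (a # ys)) vs =
      - wedge (\<lambda>ys. (- 1) ^ length ys * \<alpha> (a # ys)) (\<lambda>ys. \<beta> (a # ys)) vs"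
      by (simp add: wedge_def sum_negf)
    then show ?case
      by (simp add: wedge_Cons altform_adjacent_hd[OF Nil(1)] altform_adjacent_hd[OF Nil(2)]
          wedge_zero_left wedge_zero_right)
  next
    case (Cons u us)
    show ?case
      by (simp add: wedge_Cons Cons.IH[OF altform_contract[OF Cons.prems(1)] Cons.prems(2)]
          Cons.IH[OF sgn[OF Cons.prems(1)] altform_contract[OF Cons.prems(2)]])
  qed
qed

lemma wedge_pullback: "wedge (pullback g \<alpha>) (pullback g \<beta>) = pullback g (wedge \<alpha> \<beta>)"
  by (simp add: wedge_def pullback_def nths_map)


subsection \<open>The exterior derivative\<close>

text \<open>The derivation induced by \<open>T\<close>: the sum over all slots of the form with
  \<open>T\<close> inserted there, without the minus sign of the dual action.\<close>

fun act :: "('v \<Rightarrow> 'v) \<Rightarrow> 'v form \<Rightarrow> 'v form" where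
  "act T \<omega> [] = 0"
| "act T \<omega> (x # xs) = \<omega> (T x # xs) + act T (\<lambda>ys. \<omega> (x # ys)) xs"

lemma act_zero: "act T (\<lambda>_. 0) xs = 0"
  by (induction xs) auto

lemma act_length: "altform k \<omega> \<Longrightarrow> length xs \<noteq> k \<Longrightarrow> act T \<omega> xs = 0"
proof (induction xs arbitrary: k \<omega>)
  case (Cons x xs)
  show ?case
  proof (cases k)
    case 0
    then have "(\<lambda>ys. \<omega> (y # ys)) = (\<lambda>_. 0)" for y
      using altform_length[OF Cons.prems(1)] by auto
    then show ?thesis using act_zero by (metis act.simps(2) add.right_neutral)
  next
    case (Suc k')
    then show ?thesis using Cons.IH[OF altform_contract[OF Cons.prems(1)]] Cons.prems(2)
      altform_length[OF Cons.prems(1)] by simp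
  qed
qed simp

lemma act_linear_form: "(\<And>ys. linear (\<lambda>x. \<omega> x ys)) \<Longrightarrow> linear (\<lambda>x. act T (\<omega> x) xs)"
proof (induction xs arbitrary: \<omega>)
  case Nil
  show ?case by (simp add: linear_iff)
next
  case (Cons y xs)
  show ?case by (auto intro!: linear_compose_add Cons)
qed

lemma act_linear_map:
  assumes "altform k \<omega>" "\<And>y. linear (\<lambda>x. T x y)"
  shows "linear (\<lambda>x. act (T x) \<omega> xs)"
  using assms(1)
proof (induction xs arbitrary: k \<omega>)
  case Nil
  show ?case by (simp add: linear_iff)
next
  case (Cons y xs)
  have "linear (\<lambda>x. \<omega> (T x y # xs))"
    using linear_compose[OF assms(2) altform_linear_hd[OF Cons.prems]] by (simp add: o_def)
  then show ?case using Cons.IH[OF altform_contract[OF Cons.prems]]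
    by (auto intro!: linear_compose_add)
qed

lemma act_adjacent:
  assumes "altform k \<omega>" shows "act T \<omega> (us @ a # a # vs) = 0"
  using assms
proof (induction us arbitrary: k \<omega>)
  case Nil
  then show ?case
    using altform_swap_hd[OF Nil, of "T a" a vs]
    by (simp add: altform_adjacent_hd[OF Nil] act_zero)
next
  case (Cons u us)
  then show ?case
    using altform_adjacent[OF Cons.prems, of "T u # us"] Cons.IH[OF altform_contract[OF Cons.prems]]
    by simp
qed

lemma act_linear_slot:
  assumes "altform k \<omega>" "linear T" shows "linear (\<lambda>x. act T \<omega> (us @ x # vs))"
  using assms(1)
proof (induction us arbitrary: k \<omega>)
  case Nil
  have "linear (\<lambda>x. \<omega> (T x # vs))"
    using linear_compose[OF assms(2) altform_linear_hd[OF Nil]] by (simp add: o_def)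
  then show ?case
    by (auto intro!: linear_compose_add act_linear_form altform_linear_hd[OF Nil])
next
  case (Cons u us)
  then show ?case
    using altform_linear[OF Cons.prems, of "T u # us"] Cons.IH[OF altform_contract[OF Cons.prems]]
    by (auto intro!: linear_compose_add)
qed

text \<open>Moving \<open>T (xs ! j)\<close> to the front past \<open>j\<close> entries costs
  \<open>(- 1) ^ j\<close>; the result has the shape of a part of the double sum in
  \<open>ext_deriv\<close>.\<close>

lemma act_eq_sum:
  assumes "altform k \<omega>"
  shows "act T \<omega> xs = (\<Sum>j<length xs. (- 1) ^ j * \<omega> (T (xs ! j) # nths xs (- {j})))"
  using assms
proof (induction xs arbitrary: k \<omega>)
  case (Cons x xs)
  have "{j. Suc j \<in> - {0}} = UNIV" "{j'. Suc j' \<in> - {Suc j}} = - {j}" for j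
    by auto
  then show ?case
    using Cons.IH[OF altform_contract[OF Cons.prems]] altform_swap_hd[OF Cons.prems, of x]
    by (simp add: sum.lessThan_Suc_shift nths_Cons nths_all sum_negf del: sum.lessThan_Suc)
qed simp

lemma ext_deriv_Nil: "ext_deriv br \<omega> [] = 0"
  by (simp add: ext_deriv_def)

text \<open>Cartan's formula i(x) d + d i(x) = L(x) for left-invariant forms, with L(x) = -
  \<open>act (br x)\<close>: pairs of arguments containing \<open>x\<close> give the first term, the
  others the second.\<close>

lemma ext_deriv_Cons:
  assumes "altform k \<omega>"
  shows "ext_deriv br \<omega> (x # xs) = - act (br x) \<omega> xs - ext_deriv br (\<lambda>ys. \<omega> (x # ys)) xs"
proof -
  have "{k. Suc k \<in> - {0, Suc j}} = - {j}" "{k. Suc k \<in> - {Suc i, Suc j}} = - {i, j}" for i j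
    by auto
  then show ?thesis
    unfolding act_eq_sum[OF assms] unfolding ext_deriv_def
    using altform_swap_hd[OF assms, of _ x]
    by (simp add: sum.lessThan_Suc_shift nths_Cons sum_subtractf sum_negf del: sum.lessThan_Suc)
qed

lemma ext_deriv_zero: "ext_deriv br (\<lambda>_. 0) xs = 0"
  by (simp add: ext_deriv_def)

lemma ext_deriv_linear_form:
  assumes "\<And>ys. linear (\<lambda>x. \<omega> x ys)" shows "linear (\<lambda>x. ext_deriv br (\<omega> x) xs)"
  unfolding linear_iff ext_deriv_def
  by (simp add: linear_add[OF assms] linear_cmul[OF assms] algebra_simps sum.distrib sum_distrib_left)

lemma ext_deriv_altform:
  fixes \<omega> :: "'v::real_vector form"
  assumes \<omega>: "altform k \<omega>" and br: "bilinear br" "\<And>x. br x x = 0"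
  shows "altform (Suc k) (ext_deriv br \<omega>)"
proof (rule altformI)
  fix xs :: "'v list" assume "length xs \<noteq> Suc k"
  then show "ext_deriv br \<omega> xs = 0"
    using \<omega>
  proof (induction xs arbitrary: k \<omega>)
    case (Cons x xs)
    have "ext_deriv br (\<lambda>ys. \<omega> (x # ys)) xs = 0"
    proof (cases k)
      case 0
      then have "(\<lambda>ys. \<omega> (x # ys)) = (\<lambda>_. 0)"
        using altform_length[OF Cons.prems(2)] by auto
      then show ?thesis using ext_deriv_zero by metis
    next
      case (Suc k')
      then show ?thesis using Cons.IH[OF _ altform_contract[OF Cons.prems(2)]] Cons.prems(1) by simp
    qed
    then show ?case using Cons.prems by (simp add: ext_deriv_Cons act_length)
  qed (simp add: ext_deriv_Nil)
next
  have lin: "linear (\<lambda>x. br x y)" "linear (br y)" for y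
    using br(1) unfolding bilinear_def by auto
  fix us vs :: "'v list"
  show "linear (\<lambda>x. ext_deriv br \<omega> (us @ x # vs))"
    using \<omega>
  proof (induction us arbitrary: k \<omega>)
    case Nil
    then show ?case
      by (auto simp: ext_deriv_Cons intro!: linear_compose_sub linear_compose_neg ext_deriv_linear_form
          altform_linear_hd act_linear_map[OF Nil lin(1)])
  next
    case (Cons u us)
    show ?case
      by (auto simp: ext_deriv_Cons[OF Cons.prems] intro!: linear_compose_sub linear_compose_neg
          Cons.IH[OF altform_contract[OF Cons.prems]] act_linear_slot[OF Cons.prems lin(2)])
  qed
next
  fix us vs :: "'v list" and a
  show "ext_deriv br \<omega> (us @ a # a # vs) = 0"
    using \<omega>
  proof (induction us arbitrary: k \<omega>)
    case Nil
    \<comment> \<open>Applying \<open>ext_deriv_Cons\<close> twice, the two \<open>act\<close> terms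
      cancel, and what remains contains \<open>br a a = 0\<close> or a repeated
      \<open>a\<close>.\<close>
    have "\<omega> (0 # vs) = 0" using linear_0[OF altform_linear_hd[OF Nil]] .
    then show ?case
      by (simp add: ext_deriv_Cons[OF Nil] ext_deriv_Cons[OF altform_contract[OF Nil]] br
          altform_adjacent_hd[OF Nil] ext_deriv_zero)
  next
    case (Cons u us)
    show ?case
      by (simp add: ext_deriv_Cons[OF Cons.prems] act_adjacent[OF Cons.prems]
          Cons.IH[OF altform_contract[OF Cons.prems]])
  qed
qed

lemma ext_deriv_pullback:
  assumes "\<And>x y. g (br x y) = br' (g x) (g y)"
  shows "ext_deriv br (pullback g \<omega>) = pullback g (ext_deriv br' \<omega>)"
proof
  fix xs
  show "ext_deriv br (pullback g \<omega>) xs = pullback g (ext_deriv br' \<omega>) xs"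
    unfolding ext_deriv_def pullback_def
    by (auto intro!: sum.cong simp: assms nths_map)
qed


subsection \<open>Components in the standard basis\<close>

text \<open>The numeral type \<open>8\<close> is arithmetic modulo 8, so \<open>basis8\<close> is
  periodic in its index; its values are distinct only below 8, whence the index bounds.\<close>

lemma of_nat_8_eq_iff: "i < 8 \<Longrightarrow> j < 8 \<Longrightarrow> (of_nat i :: 8) = of_nat j \<longleftrightarrow> i = j"
proof -
  have "Rep_bit0 (of_nat k :: 8) = int k" if "k < 8" for k
    using that by (simp add: bit0.of_nat_eq bit0.Abs_inverse)
  then show "i < 8 \<Longrightarrow> j < 8 \<Longrightarrow> (of_nat i :: 8) = of_nat j \<longleftrightarrow> i = j"
    by (metis of_nat_eq_iff)
qed

lemma bij_of_nat_8: "bij_betw (of_nat :: nat \<Rightarrow> 8) {..<8} UNIV"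
proof -
  have inj: "inj_on (of_nat :: nat \<Rightarrow> 8) {..<8}"
    by (auto simp: inj_on_def of_nat_8_eq_iff)
  then have "card ((of_nat :: nat \<Rightarrow> 8) ` {..<8}) = CARD(8)"
    by (simp add: card_image)
  then have "(of_nat :: nat \<Rightarrow> 8) ` {..<8} = UNIV"
    by (metis card_subset_eq finite subset_UNIV)
  then show ?thesis using inj by (simp add: bij_betw_def)
qed

lemma inner_basis8: "i < 8 \<Longrightarrow> j < 8 \<Longrightarrow> basis8 i \<bullet> basis8 j = (if i = j then 1 else 0)"
  by (simp add: basis8_def inner_axis_axis of_nat_8_eq_iff)

lemma inner_eq_sum_basis8: "x \<bullet> y = (\<Sum>i<8. (basis8 i \<bullet> x) * (basis8 i \<bullet> y))"
proof -
  have "x \<bullet> y = (\<Sum>i\<in>UNIV. x $ i * y $ i)" by (simp add: inner_vec_def)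
  also have "\<dots> = (\<Sum>i<8. x $ of_nat i * y $ of_nat i)"
    by (rule sum.reindex_bij_betw[OF bij_of_nat_8, symmetric])
  finally show ?thesis by (simp add: basis8_def inner_axis')
qed

lemma basis8_eqI: "(\<And>i. i < 8 \<Longrightarrow> basis8 i \<bullet> x = basis8 i \<bullet> y) \<Longrightarrow> x = y"
  by (subst vector_eq_rdot[symmetric], intro allI, subst (1 2) inner_eq_sum_basis8) simp

lemma basis8_expansion: "x = (\<Sum>i<8. (basis8 i \<bullet> x) *\<^sub>R basis8 i)"
proof (rule basis8_eqI)
  fix j :: nat assume "j < 8"
  have "basis8 j \<bullet> (\<Sum>i<8. (basis8 i \<bullet> x) *\<^sub>R basis8 i) = (\<Sum>i<8. (basis8 i \<bullet> x) * (basis8 j \<bullet> basis8 i))"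
    by (simp only: inner_sum_right inner_scaleR_right)
  also have "\<dots> = (\<Sum>i<8. if i = j then basis8 j \<bullet> x else 0)"
    using \<open>j < 8\<close> by (intro sum.cong) (auto simp: inner_basis8)
  also have "\<dots> = basis8 j \<bullet> x"
    using \<open>j < 8\<close> by (simp only: sum.delta finite_lessThan lessThan_iff if_True)
  finally show "basis8 j \<bullet> x = basis8 j \<bullet> (\<Sum>i<8. (basis8 i \<bullet> x) *\<^sub>R basis8 i)" by (rule sym)
qed

lemma linear_basis8:
  assumes "linear f" shows "f x = (\<Sum>i<8. (basis8 i \<bullet> x) *\<^sub>R f (basis8 i))"
  using arg_cong[OF basis8_expansion[of x], of f] by (simp only: linear_sum[OF assms] linear_cmul[OF assms])

lemma nths_upt:
  assumes "A \<subseteq> {..<n}"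
  shows "set (nths [0..<n] A) = A" "length (nths [0..<n] A) = card A"
proof -
  show "set (nths [0..<n] A) = A"
  proof
    show "A \<subseteq> set (nths [0..<n] A)"
    proof
      fix x assume "x \<in> A"
      with assms have "x = [0..<n] ! x" "x < length [0..<n]" by auto
      with \<open>x \<in> A\<close> show "x \<in> set (nths [0..<n] A)" unfolding set_nths by blast
    qed
  qed (auto simp: set_nths)
  then show "length (nths [0..<n] A) = card A"
    using distinct_card[of "nths [0..<n] A"] by simp
qed

text \<open>Multilinearity reduces to basis vectors, alternation to increasing index lists.
  Enumerating those as the length-\<open>k\<close> members of \<open>subseqs [0..<8]\<close> makes
  equality of forms a finite check.\<close>

lemma altform_eqI:
  assumes \<alpha>: "altform k \<alpha>" and \<beta>: "altform k \<beta>"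
    and eq: "\<And>I. I \<in> set (filter (\<lambda>I. length I = k) (subseqs [0..<8])) \<Longrightarrow>
      \<alpha> (map basis8 I) = \<beta> (map basis8 I)"
  shows "\<alpha> = \<beta>"
proof -
  define \<gamma> where "\<gamma> = (\<lambda>xs. \<alpha> xs - \<beta> xs)"
  have \<gamma>: "altform k \<gamma>" unfolding \<gamma>_def by (rule altform_diff[OF \<alpha> \<beta>])
  have basis: "\<gamma> (map basis8 I) = 0" if I: "set I \<subseteq> {..<8}" for I
  proof (cases "distinct I \<and> length I = k")
    case True
    from I have "set I \<in> set ` set (subseqs [0..<8])" by (intro subset_subseqs) auto
    then obtain S where S: "S \<in> set (subseqs [0..<8])" "set S = set I" by (metis imageE)
    then have "distinct S" using subseqs_distinctD distinct_upt by blast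
    then have mset: "mset I = mset S" using True S(2) set_eq_iff_mset_eq_distinct by metis
    then have "length S = k" using True by (metis size_mset)
    with S(1) have "S \<in> set (filter (\<lambda>I. length I = k) (subseqs [0..<8]))"
      by (simp only: set_filter mem_Collect_eq)
    then have "\<gamma> (map basis8 S) = 0" unfolding \<gamma>_def by (simp only: eq)
    moreover have "\<bar>\<gamma> (map basis8 I)\<bar> = \<bar>\<gamma> (map basis8 S)\<bar>"
      by (rule altform_abs_mset[OF \<gamma>]) (simp add: mset)
    ultimately show ?thesis by simp
  next
    case False
    then show ?thesis
      using altform_length[OF \<gamma>, of "map basis8 I"] altform_not_distinct[OF \<gamma>, of "map basis8 I"]
      by (auto simp: distinct_map)
  qed
  \<comment> \<open>Arguments are expanded one at a time; the prefix \<open>I\<close> collects the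
    slots that already hold basis vectors.\<close>
  have "\<gamma> (map basis8 I @ xs) = 0" if "set I \<subseteq> {..<8}" for I xs
    using that
  proof (induction xs arbitrary: I)
    case Nil
    then show ?case by (simp add: basis)
  next
    case (Cons x xs)
    have "\<gamma> (map basis8 I @ x # xs) = (\<Sum>i<8. (basis8 i \<bullet> x) *\<^sub>R \<gamma> (map basis8 I @ basis8 i # xs))"
      by (rule linear_basis8[OF altform_linear[OF \<gamma>]])
    also have "\<dots> = 0"
    proof (rule sum.neutral, rule ballI)
      fix i :: nat assume "i \<in> {..<8}"
      then show "(basis8 i \<bullet> x) *\<^sub>R \<gamma> (map basis8 I @ basis8 i # xs) = 0"
        using Cons.IH[of "I @ [i]"] Cons.prems by simp
    qed
    finally show ?case .
  qed
  from this[of "[]"] show ?thesis by (auto simp: \<gamma>_def)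
qed

lemma altform_dual8: "altform 1 (dual8 i)"
proof (rule altformI)
  fix us vs :: "(real^8) list"
  show "linear (\<lambda>x. dual8 i (us @ x # vs))"
    by (cases "us = [] \<and> vs = []") (auto simp: dual8_def linear_iff inner_add_right)
qed (auto simp: dual8_def)

lemma altform_one_form0: "altform 0 (one_form0 :: 'v::real_vector form)"
  by (rule altformI) (auto simp: one_form0_def linear_iff)

lemma altform_wedge8: "altform (length is) (wedge8 is)"
proof (induction "is")
  case Nil
  then show ?case by (simp add: wedge8_def altform_one_form0)
next
  case (Cons i "is")
  then show ?case using wedge_altform[OF altform_dual8 Cons, of i] by (simp add: wedge8_def)
qed

lemma altform_vol8: "altform 8 vol8"
  using altform_wedge8[of "[0, 1, 2, 3, 4, 5, 6, 7]"] by (simp add: vol8_def numeral_eq_Suc)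

lemma altform_Omega0: "altform 4 Omega0"
  unfolding Omega0_def
  using altform_wedge8[of "[a, b, c, d]" for a b c d]
  by (intro altform_add altform_diff) (simp_all add: numeral_eq_Suc)

lemma wedge_dual8_Nil: "wedge (dual8 i) \<omega> [] = 0"
  by (simp add: wedge_Nil dual8_def)

lemma wedge_one_form0: "wedge (\<lambda>ys. if ys = [] then c else 0) \<omega> xs = c * \<omega> xs"
proof (induction xs arbitrary: c \<omega>)
  case (Cons x xs)
  have "wedge (\<lambda>ys. (- 1) ^ length ys * (if ys = [] then c else 0)) (\<lambda>ys. \<omega> (x # ys)) xs = c * \<omega> (x # xs)"
    unfolding Cons.IH[of c "\<lambda>ys. \<omega> (x # ys)", symmetric]
    by (rule arg_cong[where f = "\<lambda>\<alpha>. wedge \<alpha> _ _"]) auto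
  then show ?case by (simp add: wedge_Cons wedge_zero_left)
qed (simp add: wedge_Nil)

lemma wedge_dual8_Cons:
  "wedge (dual8 i) \<omega> (x # xs) = (basis8 i \<bullet> x) * \<omega> xs - wedge (dual8 i) (\<lambda>ys. \<omega> (x # ys)) xs"
proof -
  have "wedge (\<lambda>ys. dual8 i (x # ys)) \<omega> xs = (basis8 i \<bullet> x) * \<omega> xs"
    unfolding wedge_one_form0[symmetric]
    by (rule arg_cong[where f = "\<lambda>\<alpha>. wedge \<alpha> _ _"]) (auto simp: dual8_def)
  moreover have "(\<lambda>ys. (- 1) ^ length ys * dual8 i ys) = (\<lambda>ys. - dual8 i ys)"
    by (auto simp: dual8_def)
  then have "wedge (\<lambda>ys. (- 1) ^ length ys * dual8 i ys) (\<lambda>ys. \<omega> (x # ys)) xs =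
      - wedge (dual8 i) (\<lambda>ys. \<omega> (x # ys)) xs"
    by (simp add: wedge_def sum_negf)
  ultimately show ?thesis by (simp add: wedge_Cons)
qed

text \<open>Laplace expansion along \<open>dual8 i\<close>: only the occurrence of \<open>i\<close>
  in \<open>js\<close> contributes, with the sign of its position. Evaluating \<open>wedge8\<close>
  on basis vectors thus becomes list rewriting.\<close>

lemma wedge_dual8_basis:
  assumes "i < 8" "set js \<subseteq> {..<8}" "distinct js"
  shows "wedge (dual8 i) \<omega> (map basis8 js) =
    (if i \<in> set js then (- 1) ^ length (takeWhile (\<lambda>j. j \<noteq> i) js) * \<omega> (map basis8 (remove1 i js)) else 0)"
  using assms(2,3)
proof (induction js arbitrary: \<omega>)
  case Nil
  then show ?case by (simp add: wedge_dual8_Nil)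
next
  case (Cons j js)
  then show ?case using assms(1) by (auto simp: wedge_dual8_Cons inner_basis8)
qed

lemma wedge8_Nil: "wedge8 [] xs = (if xs = [] then 1 else 0)"
  by (simp add: wedge8_def one_form0_def)

lemma wedge8_Cons: "wedge8 (i # is) xs = wedge (dual8 i) (wedge8 is) xs"
  by (simp add: wedge8_def)

lemma wedge8_basis_Cons:
  assumes "i < 8" "set js \<subseteq> {..<8}" "distinct js"
  shows "wedge8 (i # is) (map basis8 js) =
    (if i \<in> set js then (- 1) ^ length (takeWhile (\<lambda>j. j \<noteq> i) js) * wedge8 is (map basis8 (remove1 i js)) else 0)"
  unfolding wedge8_Cons by (rule wedge_dual8_basis[OF assms])

lemma vol8_basis: "vol8 (map basis8 [0, 1, 2, 3, 4, 5, 6, 7]) = 1"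
  unfolding vol8_def by (simp add: wedge8_basis_Cons wedge8_Nil del: list.map)


subsection \<open>Equivariance of the Hodge star\<close>

text \<open>Expanding both arguments in \<open>basis8\<close>, the coefficients add up to the Gram
  matrix of the basis moved by the inverse of \<open>g\<close>, which is the identity since that
  inverse is orthogonal too.\<close>

lemma orthonormal_trace:
  fixes B :: "real^8 \<Rightarrow> real^8 \<Rightarrow> real"
  assumes B: "\<And>y. linear (\<lambda>x. B x y)" "\<And>x. linear (B x)" and g: "orthogonal_transformation g"
  shows "(\<Sum>i<8. B (g (basis8 i)) (g (basis8 i))) = (\<Sum>i<8. B (basis8 i) (basis8 i))"
proof -
  have inv: "x \<bullet> g y = y \<bullet> Hilbert_Choice.inv g x" for x y
  proof -
    have "g (Hilbert_Choice.inv g x) = x"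
      using orthogonal_transformation_surj[OF g] by (rule surj_f_inv_f)
    then have "x \<bullet> g y = g (Hilbert_Choice.inv g x) \<bullet> g y" by simp
    also have "\<dots> = Hilbert_Choice.inv g x \<bullet> y"
      using g by (simp only: orthogonal_transformation_def)
    finally show ?thesis by (simp only: inner_commute)
  qed
  have gram: "(\<Sum>i<8. (basis8 a \<bullet> g (basis8 i)) * (basis8 c \<bullet> g (basis8 i))) = basis8 a \<bullet> basis8 c" for a c
  proof -
    have "(\<Sum>i<8. (basis8 a \<bullet> g (basis8 i)) * (basis8 c \<bullet> g (basis8 i))) =
        Hilbert_Choice.inv g (basis8 a) \<bullet> Hilbert_Choice.inv g (basis8 c)"
      unfolding inv by (rule inner_eq_sum_basis8[symmetric])
    also have "\<dots> = basis8 a \<bullet> basis8 c"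
      using orthogonal_transformation_inv[OF g] by (simp only: orthogonal_transformation_def)
    finally show ?thesis .
  qed
  let ?t = "\<lambda>x a c. (basis8 a \<bullet> x) * (basis8 c \<bullet> x) * B (basis8 a) (basis8 c)"
  have expand: "B x x = (\<Sum>a<8. \<Sum>c<8. ?t x a c)" for x
  proof -
    have "B x x = (\<Sum>a<8. (basis8 a \<bullet> x) *\<^sub>R B (basis8 a) x)" by (rule linear_basis8[OF B(1)])
    also have "\<dots> = (\<Sum>a<8. (basis8 a \<bullet> x) *\<^sub>R (\<Sum>c<8. (basis8 c \<bullet> x) *\<^sub>R B (basis8 a) (basis8 c)))"
      by (rule sum.cong[OF refl]) (subst linear_basis8[OF B(2)], rule refl)
    finally show ?thesis by (simp only: sum_distrib_left real_scaleR_def mult.assoc)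
  qed
  have "(\<Sum>i<8. B (g (basis8 i)) (g (basis8 i))) = (\<Sum>i<8. \<Sum>a<8. \<Sum>c<8. ?t (g (basis8 i)) a c)"
    by (rule sum.cong[OF refl]) (rule expand)
  also have "\<dots> = (\<Sum>a<8. \<Sum>i<8. \<Sum>c<8. ?t (g (basis8 i)) a c)"
    by (rule sum.swap)
  also have "\<dots> = (\<Sum>a<8. \<Sum>c<8. \<Sum>i<8. ?t (g (basis8 i)) a c)"
    by (rule sum.cong[OF refl]) (rule sum.swap)
  also have "\<dots> = (\<Sum>a<8. \<Sum>c<8. (basis8 a \<bullet> basis8 c) * B (basis8 a) (basis8 c))"
    by (simp only: sum_distrib_right[symmetric] gram)
  also have "\<dots> = (\<Sum>a<8. \<Sum>c<8. if c = a then B (basis8 a) (basis8 a) else 0)"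
    by (rule sum.cong[OF refl], rule sum.cong[OF refl]) (auto simp: inner_basis8)
  also have "\<dots> = (\<Sum>i<8. B (basis8 i) (basis8 i))"
    by (rule sum.cong[OF refl]) (simp only: sum.delta finite_lessThan lessThan_iff if_True)
  finally show ?thesis .
qed

text \<open>
  Unlike the sum over increasing tuples in \<^const>\<open>hodge8\<close>, the sum over all tuples of basis
  vectors can be moved to another orthonormal basis one slot at a time.
\<close>

fun sum_tuples :: "(nat \<Rightarrow> 'v) \<Rightarrow> nat \<Rightarrow> ('v list \<Rightarrow> real) \<Rightarrow> real" where
  "sum_tuples f 0 G = G []"
| "sum_tuples f (Suc k) G = (\<Sum>i<8. sum_tuples f k (\<lambda>xs. G (f i # xs)))"

lemma sum_tuples_sum: "(\<Sum>i\<in>I. sum_tuples f k (G i)) = sum_tuples f k (\<lambda>xs. \<Sum>i\<in>I. G i xs)"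
proof (induction k arbitrary: G)
  case (Suc k)
  have "(\<Sum>i\<in>I. sum_tuples f (Suc k) (G i)) = (\<Sum>j<8. \<Sum>i\<in>I. sum_tuples f k (\<lambda>xs. G i (f j # xs)))"
    unfolding sum_tuples.simps by (rule sum.swap)
  then show ?case using Suc by simp
qed simp

text \<open>For a fixed head the tail is handled by induction; then the head alone changes basis by
  \<open>orthonormal_trace\<close>, applied to the bilinear form with \<open>P\<close> in one
  variable and \<open>Q\<close> in the other.\<close>

lemma sum_tuples_orthonormal:
  assumes "\<And>us vs. linear (\<lambda>x. P (us @ x # vs))" "\<And>us vs. linear (\<lambda>x. Q (us @ x # vs))"
    and g: "orthogonal_transformation g"
  shows "sum_tuples (\<lambda>i. g (basis8 i)) k (\<lambda>xs. P xs * Q xs) = sum_tuples basis8 k (\<lambda>xs. P xs * Q xs)"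
  using assms(1,2)
proof (induction k arbitrary: P Q)
  case (Suc k)
  have lin: "linear (\<lambda>x. P (x # xs))" "linear (\<lambda>x. Q (x # xs))" for xs
    using Suc.prems[of "[]" xs] by simp_all
  have IH: "sum_tuples (\<lambda>i. g (basis8 i)) k (\<lambda>xs. P (y # xs) * Q (y # xs)) =
      sum_tuples basis8 k (\<lambda>xs. P (y # xs) * Q (y # xs))" for y
  proof (rule Suc.IH)
    fix us vs
    show "linear (\<lambda>x. P (y # us @ x # vs))" "linear (\<lambda>x. Q (y # us @ x # vs))"
      using Suc.prems[of "y # us" vs] by simp_all
  qed
  have "sum_tuples (\<lambda>i. g (basis8 i)) (Suc k) (\<lambda>xs. P xs * Q xs) =
      (\<Sum>i<8. sum_tuples basis8 k (\<lambda>xs. P (g (basis8 i) # xs) * Q (g (basis8 i) # xs)))"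
    by (simp only: sum_tuples.simps IH)
  also have "\<dots> = sum_tuples basis8 k (\<lambda>xs. \<Sum>i<8. P (g (basis8 i) # xs) * Q (g (basis8 i) # xs))"
    by (rule sum_tuples_sum)
  also have "\<dots> = sum_tuples basis8 k (\<lambda>xs. \<Sum>i<8. P (basis8 i # xs) * Q (basis8 i # xs))"
  proof -
    have "(\<Sum>i<8. P (g (basis8 i) # xs) * Q (g (basis8 i) # xs)) = (\<Sum>i<8. P (basis8 i # xs) * Q (basis8 i # xs))" for xs
    proof (rule orthonormal_trace[where B = "\<lambda>x y. P (x # xs) * Q (y # xs)", OF _ _ g])
      show "linear (\<lambda>x. P (x # xs) * Q (y # xs))" "linear (\<lambda>y. P (x # xs) * Q (y # xs))" for x y
        using linear_compose_scale_right[OF lin(1), of "Q (y # xs)" xs]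
          linear_compose_scale_right[OF lin(2), of "P (x # xs)" xs] by (simp_all add: mult.commute)
    qed
    then show ?thesis by (simp only:)
  qed
  also have "\<dots> = sum_tuples basis8 (Suc k) (\<lambda>xs. P xs * Q xs)"
    by (simp only: sum_tuples.simps sum_tuples_sum)
  finally show ?case .
qed (simp only: sum_tuples.simps)

lemma sum_tuples_eq_sum_lists:
  "sum_tuples f k G = (\<Sum>I\<in>{I. set I \<subseteq> {..<8} \<and> length I = k}. G (map f I))"
proof (induction k arbitrary: G)
  case 0
  have "{I :: nat list. set I \<subseteq> {..<8} \<and> length I = 0} = {[]}" by auto
  then show ?case by simp
next
  case (Suc k)
  let ?L = "{I :: nat list. set I \<subseteq> {..<8} \<and> length I = k}"
  have "(\<Sum>I\<in>{I. set I \<subseteq> {..<8} \<and> length I = Suc k}. G (map f I)) =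
      (\<Sum>(I, i)\<in>?L \<times> {..<8}. G (f i # map f I))"
    unfolding lists_length_Suc_eq by (subst sum.reindex) (auto simp: inj_on_def case_prod_unfold)
  also have "\<dots> = (\<Sum>i<8. \<Sum>I\<in>?L. G (f i # map f I))"
    by (subst sum.swap) (simp add: sum.cartesian_product)
  finally show ?case using Suc by simp
qed

text \<open>Each \<open>k\<close>-element index set is listed by \<open>fact k\<close> distinct
  tuples, on which a symmetric summand is constant; tuples with repetition contribute
  nothing.\<close>

lemma sum_tuples_symmetric:
  assumes sym: "\<And>I J. mset I = mset J \<Longrightarrow> G (map f I) = G (map f J)"
    and dist: "\<And>I. \<not> distinct I \<Longrightarrow> G (map f I) = 0"
  shows "sum_tuples f k G = fact k * (\<Sum>A\<in>{A. A \<subseteq> {..<8} \<and> card A = k}. G (map f (nths [0..<8] A)))"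
proof -
  let ?D = "{I :: nat list. set I \<subseteq> {..<8} \<and> length I = k \<and> distinct I}"
  have fin: "finite {I :: nat list. set I \<subseteq> {..<8} \<and> length I = k}"
    by (rule finite_lists_length_eq) simp
  have "sum_tuples f k G = (\<Sum>I\<in>?D. G (map f I))"
    unfolding sum_tuples_eq_sum_lists using fin dist by (intro sum.mono_neutral_right) auto
  also have "\<dots> = (\<Sum>A\<in>{A. A \<subseteq> {..<8} \<and> card A = k}. \<Sum>I\<in>{I\<in>?D. set I = A}. G (map f I))"
    by (rule sum.group[symmetric])
      (auto simp: distinct_card intro: finite_subset[OF _ fin] finite_subset[OF _ finite_Collect_subsets])
  also have "\<dots> = (\<Sum>A\<in>{A. A \<subseteq> {..<8} \<and> card A = k}. fact k * G (map f (nths [0..<8] A)))"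
  proof (rule sum.cong[OF refl])
    fix A :: "nat set" assume A: "A \<in> {A. A \<subseteq> {..<8} \<and> card A = k}"
    then have finA: "finite A" using finite_subset by blast
    have D: "{I\<in>?D. set I = A} = permutations_of_set A"
      using A by (auto simp: permutations_of_set_def distinct_card)
    have "G (map f I) = G (map f (nths [0..<8] A))" if "I \<in> permutations_of_set A" for I
    proof (rule sym)
      have "set I = A" "distinct I" using that by (auto simp: permutations_of_set_def)
      then show "mset I = mset (nths [0..<8] A)"
        using A by (subst set_eq_iff_mset_eq_distinct[symmetric]) (auto simp: nths_upt)
    qed
    then show "(\<Sum>I\<in>{I\<in>?D. set I = A}. G (map f I)) = fact k * G (map f (nths [0..<8] A))"
      unfolding D using A finA by (simp add: card_permutations_of_set)
  qed
  finally show ?thesis by (simp add: sum_distrib_left)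
qed

text \<open>Swapping two summation vectors changes the sign of both the form and
  \<open>vol8\<close>, so the product is symmetric and every increasing tuple is counted
  \<open>fact k\<close> times.\<close>

lemma hodge8_eq_sum_tuples:
  assumes \<omega>: "altform k \<omega>"
  shows "hodge8 \<omega> ys = sum_tuples basis8 k (\<lambda>xs. \<omega> xs * vol8 (xs @ ys)) / fact k"
proof -
  let ?G = "\<lambda>xs. \<omega> xs * vol8 (xs @ ys)"
  have "?G (us @ a # b # vs) = ?G (us @ b # a # vs)" for us a b vs
    using altform_swap[OF \<omega>, of us a b vs] altform_swap[OF altform_vol8, of us a b "vs @ ys"] by simp
  then have "mset xs = mset xs' \<Longrightarrow> ?G xs = ?G xs'" for xs xs'
    using swap_invariant_mset[of ?G xs xs' "[]"] by simp
  then have "sum_tuples basis8 k ?G = fact k * (\<Sum>A\<in>{A. A \<subseteq> {..<8} \<and> card A = k}. ?G (map basis8 (nths [0..<8] A)))"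
    by (intro sum_tuples_symmetric) (auto simp: altform_not_distinct[OF \<omega>] distinct_map)
  also have "(\<Sum>A\<in>{A. A \<subseteq> {..<8} \<and> card A = k}. ?G (map basis8 (nths [0..<8] A))) = hodge8 \<omega> ys"
    unfolding hodge8_def Let_def
    by (rule sum.mono_neutral_left) (auto simp: nths_upt altform_length[OF \<omega>])
  finally show ?thesis by simp
qed

text \<open>An 8-form is determined by one value, so the pullback of \<open>vol8\<close> under the
  inverse of \<open>g\<close> is a multiple of it. Only \<open>s \<noteq> 0\<close> is recorded,
  since the type conditions are insensitive to rescaling the 3-form.\<close>

lemma vol8_pullback:
  assumes g: "orthogonal_transformation g"
  obtains s where "s \<noteq> 0" "\<And>xs. vol8 xs = s * vol8 (map g xs)"
proof -
  let ?b = "map basis8 [0, 1, 2, 3, 4, 5, 6, 7]"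
  have scale: "vol8 (map f xs) = vol8 (map f ?b) * vol8 xs" if "linear f" for f xs
  proof -
    have "pullback f vol8 = (\<lambda>xs. vol8 (map f ?b) * vol8 xs)"
    proof (rule altform_eqI)
      show "altform 8 (pullback f vol8)" by (rule pullback_altform[OF altform_vol8 that])
      show "altform 8 (\<lambda>xs. vol8 (map f ?b) * vol8 xs)"
        using altform_scale[OF altform_vol8, of "\<lambda>_. vol8 (map f ?b)"] by simp
      fix I assume "I \<in> set (filter (\<lambda>I. length I = 8) (subseqs [0..<8]))"
      moreover have "filter (\<lambda>I. length I = 8) (subseqs [0..<8]) = [[0, 1, 2, 3, 4, 5, 6, 7]]"
        by code_simp
      ultimately have "I = [0, 1, 2, 3, 4, 5, 6, 7]" by (simp only: list.set) simp
      then show "pullback f vol8 (map basis8 I) = vol8 (map f ?b) * vol8 (map basis8 I)"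
        using vol8_basis by (simp add: pullback_def)
    qed
    from fun_cong[OF this, of xs] show ?thesis by (simp add: pullback_def)
  qed
  have lin: "linear g" "linear (Hilbert_Choice.inv g)"
    using g orthogonal_transformation_inv[OF g] by (auto simp: orthogonal_transformation_def)
  have "map (Hilbert_Choice.inv g) (map g xs) = xs" for xs
    using orthogonal_transformation_inj[OF g] by (simp add: o_def)
  then have eq: "vol8 xs = vol8 (map (Hilbert_Choice.inv g) ?b) * vol8 (map g xs)" for xs
    using scale[OF lin(2), of "map g xs"] by simp
  show thesis
    by (rule that[OF _ eq]) (use eq[of ?b] vol8_basis in auto)
qed

lemma hodge8_pullback:
  assumes g: "orthogonal_transformation g"
  obtains s where "s \<noteq> 0"
    "\<And>k \<omega>. altform k \<omega> \<Longrightarrow> hodge8 (pullback g \<omega>) = (\<lambda>ys. s * pullback g (hodge8 \<omega>) ys)"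
proof -
  obtain s where s: "s \<noteq> 0" "\<And>xs. vol8 xs = s * vol8 (map g xs)" using vol8_pullback[OF g] by blast
  have map: "sum_tuples f k (\<lambda>xs. G (map g xs)) = sum_tuples (\<lambda>i. g (f i)) k G" for f k and G :: "(real^8) list \<Rightarrow> real"
  proof (induction k arbitrary: G)
    case (Suc k)
    show ?case using Suc[of "\<lambda>xs. G (g (f i) # xs)" for i] by simp
  qed simp
  have scale: "sum_tuples f k (\<lambda>xs. s * G xs) = s * sum_tuples f k G" for f :: "nat \<Rightarrow> real^8" and k G
    by (induction k arbitrary: G) (simp_all add: sum_distrib_left)
  show thesis
  proof (rule that[OF s(1)], rule ext)
    fix k and \<omega> :: "(real^8) form" and ys assume \<omega>: "altform k \<omega>"
    have lin: "linear g" using g by (simp add: orthogonal_transformation_def)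
    have volys: "linear (\<lambda>x. vol8 ((us @ x # vs) @ map g ys))" for us vs
      using altform_linear[OF altform_vol8, of us "vs @ map g ys"] by simp
    have "hodge8 (pullback g \<omega>) ys =
        sum_tuples basis8 k (\<lambda>xs. s * (\<omega> (map g xs) * vol8 (map g xs @ map g ys))) / fact k"
      unfolding hodge8_eq_sum_tuples[OF pullback_altform[OF \<omega> lin]]
      by (subst s(2)) (simp add: pullback_def mult_ac)
    also have "\<dots> = s * sum_tuples (\<lambda>i. g (basis8 i)) k (\<lambda>xs. \<omega> xs * vol8 (xs @ map g ys)) / fact k"
      unfolding scale map[of basis8 k "\<lambda>xs. \<omega> xs * vol8 (xs @ map g ys)", symmetric] ..
    also have "\<dots> = s * sum_tuples basis8 k (\<lambda>xs. \<omega> xs * vol8 (xs @ map g ys)) / fact k"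
      by (subst sum_tuples_orthonormal[OF altform_linear[OF \<omega>] volys g]) simp
    finally show "hodge8 (pullback g \<omega>) ys = s * pullback g (hodge8 \<omega>) ys"
      by (simp add: hodge8_eq_sum_tuples[OF \<omega>] pullback_def)
  qed
qed

lemma altform_append:
  "altform n \<omega> \<Longrightarrow> altform (n - length xs) (\<lambda>ys. \<omega> (xs @ ys))"
proof (induction xs arbitrary: n \<omega>)
  case (Cons x xs)
  then show ?case using Cons.IH[OF altform_contract[OF Cons.prems]] by simp
qed simp

lemma hodge8_altform:
  assumes "altform k \<omega>" shows "altform (8 - k) (hodge8 \<omega>)"
  unfolding hodge8_def Let_def
proof (rule altform_sum)
  fix A assume "A \<in> Pow {..<8::nat}"
  let ?xs = "map basis8 (nths [0..<8] A)"
  show "altform (8 - k) (\<lambda>ys. \<omega> ?xs * vol8 (?xs @ ys))"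
  proof (cases "length ?xs = k")
    case True
    then show ?thesis
      using altform_scale[OF altform_append[OF altform_vol8], where c = "\<lambda>_. \<omega> ?xs"] by metis
  next
    case False
    then show ?thesis by (simp add: altform_length[OF assms] altform_zero)
  qed
qed

text \<open>Only the complement of \<open>J\<close> survives: another index set either meets
  \<open>J\<close>, which repeats a basis vector, or is properly smaller than the complement, which
  gives \<open>vol8\<close> too few arguments.\<close>

lemma hodge8_basis:
  assumes J: "set J \<subseteq> {..<8}" "distinct J"
  shows "hodge8 \<omega> (map basis8 J) =
    \<omega> (map basis8 (filter (\<lambda>i. i \<notin> set J) [0..<8])) *
    vol8 (map basis8 (filter (\<lambda>i. i \<notin> set J) [0..<8] @ J))"
proof -
  let ?C = "{..<8} - set J"
  have C: "nths [0..<8] ?C = filter (\<lambda>i. i \<notin> set J) [0..<8]"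
    by (rule sorted_distinct_set_unique) (auto simp: sorted_nths nths_upt sorted_wrt_filter)
  have zero: "vol8 (map basis8 (nths [0..<8] A) @ map basis8 J) = 0" if A: "A \<in> Pow {..<8} - {?C}" for A
  proof (cases "distinct (nths [0..<8] A @ J)")
    case True
    then have "A \<subseteq> ?C" using A nths_upt(1)[of A 8] by auto
    then have "A \<subset> ?C" using A by auto
    then have "card A < card ?C" by (intro psubset_card_mono) auto
    also have "card ?C = 8 - length J" using J by (simp add: card_Diff_subset distinct_card)
    finally show ?thesis
      using A by (intro altform_length[OF altform_vol8]) (auto simp: nths_upt)
  next
    case False
    then have "\<not> distinct (map basis8 (nths [0..<8] A @ J))" by (simp only: distinct_map) simp
    then show ?thesis using altform_not_distinct[OF altform_vol8] by simp
  qed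
  have "hodge8 \<omega> (map basis8 J) = (\<Sum>A\<in>{?C}. \<omega> (map basis8 (nths [0..<8] A)) * vol8 (map basis8 (nths [0..<8] A) @ map basis8 J))"
    unfolding hodge8_def Let_def by (rule sum.mono_neutral_right) (auto simp: zero)
  then show ?thesis by (simp add: C)
qed


subsection \<open>The 4-form in components\<close>

text \<open>Every covector of the product annihilates \<open>basis8 i\<close>. Discarding such
  summands before expanding keeps the evaluations in \<open>Omega0_contract_table\<close>
  small.\<close>

lemma wedge8_absent:
  assumes "basis8 i \<in> set xs" "i < 8" "set is \<subseteq> {..<8}" "i \<notin> set is"
  shows "wedge8 is xs = 0"
  using assms(1,3,4)
proof (induction "is" arbitrary: xs)
  case Nil
  then show ?case by (auto simp: wedge8_Nil)
next
  case (Cons a "is")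
  have dual: "wedge (dual8 a) \<omega> xs = 0" if "\<And>ys. basis8 i \<in> set ys \<Longrightarrow> \<omega> ys = 0" "basis8 i \<in> set xs" for \<omega> xs
    using that
  proof (induction xs arbitrary: \<omega>)
    case (Cons x xs)
    then show ?case using Cons.prems \<open>i < 8\<close> \<open>set (a # is) \<subseteq> {..<8}\<close> \<open>i \<notin> set (a # is)\<close>
      by (cases "x = basis8 i") (auto simp: wedge_dual8_Cons inner_basis8 wedge_zero_right)
  qed simp
  show ?case unfolding wedge8_Cons by (rule dual) (use Cons in auto)
qed

lemma wedge8_4_absent:
  assumes "i < 8" "set is \<subseteq> {..<8}" "i \<notin> set is"
  shows "wedge8 is [x, basis8 i, y, z] = 0" "wedge8 is [x, y, basis8 i, z] = 0" "wedge8 is [x, y, z, basis8 i] = 0"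
  by (rule wedge8_absent[of i], use assms in auto)+

text \<open>The 14 index sets of \<open>Omega0\<close> form a Steiner system: three indices
  determine the fourth, so each value is up to sign one coordinate of \<open>X\<close>. Leaving
  \<open>X\<close> arbitrary serves \<open>act_Omega0_basis\<close>, where images under
  \<open>T\<close> stand in the first slot.\<close>

lemma Omega0_contract_table:
  shows
  "Omega0 [X, basis8 0, basis8 1, basis8 2] = - (basis8 3 \<bullet> X)"
  "Omega0 [X, basis8 0, basis8 1, basis8 3] = basis8 2 \<bullet> X"
  "Omega0 [X, basis8 0, basis8 1, basis8 4] = basis8 5 \<bullet> X"
  "Omega0 [X, basis8 0, basis8 1, basis8 5] = - (basis8 4 \<bullet> X)"
  "Omega0 [X, basis8 0, basis8 1, basis8 6] = basis8 7 \<bullet> X"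
  "Omega0 [X, basis8 0, basis8 1, basis8 7] = - (basis8 6 \<bullet> X)"
  "Omega0 [X, basis8 0, basis8 2, basis8 3] = - (basis8 1 \<bullet> X)"
  "Omega0 [X, basis8 0, basis8 2, basis8 4] = basis8 6 \<bullet> X"
  "Omega0 [X, basis8 0, basis8 2, basis8 5] = - (basis8 7 \<bullet> X)"
  "Omega0 [X, basis8 0, basis8 2, basis8 6] = - (basis8 4 \<bullet> X)"
  "Omega0 [X, basis8 0, basis8 2, basis8 7] = basis8 5 \<bullet> X"
  "Omega0 [X, basis8 0, basis8 3, basis8 4] = basis8 7 \<bullet> X"
  "Omega0 [X, basis8 0, basis8 3, basis8 5] = basis8 6 \<bullet> X"
  "Omega0 [X, basis8 0, basis8 3, basis8 6] = - (basis8 5 \<bullet> X)"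
  "Omega0 [X, basis8 0, basis8 3, basis8 7] = - (basis8 4 \<bullet> X)"
  "Omega0 [X, basis8 0, basis8 4, basis8 5] = basis8 1 \<bullet> X"
  "Omega0 [X, basis8 0, basis8 4, basis8 6] = basis8 2 \<bullet> X"
  "Omega0 [X, basis8 0, basis8 4, basis8 7] = basis8 3 \<bullet> X"
  "Omega0 [X, basis8 0, basis8 5, basis8 6] = basis8 3 \<bullet> X"
  "Omega0 [X, basis8 0, basis8 5, basis8 7] = - (basis8 2 \<bullet> X)"
  "Omega0 [X, basis8 0, basis8 6, basis8 7] = basis8 1 \<bullet> X"
  "Omega0 [X, basis8 1, basis8 2, basis8 3] = basis8 0 \<bullet> X"
  "Omega0 [X, basis8 1, basis8 2, basis8 4] = basis8 7 \<bullet> X"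
  "Omega0 [X, basis8 1, basis8 2, basis8 5] = basis8 6 \<bullet> X"
  "Omega0 [X, basis8 1, basis8 2, basis8 6] = - (basis8 5 \<bullet> X)"
  "Omega0 [X, basis8 1, basis8 2, basis8 7] = - (basis8 4 \<bullet> X)"
  "Omega0 [X, basis8 1, basis8 3, basis8 4] = - (basis8 6 \<bullet> X)"
  "Omega0 [X, basis8 1, basis8 3, basis8 5] = basis8 7 \<bullet> X"
  "Omega0 [X, basis8 1, basis8 3, basis8 6] = basis8 4 \<bullet> X"
  "Omega0 [X, basis8 1, basis8 3, basis8 7] = - (basis8 5 \<bullet> X)"
  "Omega0 [X, basis8 1, basis8 4, basis8 5] = - (basis8 0 \<bullet> X)"
  "Omega0 [X, basis8 1, basis8 4, basis8 6] = - (basis8 3 \<bullet> X)"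
  "Omega0 [X, basis8 1, basis8 4, basis8 7] = basis8 2 \<bullet> X"
  "Omega0 [X, basis8 1, basis8 5, basis8 6] = basis8 2 \<bullet> X"
  "Omega0 [X, basis8 1, basis8 5, basis8 7] = basis8 3 \<bullet> X"
  "Omega0 [X, basis8 1, basis8 6, basis8 7] = - (basis8 0 \<bullet> X)"
  "Omega0 [X, basis8 2, basis8 3, basis8 4] = basis8 5 \<bullet> X"
  "Omega0 [X, basis8 2, basis8 3, basis8 5] = - (basis8 4 \<bullet> X)"
  "Omega0 [X, basis8 2, basis8 3, basis8 6] = basis8 7 \<bullet> X"
  "Omega0 [X, basis8 2, basis8 3, basis8 7] = - (basis8 6 \<bullet> X)"
  "Omega0 [X, basis8 2, basis8 4, basis8 5] = basis8 3 \<bullet> X"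
  "Omega0 [X, basis8 2, basis8 4, basis8 6] = - (basis8 0 \<bullet> X)"
  "Omega0 [X, basis8 2, basis8 4, basis8 7] = - (basis8 1 \<bullet> X)"
  "Omega0 [X, basis8 2, basis8 5, basis8 6] = - (basis8 1 \<bullet> X)"
  "Omega0 [X, basis8 2, basis8 5, basis8 7] = basis8 0 \<bullet> X"
  "Omega0 [X, basis8 2, basis8 6, basis8 7] = basis8 3 \<bullet> X"
  "Omega0 [X, basis8 3, basis8 4, basis8 5] = - (basis8 2 \<bullet> X)"
  "Omega0 [X, basis8 3, basis8 4, basis8 6] = basis8 1 \<bullet> X"
  "Omega0 [X, basis8 3, basis8 4, basis8 7] = - (basis8 0 \<bullet> X)"
  "Omega0 [X, basis8 3, basis8 5, basis8 6] = - (basis8 0 \<bullet> X)"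
  "Omega0 [X, basis8 3, basis8 5, basis8 7] = - (basis8 1 \<bullet> X)"
  "Omega0 [X, basis8 3, basis8 6, basis8 7] = - (basis8 2 \<bullet> X)"
  "Omega0 [X, basis8 4, basis8 5, basis8 6] = - (basis8 7 \<bullet> X)"
  "Omega0 [X, basis8 4, basis8 5, basis8 7] = basis8 6 \<bullet> X"
  "Omega0 [X, basis8 4, basis8 6, basis8 7] = - (basis8 5 \<bullet> X)"
  "Omega0 [X, basis8 5, basis8 6, basis8 7] = basis8 4 \<bullet> X"
  by (simp add: Omega0_def wedge8_4_absent,
      simp add: wedge8_Cons wedge8_Nil wedge_dual8_Cons wedge_dual8_Nil inner_basis8)+

lemma Omega0_basis_table:
  shows
  "Omega0 [basis8 0, basis8 1, basis8 2, basis8 3] = 1"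
  "Omega0 [basis8 0, basis8 1, basis8 2, basis8 4] = 0"
  "Omega0 [basis8 0, basis8 1, basis8 2, basis8 5] = 0"
  "Omega0 [basis8 0, basis8 1, basis8 2, basis8 6] = 0"
  "Omega0 [basis8 0, basis8 1, basis8 2, basis8 7] = 0"
  "Omega0 [basis8 0, basis8 1, basis8 3, basis8 4] = 0"
  "Omega0 [basis8 0, basis8 1, basis8 3, basis8 5] = 0"
  "Omega0 [basis8 0, basis8 1, basis8 3, basis8 6] = 0"
  "Omega0 [basis8 0, basis8 1, basis8 3, basis8 7] = 0"
  "Omega0 [basis8 0, basis8 1, basis8 4, basis8 5] = -1"
  "Omega0 [basis8 0, basis8 1, basis8 4, basis8 6] = 0"
  "Omega0 [basis8 0, basis8 1, basis8 4, basis8 7] = 0"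
  "Omega0 [basis8 0, basis8 1, basis8 5, basis8 6] = 0"
  "Omega0 [basis8 0, basis8 1, basis8 5, basis8 7] = 0"
  "Omega0 [basis8 0, basis8 1, basis8 6, basis8 7] = -1"
  "Omega0 [basis8 0, basis8 2, basis8 3, basis8 4] = 0"
  "Omega0 [basis8 0, basis8 2, basis8 3, basis8 5] = 0"
  "Omega0 [basis8 0, basis8 2, basis8 3, basis8 6] = 0"
  "Omega0 [basis8 0, basis8 2, basis8 3, basis8 7] = 0"
  "Omega0 [basis8 0, basis8 2, basis8 4, basis8 5] = 0"
  "Omega0 [basis8 0, basis8 2, basis8 4, basis8 6] = -1"
  "Omega0 [basis8 0, basis8 2, basis8 4, basis8 7] = 0"
  "Omega0 [basis8 0, basis8 2, basis8 5, basis8 6] = 0"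
  "Omega0 [basis8 0, basis8 2, basis8 5, basis8 7] = 1"
  "Omega0 [basis8 0, basis8 2, basis8 6, basis8 7] = 0"
  "Omega0 [basis8 0, basis8 3, basis8 4, basis8 5] = 0"
  "Omega0 [basis8 0, basis8 3, basis8 4, basis8 6] = 0"
  "Omega0 [basis8 0, basis8 3, basis8 4, basis8 7] = -1"
  "Omega0 [basis8 0, basis8 3, basis8 5, basis8 6] = -1"
  "Omega0 [basis8 0, basis8 3, basis8 5, basis8 7] = 0"
  "Omega0 [basis8 0, basis8 3, basis8 6, basis8 7] = 0"
  "Omega0 [basis8 0, basis8 4, basis8 5, basis8 6] = 0"
  "Omega0 [basis8 0, basis8 4, basis8 5, basis8 7] = 0"
  "Omega0 [basis8 0, basis8 4, basis8 6, basis8 7] = 0"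
  "Omega0 [basis8 0, basis8 5, basis8 6, basis8 7] = 0"
  "Omega0 [basis8 1, basis8 2, basis8 3, basis8 4] = 0"
  "Omega0 [basis8 1, basis8 2, basis8 3, basis8 5] = 0"
  "Omega0 [basis8 1, basis8 2, basis8 3, basis8 6] = 0"
  "Omega0 [basis8 1, basis8 2, basis8 3, basis8 7] = 0"
  "Omega0 [basis8 1, basis8 2, basis8 4, basis8 5] = 0"
  "Omega0 [basis8 1, basis8 2, basis8 4, basis8 6] = 0"
  "Omega0 [basis8 1, basis8 2, basis8 4, basis8 7] = -1"
  "Omega0 [basis8 1, basis8 2, basis8 5, basis8 6] = -1"
  "Omega0 [basis8 1, basis8 2, basis8 5, basis8 7] = 0"
  "Omega0 [basis8 1, basis8 2, basis8 6, basis8 7] = 0"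
  "Omega0 [basis8 1, basis8 3, basis8 4, basis8 5] = 0"
  "Omega0 [basis8 1, basis8 3, basis8 4, basis8 6] = 1"
  "Omega0 [basis8 1, basis8 3, basis8 4, basis8 7] = 0"
  "Omega0 [basis8 1, basis8 3, basis8 5, basis8 6] = 0"
  "Omega0 [basis8 1, basis8 3, basis8 5, basis8 7] = -1"
  "Omega0 [basis8 1, basis8 3, basis8 6, basis8 7] = 0"
  "Omega0 [basis8 1, basis8 4, basis8 5, basis8 6] = 0"
  "Omega0 [basis8 1, basis8 4, basis8 5, basis8 7] = 0"
  "Omega0 [basis8 1, basis8 4, basis8 6, basis8 7] = 0"
  "Omega0 [basis8 1, basis8 5, basis8 6, basis8 7] = 0"
  "Omega0 [basis8 2, basis8 3, basis8 4, basis8 5] = -1"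
  "Omega0 [basis8 2, basis8 3, basis8 4, basis8 6] = 0"
  "Omega0 [basis8 2, basis8 3, basis8 4, basis8 7] = 0"
  "Omega0 [basis8 2, basis8 3, basis8 5, basis8 6] = 0"
  "Omega0 [basis8 2, basis8 3, basis8 5, basis8 7] = 0"
  "Omega0 [basis8 2, basis8 3, basis8 6, basis8 7] = -1"
  "Omega0 [basis8 2, basis8 4, basis8 5, basis8 6] = 0"
  "Omega0 [basis8 2, basis8 4, basis8 5, basis8 7] = 0"
  "Omega0 [basis8 2, basis8 4, basis8 6, basis8 7] = 0"
  "Omega0 [basis8 2, basis8 5, basis8 6, basis8 7] = 0"
  "Omega0 [basis8 3, basis8 4, basis8 5, basis8 6] = 0"
  "Omega0 [basis8 3, basis8 4, basis8 5, basis8 7] = 0"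
  "Omega0 [basis8 3, basis8 4, basis8 6, basis8 7] = 0"
  "Omega0 [basis8 3, basis8 5, basis8 6, basis8 7] = 0"
  "Omega0 [basis8 4, basis8 5, basis8 6, basis8 7] = 1"
  by (simp_all add: Omega0_contract_table inner_basis8 del: One_nat_def)

lemma subseqs_upt_8_4:
  "filter (\<lambda>I. length I = 4) (subseqs [0..<8]) = [
     [0, 1, 2, 3], [0, 1, 2, 4], [0, 1, 2, 5], [0, 1, 2, 6], [0, 1, 2, 7], [0, 1, 3, 4], [0, 1, 3, 5],
     [0, 1, 3, 6], [0, 1, 3, 7], [0, 1, 4, 5], [0, 1, 4, 6], [0, 1, 4, 7], [0, 1, 5, 6], [0, 1, 5, 7],
     [0, 1, 6, 7], [0, 2, 3, 4], [0, 2, 3, 5], [0, 2, 3, 6], [0, 2, 3, 7], [0, 2, 4, 5], [0, 2, 4, 6],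
     [0, 2, 4, 7], [0, 2, 5, 6], [0, 2, 5, 7], [0, 2, 6, 7], [0, 3, 4, 5], [0, 3, 4, 6], [0, 3, 4, 7],
     [0, 3, 5, 6], [0, 3, 5, 7], [0, 3, 6, 7], [0, 4, 5, 6], [0, 4, 5, 7], [0, 4, 6, 7], [0, 5, 6, 7],
     [1, 2, 3, 4], [1, 2, 3, 5], [1, 2, 3, 6], [1, 2, 3, 7], [1, 2, 4, 5], [1, 2, 4, 6], [1, 2, 4, 7],
     [1, 2, 5, 6], [1, 2, 5, 7], [1, 2, 6, 7], [1, 3, 4, 5], [1, 3, 4, 6], [1, 3, 4, 7], [1, 3, 5, 6],
     [1, 3, 5, 7], [1, 3, 6, 7], [1, 4, 5, 6], [1, 4, 5, 7], [1, 4, 6, 7], [1, 5, 6, 7], [2, 3, 4, 5],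
     [2, 3, 4, 6], [2, 3, 4, 7], [2, 3, 5, 6], [2, 3, 5, 7], [2, 3, 6, 7], [2, 4, 5, 6], [2, 4, 5, 7],
     [2, 4, 6, 7], [2, 5, 6, 7], [3, 4, 5, 6], [3, 4, 5, 7], [3, 4, 6, 7], [3, 5, 6, 7], [4, 5, 6, 7]]"
  by code_simp

lemma subseqs_upt_8_3:
  "filter (\<lambda>I. length I = 3) (subseqs [0..<8]) = [
     [0, 1, 2], [0, 1, 3], [0, 1, 4], [0, 1, 5], [0, 1, 6], [0, 1, 7], [0, 2, 3], [0, 2, 4], [0, 2, 5],
     [0, 2, 6], [0, 2, 7], [0, 3, 4], [0, 3, 5], [0, 3, 6], [0, 3, 7], [0, 4, 5], [0, 4, 6], [0, 4, 7],
     [0, 5, 6], [0, 5, 7], [0, 6, 7], [1, 2, 3], [1, 2, 4], [1, 2, 5], [1, 2, 6], [1, 2, 7], [1, 3, 4],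
     [1, 3, 5], [1, 3, 6], [1, 3, 7], [1, 4, 5], [1, 4, 6], [1, 4, 7], [1, 5, 6], [1, 5, 7], [1, 6, 7],
     [2, 3, 4], [2, 3, 5], [2, 3, 6], [2, 3, 7], [2, 4, 5], [2, 4, 6], [2, 4, 7], [2, 5, 6], [2, 5, 7],
     [2, 6, 7], [3, 4, 5], [3, 4, 6], [3, 4, 7], [3, 5, 6], [3, 5, 7], [3, 6, 7], [4, 5, 6], [4, 5, 7],
     [4, 6, 7], [5, 6, 7]]"
  by code_simp

lemma subseqs_upt_8_7:
  "filter (\<lambda>I. length I = 7) (subseqs [0..<8]) = [
     [0, 1, 2, 3, 4, 5, 6], [0, 1, 2, 3, 4, 5, 7], [0, 1, 2, 3, 4, 6, 7], [0, 1, 2, 3, 5, 6, 7],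
     [0, 1, 2, 4, 5, 6, 7], [0, 1, 3, 4, 5, 6, 7], [0, 2, 3, 4, 5, 6, 7], [1, 2, 3, 4, 5, 6, 7]]"
  by code_simp

lemma subseqs_upt_8_8:
  "filter (\<lambda>I. length I = 8) (subseqs [0..<8]) = [
     [0, 1, 2, 3, 4, 5, 6, 7]]"
  by code_simp


subsection \<open>Left multiplication by imaginary octonions\<close>

text \<open>The determinant is expanded for arbitrary arguments because
  \<open>Omega0_oct_mult\<close> evaluates the form on images of basis vectors, whose coordinates
  are polynomials in \<open>v\<close>.\<close>

lemma wedge8_4:
  "wedge8 [a, b, c, d] [x, y, z, w] =
     (basis8 a \<bullet> x) * (basis8 b \<bullet> y) * (basis8 c \<bullet> z) * (basis8 d \<bullet> w)
     - (basis8 a \<bullet> x) * (basis8 b \<bullet> y) * (basis8 c \<bullet> w) * (basis8 d \<bullet> z)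
     - (basis8 a \<bullet> x) * (basis8 b \<bullet> z) * (basis8 c \<bullet> y) * (basis8 d \<bullet> w)
     + (basis8 a \<bullet> x) * (basis8 b \<bullet> z) * (basis8 c \<bullet> w) * (basis8 d \<bullet> y)
     + (basis8 a \<bullet> x) * (basis8 b \<bullet> w) * (basis8 c \<bullet> y) * (basis8 d \<bullet> z)
     - (basis8 a \<bullet> x) * (basis8 b \<bullet> w) * (basis8 c \<bullet> z) * (basis8 d \<bullet> y)
     - (basis8 a \<bullet> y) * (basis8 b \<bullet> x) * (basis8 c \<bullet> z) * (basis8 d \<bullet> w)
     + (basis8 a \<bullet> y) * (basis8 b \<bullet> x) * (basis8 c \<bullet> w) * (basis8 d \<bullet> z)
     + (basis8 a \<bullet> y) * (basis8 b \<bullet> z) * (basis8 c \<bullet> x) * (basis8 d \<bullet> w)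
     - (basis8 a \<bullet> y) * (basis8 b \<bullet> z) * (basis8 c \<bullet> w) * (basis8 d \<bullet> x)
     - (basis8 a \<bullet> y) * (basis8 b \<bullet> w) * (basis8 c \<bullet> x) * (basis8 d \<bullet> z)
     + (basis8 a \<bullet> y) * (basis8 b \<bullet> w) * (basis8 c \<bullet> z) * (basis8 d \<bullet> x)
     + (basis8 a \<bullet> z) * (basis8 b \<bullet> x) * (basis8 c \<bullet> y) * (basis8 d \<bullet> w)
     - (basis8 a \<bullet> z) * (basis8 b \<bullet> x) * (basis8 c \<bullet> w) * (basis8 d \<bullet> y)
     - (basis8 a \<bullet> z) * (basis8 b \<bullet> y) * (basis8 c \<bullet> x) * (basis8 d \<bullet> w)
     + (basis8 a \<bullet> z) * (basis8 b \<bullet> y) * (basis8 c \<bullet> w) * (basis8 d \<bullet> x)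
     + (basis8 a \<bullet> z) * (basis8 b \<bullet> w) * (basis8 c \<bullet> x) * (basis8 d \<bullet> y)
     - (basis8 a \<bullet> z) * (basis8 b \<bullet> w) * (basis8 c \<bullet> y) * (basis8 d \<bullet> x)
     - (basis8 a \<bullet> w) * (basis8 b \<bullet> x) * (basis8 c \<bullet> y) * (basis8 d \<bullet> z)
     + (basis8 a \<bullet> w) * (basis8 b \<bullet> x) * (basis8 c \<bullet> z) * (basis8 d \<bullet> y)
     + (basis8 a \<bullet> w) * (basis8 b \<bullet> y) * (basis8 c \<bullet> x) * (basis8 d \<bullet> z)
     - (basis8 a \<bullet> w) * (basis8 b \<bullet> y) * (basis8 c \<bullet> z) * (basis8 d \<bullet> x)
     - (basis8 a \<bullet> w) * (basis8 b \<bullet> z) * (basis8 c \<bullet> x) * (basis8 d \<bullet> y)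
     + (basis8 a \<bullet> w) * (basis8 b \<bullet> z) * (basis8 c \<bullet> y) * (basis8 d \<bullet> x)"
  by (simp add: wedge8_Cons wedge8_Nil wedge_dual8_Cons wedge_dual8_Nil algebra_simps)

text \<open>For \<open>v\<close> orthogonal to \<open>basis8 0\<close> this is the octonion product
  of \<open>v\<close> and \<open>x\<close> with unit \<open>basis8 0\<close>: the last sum is the
  cross product of \<open>v\<close> with the imaginary part of \<open>x\<close>, encoded by the
  3-form i(e0) Omega0.\<close>

definition oct_mult :: "real^8 \<Rightarrow> real^8 \<Rightarrow> real^8" where
  "oct_mult v x = (basis8 0 \<bullet> x) *\<^sub>R v - (v \<bullet> x) *\<^sub>R basis8 0 +
     (\<Sum>k<8. Omega0 [basis8 0, v, x, basis8 k] *\<^sub>R basis8 k)"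

lemma sum_lessThan_8: "(\<Sum>i<8::nat. f i) = f 0 + f 1 + f 2 + f 3 + f 4 + f 5 + f 6 + (f 7 :: 'a::comm_monoid_add)"
  by (simp add: eval_nat_numeral)

lemma linear_oct_mult: "linear (oct_mult v)"
proof -
  have "linear (\<lambda>x. Omega0 [basis8 0, v, x, basis8 k])" for k
    using altform_linear[OF altform_Omega0, of "[basis8 0, v]" "[basis8 k]"] by simp
  then show ?thesis
    unfolding oct_mult_def linear_iff
    by (simp add: inner_add_right algebra_simps sum.distrib scaleR_sum_right)
qed

lemma inner_oct_mult:
  assumes "k < 8"
  shows "basis8 k \<bullet> oct_mult v x = (basis8 0 \<bullet> x) * (basis8 k \<bullet> v) -
    (v \<bullet> x) * (if k = 0 then 1 else 0) + Omega0 [basis8 0, v, x, basis8 k]"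
proof -
  have "(\<Sum>i<8. Omega0 [basis8 0, v, x, basis8 i] * (basis8 k \<bullet> basis8 i)) =
      (\<Sum>i<8. if i = k then Omega0 [basis8 0, v, x, basis8 k] else 0)"
    using assms by (intro sum.cong) (auto simp: inner_basis8)
  then show ?thesis
    using assms by (simp add: oct_mult_def inner_add_right inner_diff_right inner_sum_right inner_basis8)
qed

lemma oct_mult_components:
  assumes "basis8 0 \<bullet> v = 0"
  shows
  "basis8 0 \<bullet> oct_mult v x = - (basis8 1 \<bullet> v) * (basis8 1 \<bullet> x) -
      (basis8 2 \<bullet> v) * (basis8 2 \<bullet> x) - (basis8 3 \<bullet> v) * (basis8 3 \<bullet> x) -
      (basis8 4 \<bullet> v) * (basis8 4 \<bullet> x) - (basis8 5 \<bullet> v) * (basis8 5 \<bullet> x) -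
      (basis8 6 \<bullet> v) * (basis8 6 \<bullet> x) - (basis8 7 \<bullet> v) * (basis8 7 \<bullet> x)"
  "basis8 1 \<bullet> oct_mult v x = (basis8 1 \<bullet> v) * (basis8 0 \<bullet> x) -
      (basis8 3 \<bullet> v) * (basis8 2 \<bullet> x) + (basis8 2 \<bullet> v) * (basis8 3 \<bullet> x) +
      (basis8 5 \<bullet> v) * (basis8 4 \<bullet> x) - (basis8 4 \<bullet> v) * (basis8 5 \<bullet> x) +
      (basis8 7 \<bullet> v) * (basis8 6 \<bullet> x) - (basis8 6 \<bullet> v) * (basis8 7 \<bullet> x)"
  "basis8 2 \<bullet> oct_mult v x = (basis8 2 \<bullet> v) * (basis8 0 \<bullet> x) +
      (basis8 3 \<bullet> v) * (basis8 1 \<bullet> x) - (basis8 1 \<bullet> v) * (basis8 3 \<bullet> x) +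
      (basis8 6 \<bullet> v) * (basis8 4 \<bullet> x) - (basis8 7 \<bullet> v) * (basis8 5 \<bullet> x) -
      (basis8 4 \<bullet> v) * (basis8 6 \<bullet> x) + (basis8 5 \<bullet> v) * (basis8 7 \<bullet> x)"
  "basis8 3 \<bullet> oct_mult v x = (basis8 3 \<bullet> v) * (basis8 0 \<bullet> x) -
      (basis8 2 \<bullet> v) * (basis8 1 \<bullet> x) + (basis8 1 \<bullet> v) * (basis8 2 \<bullet> x) +
      (basis8 7 \<bullet> v) * (basis8 4 \<bullet> x) + (basis8 6 \<bullet> v) * (basis8 5 \<bullet> x) -
      (basis8 5 \<bullet> v) * (basis8 6 \<bullet> x) - (basis8 4 \<bullet> v) * (basis8 7 \<bullet> x)"
  "basis8 4 \<bullet> oct_mult v x = (basis8 4 \<bullet> v) * (basis8 0 \<bullet> x) -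
      (basis8 5 \<bullet> v) * (basis8 1 \<bullet> x) - (basis8 6 \<bullet> v) * (basis8 2 \<bullet> x) -
      (basis8 7 \<bullet> v) * (basis8 3 \<bullet> x) + (basis8 1 \<bullet> v) * (basis8 5 \<bullet> x) +
      (basis8 2 \<bullet> v) * (basis8 6 \<bullet> x) + (basis8 3 \<bullet> v) * (basis8 7 \<bullet> x)"
  "basis8 5 \<bullet> oct_mult v x = (basis8 5 \<bullet> v) * (basis8 0 \<bullet> x) +
      (basis8 4 \<bullet> v) * (basis8 1 \<bullet> x) + (basis8 7 \<bullet> v) * (basis8 2 \<bullet> x) -
      (basis8 6 \<bullet> v) * (basis8 3 \<bullet> x) - (basis8 1 \<bullet> v) * (basis8 4 \<bullet> x) +
      (basis8 3 \<bullet> v) * (basis8 6 \<bullet> x) - (basis8 2 \<bullet> v) * (basis8 7 \<bullet> x)"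
  "basis8 6 \<bullet> oct_mult v x = (basis8 6 \<bullet> v) * (basis8 0 \<bullet> x) -
      (basis8 7 \<bullet> v) * (basis8 1 \<bullet> x) + (basis8 4 \<bullet> v) * (basis8 2 \<bullet> x) +
      (basis8 5 \<bullet> v) * (basis8 3 \<bullet> x) - (basis8 2 \<bullet> v) * (basis8 4 \<bullet> x) -
      (basis8 3 \<bullet> v) * (basis8 5 \<bullet> x) + (basis8 1 \<bullet> v) * (basis8 7 \<bullet> x)"
  "basis8 7 \<bullet> oct_mult v x = (basis8 7 \<bullet> v) * (basis8 0 \<bullet> x) +
      (basis8 6 \<bullet> v) * (basis8 1 \<bullet> x) - (basis8 5 \<bullet> v) * (basis8 2 \<bullet> x) +
      (basis8 4 \<bullet> v) * (basis8 3 \<bullet> x) - (basis8 3 \<bullet> v) * (basis8 4 \<bullet> x) +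
      (basis8 2 \<bullet> v) * (basis8 5 \<bullet> x) - (basis8 1 \<bullet> v) * (basis8 6 \<bullet> x)"
  by (simp_all add: inner_oct_mult Omega0_def wedge8_4 inner_basis8 assms inner_eq_sum_basis8[of v] sum_lessThan_8)

text \<open>Multiplicativity of the octonion norm; with imaginary \<open>v\<close> it is a case of
  the eight-square identity, checked in coordinates.\<close>

lemma oct_mult_orthogonal:
  assumes "basis8 0 \<bullet> v = 0" "norm v = 1"
  shows "orthogonal_transformation (oct_mult v)"
  unfolding orthogonal_transformation
proof (intro conjI allI linear_oct_mult)
  fix x
  have v: "v \<bullet> v = 1" using assms(2) by (simp add: norm_eq_1)
  define x0 where "x0 = basis8 0 \<bullet> x"
  define x1 where "x1 = basis8 1 \<bullet> x"
  define x2 where "x2 = basis8 2 \<bullet> x"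
  define x3 where "x3 = basis8 3 \<bullet> x"
  define x4 where "x4 = basis8 4 \<bullet> x"
  define x5 where "x5 = basis8 5 \<bullet> x"
  define x6 where "x6 = basis8 6 \<bullet> x"
  define x7 where "x7 = basis8 7 \<bullet> x"
  define v1 where "v1 = basis8 1 \<bullet> v"
  define v2 where "v2 = basis8 2 \<bullet> v"
  define v3 where "v3 = basis8 3 \<bullet> v"
  define v4 where "v4 = basis8 4 \<bullet> v"
  define v5 where "v5 = basis8 5 \<bullet> v"
  define v6 where "v6 = basis8 6 \<bullet> v"
  define v7 where "v7 = basis8 7 \<bullet> v"
  note defs = x0_def x1_def x2_def x3_def x4_def x5_def x6_def x7_def v1_def v2_def v3_def v4_def v5_def v6_def v7_def
  have "oct_mult v x \<bullet> oct_mult v x = (v \<bullet> v) * (x \<bullet> x)"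
    unfolding inner_eq_sum_basis8[of "oct_mult v x"] inner_eq_sum_basis8[of v] inner_eq_sum_basis8[of x]
      sum_lessThan_8 oct_mult_components[OF assms(1)] assms(1) defs[symmetric]
    by Groebner_Basis.algebra
  then show "norm (oct_mult v x) = norm x"
    by (simp add: v norm_eq_sqrt_inner)
qed

lemma Omega0_oct_mult:
  assumes "basis8 0 \<bullet> v = 0" "norm v = 1"
  shows "pullback (oct_mult v) Omega0 = Omega0"
proof (rule altform_eqI[OF pullback_altform[OF altform_Omega0 linear_oct_mult] altform_Omega0])
  define v1 where "v1 = basis8 1 \<bullet> v"
  define v2 where "v2 = basis8 2 \<bullet> v"
  define v3 where "v3 = basis8 3 \<bullet> v"
  define v4 where "v4 = basis8 4 \<bullet> v"
  define v5 where "v5 = basis8 5 \<bullet> v"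
  define v6 where "v6 = basis8 6 \<bullet> v"
  define v7 where "v7 = basis8 7 \<bullet> v"
  \<comment> \<open>The squared norm of \<open>v\<close>, equal to 1. The pulled-back form has
    degree four in \<open>v\<close>, so comparing it with \<open>n\<^sup>2\<close> times
    \<open>Omega0\<close> makes every component a polynomial identity.\<close>
  define n where "n = v1\<^sup>2 + v2\<^sup>2 + v3\<^sup>2 + v4\<^sup>2 + v5\<^sup>2 + v6\<^sup>2 + v7\<^sup>2"
  have n: "n = 1"
    using assms inner_eq_sum_basis8[of v v] by (simp add: sum_lessThan_8 norm_eq_1 n_def power2_eq_square v1_def v2_def v3_def v4_def v5_def v6_def v7_def)
  have M:
    "basis8 0 \<bullet> oct_mult v (basis8 0) = 0"
    "basis8 0 \<bullet> oct_mult v (basis8 1) = - v1"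
    "basis8 0 \<bullet> oct_mult v (basis8 2) = - v2"
    "basis8 0 \<bullet> oct_mult v (basis8 3) = - v3"
    "basis8 0 \<bullet> oct_mult v (basis8 4) = - v4"
    "basis8 0 \<bullet> oct_mult v (basis8 5) = - v5"
    "basis8 0 \<bullet> oct_mult v (basis8 6) = - v6"
    "basis8 0 \<bullet> oct_mult v (basis8 7) = - v7"
    "basis8 1 \<bullet> oct_mult v (basis8 0) = v1"
    "basis8 1 \<bullet> oct_mult v (basis8 1) = 0"
    "basis8 1 \<bullet> oct_mult v (basis8 2) = - v3"
    "basis8 1 \<bullet> oct_mult v (basis8 3) = v2"
    "basis8 1 \<bullet> oct_mult v (basis8 4) = v5"
    "basis8 1 \<bullet> oct_mult v (basis8 5) = - v4"
    "basis8 1 \<bullet> oct_mult v (basis8 6) = v7"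
    "basis8 1 \<bullet> oct_mult v (basis8 7) = - v6"
    "basis8 2 \<bullet> oct_mult v (basis8 0) = v2"
    "basis8 2 \<bullet> oct_mult v (basis8 1) = v3"
    "basis8 2 \<bullet> oct_mult v (basis8 2) = 0"
    "basis8 2 \<bullet> oct_mult v (basis8 3) = - v1"
    "basis8 2 \<bullet> oct_mult v (basis8 4) = v6"
    "basis8 2 \<bullet> oct_mult v (basis8 5) = - v7"
    "basis8 2 \<bullet> oct_mult v (basis8 6) = - v4"
    "basis8 2 \<bullet> oct_mult v (basis8 7) = v5"
    "basis8 3 \<bullet> oct_mult v (basis8 0) = v3"
    "basis8 3 \<bullet> oct_mult v (basis8 1) = - v2"
    "basis8 3 \<bullet> oct_mult v (basis8 2) = v1"
    "basis8 3 \<bullet> oct_mult v (basis8 3) = 0"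
    "basis8 3 \<bullet> oct_mult v (basis8 4) = v7"
    "basis8 3 \<bullet> oct_mult v (basis8 5) = v6"
    "basis8 3 \<bullet> oct_mult v (basis8 6) = - v5"
    "basis8 3 \<bullet> oct_mult v (basis8 7) = - v4"
    "basis8 4 \<bullet> oct_mult v (basis8 0) = v4"
    "basis8 4 \<bullet> oct_mult v (basis8 1) = - v5"
    "basis8 4 \<bullet> oct_mult v (basis8 2) = - v6"
    "basis8 4 \<bullet> oct_mult v (basis8 3) = - v7"
    "basis8 4 \<bullet> oct_mult v (basis8 4) = 0"
    "basis8 4 \<bullet> oct_mult v (basis8 5) = v1"
    "basis8 4 \<bullet> oct_mult v (basis8 6) = v2"
    "basis8 4 \<bullet> oct_mult v (basis8 7) = v3"
    "basis8 5 \<bullet> oct_mult v (basis8 0) = v5"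
    "basis8 5 \<bullet> oct_mult v (basis8 1) = v4"
    "basis8 5 \<bullet> oct_mult v (basis8 2) = v7"
    "basis8 5 \<bullet> oct_mult v (basis8 3) = - v6"
    "basis8 5 \<bullet> oct_mult v (basis8 4) = - v1"
    "basis8 5 \<bullet> oct_mult v (basis8 5) = 0"
    "basis8 5 \<bullet> oct_mult v (basis8 6) = v3"
    "basis8 5 \<bullet> oct_mult v (basis8 7) = - v2"
    "basis8 6 \<bullet> oct_mult v (basis8 0) = v6"
    "basis8 6 \<bullet> oct_mult v (basis8 1) = - v7"
    "basis8 6 \<bullet> oct_mult v (basis8 2) = v4"
    "basis8 6 \<bullet> oct_mult v (basis8 3) = v5"
    "basis8 6 \<bullet> oct_mult v (basis8 4) = - v2"
    "basis8 6 \<bullet> oct_mult v (basis8 5) = - v3"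
    "basis8 6 \<bullet> oct_mult v (basis8 6) = 0"
    "basis8 6 \<bullet> oct_mult v (basis8 7) = v1"
    "basis8 7 \<bullet> oct_mult v (basis8 0) = v7"
    "basis8 7 \<bullet> oct_mult v (basis8 1) = v6"
    "basis8 7 \<bullet> oct_mult v (basis8 2) = - v5"
    "basis8 7 \<bullet> oct_mult v (basis8 3) = v4"
    "basis8 7 \<bullet> oct_mult v (basis8 4) = - v3"
    "basis8 7 \<bullet> oct_mult v (basis8 5) = v2"
    "basis8 7 \<bullet> oct_mult v (basis8 6) = - v1"
    "basis8 7 \<bullet> oct_mult v (basis8 7) = 0"
    by (simp_all add: oct_mult_components[OF assms(1)] inner_basis8 v1_def v2_def v3_def v4_def v5_def v6_def v7_def del: One_nat_def)
  have "\<forall>I\<in>set (filter (\<lambda>I. length I = 4) (subseqs [0..<8])).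
      Omega0 (map (oct_mult v) (map basis8 I)) = n\<^sup>2 * Omega0 (map basis8 I)"
    unfolding subseqs_upt_8_4
    by (simp only: list.set ball_simps list.map Omega0_basis_table simp_thms; intro conjI;
        unfold Omega0_def wedge8_4 M n_def; Groebner_Basis.algebra)
  then show "pullback (oct_mult v) Omega0 (map basis8 I) = Omega0 (map basis8 I)"
    if "I \<in> set (filter (\<lambda>I. length I = 4) (subseqs [0..<8]))" for I
    using that by (simp only: pullback_def n power_one mult_1_left)
qed

text \<open>One multiplication sends \<open>basis8 0\<close> only to imaginary units, so two are
  composed. With \<open>v\<close> orthogonal to \<open>basis8 0\<close> and \<open>u\<close>, the
  preimage \<open>w\<close> of \<open>u\<close> under multiplication by \<open>v\<close> is
  imaginary, since its inner product with \<open>basis8 0\<close> equals that of \<open>u\<close>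
  with \<open>v\<close>.\<close>

lemma Omega0_stabilizer_transitive:
  assumes "norm u = 1"
  obtains g where "orthogonal_transformation g" "g (basis8 0) = u" "pullback g Omega0 = Omega0"
proof -
  have "dim {basis8 0, u} \<le> card {basis8 0, u}" by (rule dim_le_card') simp
  also have "\<dots> \<le> 2" by (cases "basis8 0 = u") auto
  finally have "dim {basis8 0, u} < DIM(real^8)" by simp
  then obtain v' where v': "v' \<noteq> 0" "\<And>y. y \<in> span {basis8 0, u} \<Longrightarrow> v' \<bullet> y = 0"
    using orthogonal_to_subspace_exists unfolding Linear_Algebra.orthogonal_def by metis
  define v where "v = v' /\<^sub>R norm v'"
  have v: "basis8 0 \<bullet> v = 0" "v \<bullet> u = 0" "norm v = 1"
    using v'(1) v'(2)[of "basis8 0"] v'(2)[of u]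
    by (auto simp: v_def span_base inner_commute)
  have Lv: "orthogonal_transformation (oct_mult v)" using v by (rule_tac oct_mult_orthogonal)
  define w where "w = Hilbert_Choice.inv (oct_mult v) u"
  have w: "oct_mult v w = u"
    unfolding w_def by (rule surj_f_inv_f[OF orthogonal_transformation_surj[OF Lv]])
  have L0: "oct_mult y (basis8 0) = y" if y: "basis8 0 \<bullet> y = 0" for y
  proof (rule basis8_eqI)
    fix i :: nat assume "i < 8"
    then consider "i = 0" | "i = 1" | "i = 2" | "i = 3" | "i = 4" | "i = 5" | "i = 6" | "i = 7" by linarith
    then show "basis8 i \<bullet> oct_mult y (basis8 0) = basis8 i \<bullet> y"
      by cases (simp_all only: oct_mult_components[OF y], simp_all add: inner_basis8 y)
  qed
  have "basis8 0 \<bullet> w = oct_mult v (basis8 0) \<bullet> oct_mult v w"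
    using Lv by (simp add: orthogonal_transformation_def)
  then have w0: "basis8 0 \<bullet> w = 0" using L0[OF v(1)] v(2) w by simp
  have nw: "norm w = 1" using w Lv assms by (metis orthogonal_transformation_norm)
  show thesis
  proof (rule that)
    show "orthogonal_transformation (oct_mult v \<circ> oct_mult w)"
      using Lv oct_mult_orthogonal[OF w0 nw] by (rule orthogonal_transformation_compose)
    show "(oct_mult v \<circ> oct_mult w) (basis8 0) = u"
      using L0[OF w0] w by simp
    show "pullback (oct_mult v \<circ> oct_mult w) Omega0 = Omega0"
      using fun_cong[OF Omega0_oct_mult[OF v(1,3)]] fun_cong[OF Omega0_oct_mult[OF w0 nw]]
      by (auto simp: pullback_def fun_eq_iff simp flip: map_map)
  qed
qed


subsection \<open>Semidirect products with an abelian ideal\<close>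

definition semidirect :: "(real^8 \<Rightarrow> real^8) \<Rightarrow> real^8 \<Rightarrow> real^8 \<Rightarrow> real^8" where
  "semidirect T x y = (basis8 0 \<bullet> x) *\<^sub>R T y - (basis8 0 \<bullet> y) *\<^sub>R T x"

text \<open>Endomorphisms of the ideal extended by zero on \<open>basis8 0\<close>, so that 7 by 7
  matrices can be treated as maps of the whole space.\<close>

definition ideal_map :: "(real^8 \<Rightarrow> real^8) \<Rightarrow> bool" where
  "ideal_map T \<longleftrightarrow> linear T \<and> T (basis8 0) = 0 \<and> (\<forall>x. basis8 0 \<bullet> T x = 0)"

definition coeff8 :: "(real^8 \<Rightarrow> real^8) \<Rightarrow> nat \<Rightarrow> nat \<Rightarrow> real" where
  "coeff8 T i j = basis8 i \<bullet> T (basis8 j)"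

lemma bilinear_semidirect: "linear T \<Longrightarrow> bilinear (semidirect T)"
  by (auto simp: bilinear_def semidirect_def linear_iff inner_add_right scaleR_add_left algebra_simps)

lemma semidirect_self: "semidirect T x x = 0"
  by (simp add: semidirect_def)

lemma ext_deriv_semidirect:
  assumes T: "ideal_map T" and \<omega>: "altform k \<omega>" and I: "0 \<notin> set I" "set I \<subseteq> {..<8}"
  shows "ext_deriv (semidirect T) \<omega> (map basis8 I) = 0"
    "ext_deriv (semidirect T) \<omega> (map basis8 (0 # I)) = - act T \<omega> (map basis8 I)"
proof -
  \<comment> \<open>Stated for any form, since it is applied again to the contraction of \<omega>
    with \<open>basis8 0\<close>.\<close>
  have zero: "ext_deriv (semidirect T) \<eta> (map basis8 I) = 0" if \<eta>: "altform n \<eta>" for n \<eta>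
    unfolding ext_deriv_def
  proof (intro sum.neutral ballI)
    fix j i assume j: "j \<in> {..<length (map basis8 I)}" and i: "i \<in> {..<j}"
    have "basis8 0 \<bullet> basis8 (I ! a) = 0" if "a < length I" for a
    proof -
      have "I ! a \<noteq> 0" "I ! a < 8" using I nth_mem[OF that] by (metis, auto)
      then show ?thesis by (simp add: inner_basis8)
    qed
    then have "semidirect T (map basis8 I ! i) (map basis8 I ! j) = 0"
      using i j by (simp add: semidirect_def)
    then show "(- 1) ^ (i + j) * \<eta> (semidirect T (map basis8 I ! i) (map basis8 I ! j) # nths (map basis8 I) (- {i, j})) = 0"
      using linear_0[OF altform_linear_hd[OF \<eta>]] by simp
  qed
  then show "ext_deriv (semidirect T) \<omega> (map basis8 I) = 0" using \<omega> .
  have "semidirect T (basis8 0) = T"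
    using T by (simp add: semidirect_def ideal_map_def inner_basis8 fun_eq_iff)
  then show "ext_deriv (semidirect T) \<omega> (map basis8 (0 # I)) = - act T \<omega> (map basis8 I)"
    using zero[OF altform_contract[OF \<omega>]] by (simp add: ext_deriv_Cons[OF \<omega>])
qed

text \<open>Every image under \<open>T\<close> is moved to the front, where
  \<open>Omega0_contract_table\<close> applies.\<close>

lemma act_Omega0:
  "act T Omega0 [x, y, z, w] =
     Omega0 [T x, y, z, w] - Omega0 [T y, x, z, w] + Omega0 [T z, x, y, w] - Omega0 [T w, x, y, z]"
  using altform_swap[OF altform_Omega0, of "[]" x "T y" "[z, w]"]
    altform_swap[OF altform_Omega0, of "[x]" y "T z" "[w]"] altform_swap[OF altform_Omega0, of "[]" x "T z" "[y, w]"]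
    altform_swap[OF altform_Omega0, of "[x, y]" z "T w" "[]"] altform_swap[OF altform_Omega0, of "[x]" y "T w" "[z]"]
    altform_swap[OF altform_Omega0, of "[]" x "T w" "[y, z]"]
  by simp

lemma act_Omega0_basis:
  "act T Omega0 (map basis8 [i, j, k, l]) =
     Omega0 [T (basis8 i), basis8 j, basis8 k, basis8 l] - Omega0 [T (basis8 j), basis8 i, basis8 k, basis8 l] +
     Omega0 [T (basis8 k), basis8 i, basis8 j, basis8 l] - Omega0 [T (basis8 l), basis8 i, basis8 j, basis8 k]"
  using act_Omega0[of T "basis8 i" "basis8 j" "basis8 k" "basis8 l"] by simp

lemma hodge8_basis_3:
  assumes "i < j" "j < k" "k < 8"
  shows "hodge8 \<omega> [basis8 i, basis8 j, basis8 k] =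
    \<omega> (map basis8 (filter (\<lambda>a. a \<noteq> i \<and> a \<noteq> j \<and> a \<noteq> k) [0, 1, 2, 3, 4, 5, 6, 7])) *
    vol8 (map basis8 (filter (\<lambda>a. a \<noteq> i \<and> a \<noteq> j \<and> a \<noteq> k) [0, 1, 2, 3, 4, 5, 6, 7] @ [i, j, k]))"
proof -
  have "[0..<8] = [0, 1, 2, 3, 4, 5, 6, 7 :: nat]" by code_simp
  then show ?thesis using hodge8_basis[of "[i, j, k]" \<omega>] assms by simp
qed

lemma ideal_map_inner_0: "ideal_map T \<Longrightarrow> basis8 0 \<bullet> T x = 0"
  by (simp add: ideal_map_def)

text \<open>The star exchanges complementary index sets. The 21 triples containing 0 have
  complements inside the ideal, where \<open>d Omega0\<close> vanishes; the other 35 give, up to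
  sign, components of \<open>act T Omega0\<close>.\<close>

lemma hodge_dOmega0_table:
  assumes T: "ideal_map T"
  defines "E \<equiv> coeff8 T"
  shows
  "hodge8 (ext_deriv (semidirect T) Omega0) [basis8 0, basis8 1, basis8 2] = 0"
  "hodge8 (ext_deriv (semidirect T) Omega0) [basis8 0, basis8 1, basis8 3] = 0"
  "hodge8 (ext_deriv (semidirect T) Omega0) [basis8 0, basis8 1, basis8 4] = 0"
  "hodge8 (ext_deriv (semidirect T) Omega0) [basis8 0, basis8 1, basis8 5] = 0"
  "hodge8 (ext_deriv (semidirect T) Omega0) [basis8 0, basis8 1, basis8 6] = 0"
  "hodge8 (ext_deriv (semidirect T) Omega0) [basis8 0, basis8 1, basis8 7] = 0"
  "hodge8 (ext_deriv (semidirect T) Omega0) [basis8 0, basis8 2, basis8 3] = 0"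
  "hodge8 (ext_deriv (semidirect T) Omega0) [basis8 0, basis8 2, basis8 4] = 0"
  "hodge8 (ext_deriv (semidirect T) Omega0) [basis8 0, basis8 2, basis8 5] = 0"
  "hodge8 (ext_deriv (semidirect T) Omega0) [basis8 0, basis8 2, basis8 6] = 0"
  "hodge8 (ext_deriv (semidirect T) Omega0) [basis8 0, basis8 2, basis8 7] = 0"
  "hodge8 (ext_deriv (semidirect T) Omega0) [basis8 0, basis8 3, basis8 4] = 0"
  "hodge8 (ext_deriv (semidirect T) Omega0) [basis8 0, basis8 3, basis8 5] = 0"
  "hodge8 (ext_deriv (semidirect T) Omega0) [basis8 0, basis8 3, basis8 6] = 0"
  "hodge8 (ext_deriv (semidirect T) Omega0) [basis8 0, basis8 3, basis8 7] = 0"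
  "hodge8 (ext_deriv (semidirect T) Omega0) [basis8 0, basis8 4, basis8 5] = 0"
  "hodge8 (ext_deriv (semidirect T) Omega0) [basis8 0, basis8 4, basis8 6] = 0"
  "hodge8 (ext_deriv (semidirect T) Omega0) [basis8 0, basis8 4, basis8 7] = 0"
  "hodge8 (ext_deriv (semidirect T) Omega0) [basis8 0, basis8 5, basis8 6] = 0"
  "hodge8 (ext_deriv (semidirect T) Omega0) [basis8 0, basis8 5, basis8 7] = 0"
  "hodge8 (ext_deriv (semidirect T) Omega0) [basis8 0, basis8 6, basis8 7] = 0"
  "hodge8 (ext_deriv (semidirect T) Omega0) [basis8 1, basis8 2, basis8 3] = - E 4 4 - E 5 5 - E 6 6 - E 7 7"
  "hodge8 (ext_deriv (semidirect T) Omega0) [basis8 1, basis8 2, basis8 4] = - E 1 6 + E 2 5 + E 4 3"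
  "hodge8 (ext_deriv (semidirect T) Omega0) [basis8 1, basis8 2, basis8 5] = E 1 7 - E 2 4 + E 5 3"
  "hodge8 (ext_deriv (semidirect T) Omega0) [basis8 1, basis8 2, basis8 6] = E 1 4 + E 2 7 + E 6 3"
  "hodge8 (ext_deriv (semidirect T) Omega0) [basis8 1, basis8 2, basis8 7] = - E 1 5 - E 2 6 + E 7 3"
  "hodge8 (ext_deriv (semidirect T) Omega0) [basis8 1, basis8 3, basis8 4] = - E 1 7 + E 3 5 - E 4 2"
  "hodge8 (ext_deriv (semidirect T) Omega0) [basis8 1, basis8 3, basis8 5] = - E 1 6 - E 3 4 - E 5 2"
  "hodge8 (ext_deriv (semidirect T) Omega0) [basis8 1, basis8 3, basis8 6] = E 1 5 + E 3 7 - E 6 2"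
  "hodge8 (ext_deriv (semidirect T) Omega0) [basis8 1, basis8 3, basis8 7] = E 1 4 - E 3 6 - E 7 2"
  "hodge8 (ext_deriv (semidirect T) Omega0) [basis8 1, basis8 4, basis8 5] = E 2 2 + E 3 3 + E 6 6 + E 7 7"
  "hodge8 (ext_deriv (semidirect T) Omega0) [basis8 1, basis8 4, basis8 6] = - E 1 2 + E 4 7 - E 6 5"
  "hodge8 (ext_deriv (semidirect T) Omega0) [basis8 1, basis8 4, basis8 7] = - E 1 3 - E 4 6 - E 7 5"
  "hodge8 (ext_deriv (semidirect T) Omega0) [basis8 1, basis8 5, basis8 6] = - E 1 3 + E 5 7 + E 6 4"
  "hodge8 (ext_deriv (semidirect T) Omega0) [basis8 1, basis8 5, basis8 7] = E 1 2 - E 5 6 + E 7 4"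
  "hodge8 (ext_deriv (semidirect T) Omega0) [basis8 1, basis8 6, basis8 7] = E 2 2 + E 3 3 + E 4 4 + E 5 5"
  "hodge8 (ext_deriv (semidirect T) Omega0) [basis8 2, basis8 3, basis8 4] = - E 2 7 + E 3 6 + E 4 1"
  "hodge8 (ext_deriv (semidirect T) Omega0) [basis8 2, basis8 3, basis8 5] = - E 2 6 - E 3 7 + E 5 1"
  "hodge8 (ext_deriv (semidirect T) Omega0) [basis8 2, basis8 3, basis8 6] = E 2 5 - E 3 4 + E 6 1"
  "hodge8 (ext_deriv (semidirect T) Omega0) [basis8 2, basis8 3, basis8 7] = E 2 4 + E 3 5 + E 7 1"
  "hodge8 (ext_deriv (semidirect T) Omega0) [basis8 2, basis8 4, basis8 5] = - E 2 1 - E 4 7 - E 5 6"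
  "hodge8 (ext_deriv (semidirect T) Omega0) [basis8 2, basis8 4, basis8 6] = E 1 1 + E 3 3 + E 5 5 + E 7 7"
  "hodge8 (ext_deriv (semidirect T) Omega0) [basis8 2, basis8 4, basis8 7] = - E 2 3 + E 4 5 - E 7 6"
  "hodge8 (ext_deriv (semidirect T) Omega0) [basis8 2, basis8 5, basis8 6] = - E 2 3 - E 5 4 + E 6 7"
  "hodge8 (ext_deriv (semidirect T) Omega0) [basis8 2, basis8 5, basis8 7] = - E 1 1 - E 3 3 - E 4 4 - E 6 6"
  "hodge8 (ext_deriv (semidirect T) Omega0) [basis8 2, basis8 6, basis8 7] = - E 2 1 + E 6 5 + E 7 4"
  "hodge8 (ext_deriv (semidirect T) Omega0) [basis8 3, basis8 4, basis8 5] = - E 3 1 + E 4 6 - E 5 7"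
  "hodge8 (ext_deriv (semidirect T) Omega0) [basis8 3, basis8 4, basis8 6] = - E 3 2 - E 4 5 - E 6 7"
  "hodge8 (ext_deriv (semidirect T) Omega0) [basis8 3, basis8 4, basis8 7] = E 1 1 + E 2 2 + E 5 5 + E 6 6"
  "hodge8 (ext_deriv (semidirect T) Omega0) [basis8 3, basis8 5, basis8 6] = E 1 1 + E 2 2 + E 4 4 + E 7 7"
  "hodge8 (ext_deriv (semidirect T) Omega0) [basis8 3, basis8 5, basis8 7] = E 3 2 - E 5 4 - E 7 6"
  "hodge8 (ext_deriv (semidirect T) Omega0) [basis8 3, basis8 6, basis8 7] = - E 3 1 - E 6 4 + E 7 5"
  "hodge8 (ext_deriv (semidirect T) Omega0) [basis8 4, basis8 5, basis8 6] = - E 4 3 + E 5 2 - E 6 1"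
  "hodge8 (ext_deriv (semidirect T) Omega0) [basis8 4, basis8 5, basis8 7] = E 4 2 + E 5 3 - E 7 1"
  "hodge8 (ext_deriv (semidirect T) Omega0) [basis8 4, basis8 6, basis8 7] = - E 4 1 + E 6 3 - E 7 2"
  "hodge8 (ext_deriv (semidirect T) Omega0) [basis8 5, basis8 6, basis8 7] = - E 5 1 - E 6 2 - E 7 3"
  by (simp_all add: hodge8_basis_3 ext_deriv_semidirect[OF T altform_Omega0] act_Omega0_basis vol8_def
      wedge8_basis_Cons wedge8_Nil Omega0_contract_table ideal_map_inner_0[OF T] E_def coeff8_def
      del: list.map One_nat_def)


definition symmetric_scalar :: "real \<Rightarrow> (nat \<Rightarrow> nat \<Rightarrow> real) \<Rightarrow> bool" where
  "symmetric_scalar h E \<longleftrightarrow> (\<forall>i\<in>{1..7}. \<forall>j\<in>{1..7}. E i j + E j i = (if i = j then 2 * h else 0))"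

text \<open>
  For a skew-symmetric matrix \<open>W\<close> these are the equations of the subalgebra \<open>\<gg>\<^sub>2\<close> of
  \<open>\<ss>\<oo>(7)\<close> stabilising the 3-form \<open>i(e\<^sub>0)\<Omega>\<^sub>0\<close>, one for each index \<open>1, \<dots>, 7\<close>.
\<close>

definition g2_relations :: "(nat \<Rightarrow> nat \<Rightarrow> real) \<Rightarrow> bool" where
  "g2_relations W \<longleftrightarrow>
     W 2 3 = W 4 5 + W 6 7 \<and> W 1 3 = W 5 7 - W 4 6 \<and> W 1 2 = W 4 7 + W 5 6 \<and>
     W 1 5 + W 2 6 + W 3 7 = 0 \<and> W 1 4 + W 2 7 = W 3 6 \<and> W 1 7 = W 2 4 + W 3 5 \<and>
     W 1 6 + W 3 4 = W 2 5"

lemma atLeastAtMost_1_7: "{1..7} = {1, 2, 3, 4, 5, 6, 7 :: nat}"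
  by auto

section \<open>The three types as linear conditions on the entries of T\<close>

lemma hodge_dOmega0_altform:
  assumes "ideal_map T"
  shows "altform 3 (hodge8 (ext_deriv (semidirect T) Omega0))"
  using hodge8_altform[OF ext_deriv_altform[OF altform_Omega0 bilinear_semidirect semidirect_self]] assms
  by (simp add: ideal_map_def)

text \<open>The 35 equations on the ideal split: seven equate sums of four diagonal entries to 4 h,
  which forces each to be \<open>h\<close>; the other 28 amount to the 21 off-diagonal symmetry
  conditions and the seven g2 relations. The factor -4 is read off from T = h Id, where the
  component at (1,2,3) is -4 h.\<close>

lemma hodge_dOmega0_eq_iff:
  assumes T: "ideal_map T"
  shows "hodge8 (ext_deriv (semidirect T) Omega0) = (\<lambda>xs. - 4 * h * Omega0 (basis8 0 # xs)) \<longleftrightarrow>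
    symmetric_scalar h (coeff8 T) \<and> g2_relations (\<lambda>i j. coeff8 T i j - coeff8 T j i)"
    (is "?\<alpha> = ?\<beta> \<longleftrightarrow> ?P")
proof
  define E where "E = coeff8 T"
  note table = hodge_dOmega0_table[OF T, folded E_def] Omega0_basis_table
  assume eq: "?\<alpha> = ?\<beta>"
  have eqs:
    "?\<alpha> [basis8 1, basis8 2, basis8 3] = - 4 * h * Omega0 [basis8 0, basis8 1, basis8 2, basis8 3]"
    "?\<alpha> [basis8 1, basis8 2, basis8 4] = - 4 * h * Omega0 [basis8 0, basis8 1, basis8 2, basis8 4]"
    "?\<alpha> [basis8 1, basis8 2, basis8 5] = - 4 * h * Omega0 [basis8 0, basis8 1, basis8 2, basis8 5]"
    "?\<alpha> [basis8 1, basis8 2, basis8 6] = - 4 * h * Omega0 [basis8 0, basis8 1, basis8 2, basis8 6]"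
    "?\<alpha> [basis8 1, basis8 2, basis8 7] = - 4 * h * Omega0 [basis8 0, basis8 1, basis8 2, basis8 7]"
    "?\<alpha> [basis8 1, basis8 3, basis8 4] = - 4 * h * Omega0 [basis8 0, basis8 1, basis8 3, basis8 4]"
    "?\<alpha> [basis8 1, basis8 3, basis8 5] = - 4 * h * Omega0 [basis8 0, basis8 1, basis8 3, basis8 5]"
    "?\<alpha> [basis8 1, basis8 3, basis8 6] = - 4 * h * Omega0 [basis8 0, basis8 1, basis8 3, basis8 6]"
    "?\<alpha> [basis8 1, basis8 3, basis8 7] = - 4 * h * Omega0 [basis8 0, basis8 1, basis8 3, basis8 7]"
    "?\<alpha> [basis8 1, basis8 4, basis8 5] = - 4 * h * Omega0 [basis8 0, basis8 1, basis8 4, basis8 5]"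
    "?\<alpha> [basis8 1, basis8 4, basis8 6] = - 4 * h * Omega0 [basis8 0, basis8 1, basis8 4, basis8 6]"
    "?\<alpha> [basis8 1, basis8 4, basis8 7] = - 4 * h * Omega0 [basis8 0, basis8 1, basis8 4, basis8 7]"
    "?\<alpha> [basis8 1, basis8 5, basis8 6] = - 4 * h * Omega0 [basis8 0, basis8 1, basis8 5, basis8 6]"
    "?\<alpha> [basis8 1, basis8 5, basis8 7] = - 4 * h * Omega0 [basis8 0, basis8 1, basis8 5, basis8 7]"
    "?\<alpha> [basis8 1, basis8 6, basis8 7] = - 4 * h * Omega0 [basis8 0, basis8 1, basis8 6, basis8 7]"
    "?\<alpha> [basis8 2, basis8 3, basis8 4] = - 4 * h * Omega0 [basis8 0, basis8 2, basis8 3, basis8 4]"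
    "?\<alpha> [basis8 2, basis8 3, basis8 5] = - 4 * h * Omega0 [basis8 0, basis8 2, basis8 3, basis8 5]"
    "?\<alpha> [basis8 2, basis8 3, basis8 6] = - 4 * h * Omega0 [basis8 0, basis8 2, basis8 3, basis8 6]"
    "?\<alpha> [basis8 2, basis8 3, basis8 7] = - 4 * h * Omega0 [basis8 0, basis8 2, basis8 3, basis8 7]"
    "?\<alpha> [basis8 2, basis8 4, basis8 5] = - 4 * h * Omega0 [basis8 0, basis8 2, basis8 4, basis8 5]"
    "?\<alpha> [basis8 2, basis8 4, basis8 6] = - 4 * h * Omega0 [basis8 0, basis8 2, basis8 4, basis8 6]"
    "?\<alpha> [basis8 2, basis8 4, basis8 7] = - 4 * h * Omega0 [basis8 0, basis8 2, basis8 4, basis8 7]"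
    "?\<alpha> [basis8 2, basis8 5, basis8 6] = - 4 * h * Omega0 [basis8 0, basis8 2, basis8 5, basis8 6]"
    "?\<alpha> [basis8 2, basis8 5, basis8 7] = - 4 * h * Omega0 [basis8 0, basis8 2, basis8 5, basis8 7]"
    "?\<alpha> [basis8 2, basis8 6, basis8 7] = - 4 * h * Omega0 [basis8 0, basis8 2, basis8 6, basis8 7]"
    "?\<alpha> [basis8 3, basis8 4, basis8 5] = - 4 * h * Omega0 [basis8 0, basis8 3, basis8 4, basis8 5]"
    "?\<alpha> [basis8 3, basis8 4, basis8 6] = - 4 * h * Omega0 [basis8 0, basis8 3, basis8 4, basis8 6]"
    "?\<alpha> [basis8 3, basis8 4, basis8 7] = - 4 * h * Omega0 [basis8 0, basis8 3, basis8 4, basis8 7]"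
    "?\<alpha> [basis8 3, basis8 5, basis8 6] = - 4 * h * Omega0 [basis8 0, basis8 3, basis8 5, basis8 6]"
    "?\<alpha> [basis8 3, basis8 5, basis8 7] = - 4 * h * Omega0 [basis8 0, basis8 3, basis8 5, basis8 7]"
    "?\<alpha> [basis8 3, basis8 6, basis8 7] = - 4 * h * Omega0 [basis8 0, basis8 3, basis8 6, basis8 7]"
    "?\<alpha> [basis8 4, basis8 5, basis8 6] = - 4 * h * Omega0 [basis8 0, basis8 4, basis8 5, basis8 6]"
    "?\<alpha> [basis8 4, basis8 5, basis8 7] = - 4 * h * Omega0 [basis8 0, basis8 4, basis8 5, basis8 7]"
    "?\<alpha> [basis8 4, basis8 6, basis8 7] = - 4 * h * Omega0 [basis8 0, basis8 4, basis8 6, basis8 7]"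
    "?\<alpha> [basis8 5, basis8 6, basis8 7] = - 4 * h * Omega0 [basis8 0, basis8 5, basis8 6, basis8 7]"
    unfolding eq by (rule refl)+
  show ?P
    unfolding symmetric_scalar_def g2_relations_def atLeastAtMost_1_7 E_def[symmetric]
    using eqs[unfolded table] by (simp del: One_nat_def)
next
  define E where "E = coeff8 T"
  note table = hodge_dOmega0_table[OF T, folded E_def] Omega0_basis_table
  assume ?P
  then have lin: "symmetric_scalar h E" "g2_relations (\<lambda>i j. E i j - E j i)" by (simp_all add: E_def)
  show "?\<alpha> = ?\<beta>"
  proof (rule altform_eqI[OF hodge_dOmega0_altform[OF T]])
    show "altform 3 ?\<beta>"
      using altform_scale[OF altform_contract[OF altform_Omega0, of "basis8 0"], of "\<lambda>_. - 4 * h"] by simp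
    have degenerate: "Omega0 [basis8 0, basis8 0, x, y] = 0" for x y
      by (rule altform_adjacent_hd[OF altform_Omega0])
    have "\<forall>I\<in>set (filter (\<lambda>I. length I = 3) (subseqs [0..<8])). ?\<alpha> (map basis8 I) = ?\<beta> (map basis8 I)"
      using lin unfolding subseqs_upt_8_3 symmetric_scalar_def g2_relations_def atLeastAtMost_1_7
      by (simp add: table degenerate del: One_nat_def)
    then show "?\<alpha> (map basis8 I) = ?\<beta> (map basis8 I)"
      if "I \<in> set (filter (\<lambda>I. length I = 3) (subseqs [0..<8]))" for I
      using that by (rule bspec)
  qed
qed

lemma parallel_semidirect_iff:
  assumes T: "ideal_map T"
  shows "spin7_parallel (semidirect T) Omega0 \<longleftrightarrow>
    symmetric_scalar 0 (coeff8 T) \<and> g2_relations (\<lambda>i j. coeff8 T i j - coeff8 T j i)"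
  using hodge_dOmega0_eq_iff[OF T, of 0] by (simp add: spin7_parallel_def)

lemma lcp_semidirect_iff:
  assumes T: "ideal_map T"
  shows "spin7_lcp (semidirect T) Omega0 \<longleftrightarrow>
    (\<exists>h. symmetric_scalar h (coeff8 T) \<and> g2_relations (\<lambda>i j. coeff8 T i j - coeff8 T j i))"
proof -
  let ?\<alpha> = "hodge8 (ext_deriv (semidirect T) Omega0)"
  have "(\<exists>X. ?\<alpha> = interior_product X Omega0) \<longleftrightarrow> (\<exists>h. ?\<alpha> = (\<lambda>xs. - 4 * h * Omega0 (basis8 0 # xs)))"
  proof
    assume "\<exists>X. ?\<alpha> = interior_product X Omega0"
    then obtain X where X: "?\<alpha> = interior_product X Omega0" by blast
    \<comment> \<open>Triples containing 0 give zero on one side and a coordinate of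
      \<open>X\<close> on the other, so \<open>X\<close> is a multiple of \<open>basis8 0\<close>;
      minus a quarter of its coefficient is then the scalar \<open>h\<close>.\<close>
    have "?\<alpha> [basis8 0, basis8 1, basis8 i] = Omega0 [X, basis8 0, basis8 1, basis8 i]"
      "?\<alpha> [basis8 0, basis8 2, basis8 3] = Omega0 [X, basis8 0, basis8 2, basis8 3]" for i
      unfolding X by (simp_all add: interior_product_def)
    from this(1)[of 2] this(1)[of 3] this(1)[of 4] this(1)[of 5] this(1)[of 6] this(1)[of 7] this(2)
    have zero: "basis8 1 \<bullet> X = 0" "basis8 2 \<bullet> X = 0" "basis8 3 \<bullet> X = 0" "basis8 4 \<bullet> X = 0"
      "basis8 5 \<bullet> X = 0" "basis8 6 \<bullet> X = 0" "basis8 7 \<bullet> X = 0"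
      by (simp_all only: hodge_dOmega0_table[OF T] Omega0_contract_table)
    have "X = (basis8 0 \<bullet> X) *\<^sub>R basis8 0"
      by (subst basis8_expansion[of X]) (simp add: sum_lessThan_8 zero del: One_nat_def)
    then have "Omega0 (X # xs) = (basis8 0 \<bullet> X) * Omega0 (basis8 0 # xs)" for xs
      using linear_cmul[OF altform_linear_hd[OF altform_Omega0], of "basis8 0 \<bullet> X" "basis8 0" xs] by simp
    then have "?\<alpha> = (\<lambda>xs. - 4 * (- (basis8 0 \<bullet> X) / 4) * Omega0 (basis8 0 # xs))"
      by (simp add: X interior_product_def)
    then show "\<exists>h. ?\<alpha> = (\<lambda>xs. - 4 * h * Omega0 (basis8 0 # xs))" by blast
  next
    assume "\<exists>h. ?\<alpha> = (\<lambda>xs. - 4 * h * Omega0 (basis8 0 # xs))"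
    then obtain h where h: "?\<alpha> = (\<lambda>xs. - 4 * h * Omega0 (basis8 0 # xs))" by blast
    have "?\<alpha> = interior_product ((- 4 * h) *\<^sub>R basis8 0) Omega0"
      unfolding h interior_product_def
      using linear_cmul[OF altform_linear_hd[OF altform_Omega0], of "- 4 * h" "basis8 0"] by simp
    then show "\<exists>X. ?\<alpha> = interior_product X Omega0" by blast
  qed
  then show ?thesis
    unfolding spin7_lcp_def Lambda3_8_def using hodge_dOmega0_eq_iff[OF T] by simp
qed

text \<open>
  The shuffles of a list into \<open>p\<close> chosen entries and the rest, with signs: passing over an entry while
  \<open>p\<close> entries are still to be chosen contributes \<open>(-1)\<^sup>p\<close>.
\<close>

fun splits :: "nat \<Rightarrow> 'a list \<Rightarrow> (real \<times> 'a list \<times> 'a list) list" where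
  "splits 0 xs = [(1, [], xs)]"
| "splits (Suc p) [] = []"
| "splits (Suc p) (x # xs) = map (\<lambda>(s, c, r). (s, x # c, r)) (splits p xs) @
     map (\<lambda>(s, c, r). ((- 1) ^ Suc p * s, c, x # r)) (splits (Suc p) xs)"

lemma wedge_eq_splits:
  "altform p \<alpha> \<Longrightarrow> wedge \<alpha> \<beta> (map f xs) = (\<Sum>(s, c, r)\<leftarrow>splits p xs. s * \<alpha> (map f c) * \<beta> (map f r))"
proof (induction p xs arbitrary: \<alpha> \<beta> rule: splits.induct)
  case (1 xs)
  have "\<alpha> = (\<lambda>ys. if ys = [] then \<alpha> [] else 0)"
    using altform_length[OF 1] by auto
  then have "wedge \<alpha> \<beta> (map f xs) = \<alpha> [] * \<beta> (map f xs)"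
    using wedge_one_form0[of "\<alpha> []" \<beta> "map f xs"] by simp
  then show ?case by simp
next
  case (2 p)
  then show ?case using altform_length[OF 2, of "[]"] by (simp add: wedge_Nil)
next
  case (3 p x xs)
  \<comment> \<open>The form vanishes on lists of length other than \<open>Suc p\<close>, so the
    length-dependent sign may be taken constant.\<close>
  have "(\<lambda>ys. (- 1) ^ length ys * \<alpha> ys) = (\<lambda>ys. (- 1) ^ Suc p * \<alpha> ys)"
  proof
    fix ys
    show "(- 1) ^ length ys * \<alpha> ys = (- 1) ^ Suc p * \<alpha> ys"
      by (cases "length ys = Suc p") (use altform_length[OF 3(3), of ys] in auto)
  qed
  then have "wedge \<alpha> \<beta> (map f (x # xs)) = wedge (\<lambda>ys. \<alpha> (f x # ys)) \<beta> (map f xs) +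
      (- 1) ^ Suc p * wedge \<alpha> (\<lambda>ys. \<beta> (f x # ys)) (map f xs)"
    by (simp add: wedge_Cons) (simp add: wedge_def sum_distrib_left mult_ac sum_negf)
  then show ?case
    using 3(1)[OF altform_contract[OF 3(3), of "f x", simplified]] 3(2)[OF 3(3)]
    by (simp add: case_prod_unfold o_def sum_list_const_mult[symmetric] mult_ac sum_list_addf)
qed

text \<open>The wedge with \<open>Omega0\<close> is a 7-form with eight components: the seven
  containing index 0 are, up to sign, twice the g2 relations, and the one on the ideal is -4 times
  the trace. The trace-free symmetric part drops out.\<close>

lemma balanced_semidirect_iff:
  assumes T: "ideal_map T"
  shows "spin7_balanced (semidirect T) Omega0 \<longleftrightarrow>
    (\<Sum>i=1..7. coeff8 T i i) = 0 \<and> g2_relations (\<lambda>i j. coeff8 T i j - coeff8 T j i)"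
proof -
  let ?\<alpha> = "hodge8 (ext_deriv (semidirect T) Omega0)"
  define E where "E = coeff8 T"
  note \<alpha> = hodge_dOmega0_altform[OF T]
  note table = hodge_dOmega0_table[OF T, folded E_def] Omega0_basis_table
  have trace: "(\<Sum>i=1..7. E i i) = E 1 1 + E 2 2 + E 3 3 + E 4 4 + E 5 5 + E 6 6 + E 7 7"
    unfolding atLeastAtMost_1_7 by (simp del: One_nat_def)
  have wedge: "wedge ?\<alpha> Omega0 (map basis8 xs) =
      (\<Sum>(s, c, r)\<leftarrow>splits (Suc (Suc (Suc 0))) xs. s * ?\<alpha> (map basis8 c) * Omega0 (map basis8 r))" for xs
    by (rule wedge_eq_splits) (use \<alpha> in \<open>simp add: numeral_3_eq_3\<close>)
  have components:
    "wedge ?\<alpha> Omega0 (map basis8 [0, 1, 2, 3, 4, 5, 6]) = 2 * E 1 6 - 2 * E 2 5 + 2 * E 3 4 - 2 * E 4 3 + 2 * E 5 2 - 2 * E 6 1"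
    "wedge ?\<alpha> Omega0 (map basis8 [0, 1, 2, 3, 4, 5, 7]) = 2 * E 1 7 - 2 * E 2 4 - 2 * E 3 5 + 2 * E 4 2 + 2 * E 5 3 - 2 * E 7 1"
    "wedge ?\<alpha> Omega0 (map basis8 [0, 1, 2, 3, 4, 6, 7]) = 2 * E 1 4 + 2 * E 2 7 - 2 * E 3 6 - 2 * E 4 1 + 2 * E 6 3 - 2 * E 7 2"
    "wedge ?\<alpha> Omega0 (map basis8 [0, 1, 2, 3, 5, 6, 7]) = 2 * E 1 5 + 2 * E 2 6 + 2 * E 3 7 - 2 * E 5 1 - 2 * E 6 2 - 2 * E 7 3"
    "wedge ?\<alpha> Omega0 (map basis8 [0, 1, 2, 4, 5, 6, 7]) = - 2 * E 1 2 + 2 * E 2 1 + 2 * E 4 7 + 2 * E 5 6 - 2 * E 6 5 - 2 * E 7 4"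
    "wedge ?\<alpha> Omega0 (map basis8 [0, 1, 3, 4, 5, 6, 7]) = - 2 * E 1 3 + 2 * E 3 1 - 2 * E 4 6 + 2 * E 5 7 + 2 * E 6 4 - 2 * E 7 5"
    "wedge ?\<alpha> Omega0 (map basis8 [0, 2, 3, 4, 5, 6, 7]) = - 2 * E 2 3 + 2 * E 3 2 + 2 * E 4 5 - 2 * E 5 4 + 2 * E 6 7 - 2 * E 7 6"
    "wedge ?\<alpha> Omega0 (map basis8 [1, 2, 3, 4, 5, 6, 7]) = - 4 * E 1 1 - 4 * E 2 2 - 4 * E 3 3 - 4 * E 4 4 - 4 * E 5 5 - 4 * E 6 6 - 4 * E 7 7"
    unfolding wedge by (simp_all add: table del: One_nat_def)
  have "wedge ?\<alpha> Omega0 = (\<lambda>_. 0) \<longleftrightarrow>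
      (\<forall>I\<in>set (filter (\<lambda>I. length I = 7) (subseqs [0..<8])). wedge ?\<alpha> Omega0 (map basis8 I) = 0)" (is "_ \<longleftrightarrow> ?V")
  proof
    assume ?V
    show "wedge ?\<alpha> Omega0 = (\<lambda>_. 0)"
    proof (rule altform_eqI[OF _ altform_zero])
      show "altform 7 (wedge ?\<alpha> Omega0)"
        using wedge_altform[OF \<alpha> altform_Omega0] by simp
    qed (use \<open>?V\<close> in blast)
  qed simp
  also have "\<dots> \<longleftrightarrow> (\<Sum>i=1..7. E i i) = 0 \<and> g2_relations (\<lambda>i j. E i j - E j i)"
    unfolding trace g2_relations_def subseqs_upt_8_7
    by (simp only: list.set ball_simps components) (auto simp del: One_nat_def)
  finally show ?thesis
    using \<alpha> by (simp add: spin7_balanced_def Lambda3_48_def forms_eq_altform E_def)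
qed


subsection \<open>Reduction to the standard 4-form\<close>

lemma span_basis8: "span (basis8 ` {1..7}) = {x. basis8 0 \<bullet> x = 0}"
proof
  have "basis8 i \<in> {x. basis8 0 \<bullet> x = 0}" if "i \<in> {1..7}" for i
    using that by (simp add: inner_basis8)
  then show "span (basis8 ` {1..7}) \<subseteq> {x. basis8 0 \<bullet> x = 0}"
    by (intro span_minimal subspace_hyperplane) auto
next
  show "{x. basis8 0 \<bullet> x = 0} \<subseteq> span (basis8 ` {1..7})"
  proof
    fix x assume "x \<in> {x. basis8 0 \<bullet> x = 0}"
    then have x: "basis8 0 \<bullet> x = 0" by simp
    have "(\<Sum>i<8. (basis8 i \<bullet> x) *\<^sub>R basis8 i) \<in> span (basis8 ` {1..7})"
    proof (rule span_sum)
      fix i :: nat assume "i \<in> {..<8}"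
      then show "(basis8 i \<bullet> x) *\<^sub>R basis8 i \<in> span (basis8 ` {1..7})"
      proof (cases "i = 0")
        case True
        then show ?thesis using x span_zero by simp
      next
        case False
        with \<open>i \<in> {..<8}\<close> have "i \<in> {1..7}" by auto
        then show ?thesis by (intro span_scale span_base imageI)
      qed
    qed
    then show "x \<in> span (basis8 ` {1..7})" using basis8_expansion[of x] by simp
  qed
qed

lemma abelian_ideal_semidirect:
  assumes br: "lie_bracket br" and ideal: "abelian_ideal br (span (basis8 ` {1..7}))"
  shows "ideal_map (br (basis8 0))" "br = semidirect (br (basis8 0))"
proof -
  let ?V = "{x. basis8 0 \<bullet> x = 0}" and ?T = "br (basis8 0)"
  have bil: "bilinear br" and alt: "br x x = 0" for x using br by (auto simp: lie_bracket_def)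
  have V: "y \<in> ?V \<Longrightarrow> br x y \<in> ?V" "x \<in> ?V \<Longrightarrow> y \<in> ?V \<Longrightarrow> br x y = 0" for x y
    using ideal unfolding abelian_ideal_def span_basis8 by blast+
  have anti: "br x y = - br y x" for x y
  proof -
    have "br (x + y) (x + y) = br x x + br x y + (br y x + br y y)"
      by (simp only: bilinear_ladd[OF bil] bilinear_radd[OF bil] add_ac)
    then have "br x y + br y x = 0" by (simp add: alt)
    then show ?thesis by (simp only: eq_neg_iff_add_eq_0)
  qed
  define p where "p x = x - (basis8 0 \<bullet> x) *\<^sub>R basis8 0" for x
  have p: "p x \<in> ?V" "x = (basis8 0 \<bullet> x) *\<^sub>R basis8 0 + p x" for x
    by (simp_all add: p_def inner_diff_right inner_basis8)
  have Tp: "?T x = ?T (p x)" for x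
    by (subst p(2)) (simp add: bilinear_radd[OF bil] bilinear_rmul[OF bil] alt)
  show "ideal_map ?T"
    unfolding ideal_map_def
  proof (intro conjI allI)
    show "linear ?T" using bil by (simp add: bilinear_def)
    show "?T (basis8 0) = 0" by (rule alt)
    show "basis8 0 \<bullet> ?T x = 0" for x unfolding Tp[of x] using V(1)[OF p(1)] by simp
  qed
  show "br = semidirect ?T"
  proof (intro ext)
    fix x y
    have "br x y = br ((basis8 0 \<bullet> x) *\<^sub>R basis8 0 + p x) ((basis8 0 \<bullet> y) *\<^sub>R basis8 0 + p y)"
      by (simp flip: p(2))
    also have "\<dots> = (basis8 0 \<bullet> x) *\<^sub>R ?T (p y) + (basis8 0 \<bullet> y) *\<^sub>R br (p x) (basis8 0)"
      by (simp add: bilinear_ladd[OF bil] bilinear_radd[OF bil] bilinear_lmul[OF bil] bilinear_rmul[OF bil]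
          alt V(2)[OF p(1) p(1)])
    also have "\<dots> = semidirect ?T x y"
      by (simp add: semidirect_def Tp[of x] Tp[of y] anti[of "p x"])
    finally show "br x y = semidirect ?T x y" .
  qed
qed

lemma pullback_eq_iff:
  assumes "surj g" shows "pullback g \<alpha> = pullback g \<beta> \<longleftrightarrow> \<alpha> = \<beta>"
proof
  assume eq: "pullback g \<alpha> = pullback g \<beta>"
  show "\<alpha> = \<beta>"
  proof
    fix xs
    have "map g (map (inv_into UNIV g) xs) = xs"
      by (simp add: map_idI surj_f_inv_f[OF assms])
    then show "\<alpha> xs = \<beta> xs"
      using fun_cong[OF eq, of "map (inv_into UNIV g) xs"] by (simp only: pullback_def)
  qed
qed simp

text \<open>Pullback commutes with d, wedge and contraction, and with the star up to a nonzero
  factor \<open>s\<close>, which is absorbed into the contracted vector or factored out.\<close>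

lemma spin7_types_pullback:
  assumes g: "orthogonal_transformation g" and br': "bilinear br'" "\<And>x. br' x x = 0"
    and hom: "\<And>x y. g (br x y) = br' (g x) (g y)" and \<Omega>: "altform 4 \<Omega>"
  shows "spin7_parallel br (pullback g \<Omega>) \<longleftrightarrow> spin7_parallel br' \<Omega>"
    "spin7_lcp br (pullback g \<Omega>) \<longleftrightarrow> spin7_lcp br' \<Omega>"
    "spin7_balanced br (pullback g \<Omega>) \<longleftrightarrow> spin7_balanced br' \<Omega>"
proof -
  have d: "altform 5 (ext_deriv br' \<Omega>)"
    using ext_deriv_altform[OF \<Omega> br'] by simp
  define \<alpha> where "\<alpha> = hodge8 (ext_deriv br' \<Omega>)"
  have \<alpha>: "altform 3 \<alpha>" unfolding \<alpha>_def using hodge8_altform[OF d] by simp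
  have surj: "surj g" by (rule orthogonal_transformation_surj[OF g])
  have lin: "linear g" using g by (simp add: orthogonal_transformation_def)
  obtain s where s: "s \<noteq> 0"
    "hodge8 (pullback g (ext_deriv br' \<Omega>)) = (\<lambda>ys. s * pullback g \<alpha> ys)"
    using hodge8_pullback[OF g] d unfolding \<alpha>_def by metis
  have hodge: "hodge8 (ext_deriv br (pullback g \<Omega>)) = pullback g (\<lambda>ys. s * \<alpha> ys)"
    using s(2) by (simp add: ext_deriv_pullback[where g = g and br = br and br' = br', OF hom]) (simp add: pullback_def)
  have zero: "pullback g \<beta> = (\<lambda>_. 0) \<longleftrightarrow> \<beta> = (\<lambda>_. 0)" for \<beta>
    using pullback_eq_iff[OF surj, of \<beta> "\<lambda>_. 0"] by (simp add: pullback_def)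
  show "spin7_parallel br (pullback g \<Omega>) \<longleftrightarrow> spin7_parallel br' \<Omega>"
    unfolding spin7_parallel_def hodge zero \<alpha>_def[symmetric] using s(1) by (simp add: fun_eq_iff)
  have int: "interior_product x (pullback g \<Omega>) = pullback g (interior_product (g x) \<Omega>)" for x
    by (simp add: interior_product_def pullback_def)
  have scale: "interior_product (c *\<^sub>R y) \<Omega> = (\<lambda>ys. c * interior_product y \<Omega> ys)" for c y
    using linear_cmul[OF altform_linear_hd[OF \<Omega>]] by (simp add: interior_product_def)
  have "(\<exists>x. (\<lambda>ys. s * \<alpha> ys) = interior_product (g x) \<Omega>) \<longleftrightarrow> (\<exists>y. \<alpha> = interior_product y \<Omega>)"
  proof
    assume "\<exists>x. (\<lambda>ys. s * \<alpha> ys) = interior_product (g x) \<Omega>"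
    then obtain x where x: "(\<lambda>ys. s * \<alpha> ys) = interior_product (g x) \<Omega>" by blast
    have "\<alpha> = interior_product ((1 / s) *\<^sub>R g x) \<Omega>"
      unfolding scale x[symmetric] using s(1) by simp
    then show "\<exists>y. \<alpha> = interior_product y \<Omega>" by blast
  next
    assume "\<exists>y. \<alpha> = interior_product y \<Omega>"
    then obtain y where y: "\<alpha> = interior_product y \<Omega>" by blast
    obtain x where "g x = s *\<^sub>R y" using surj by (metis surjD)
    then show "\<exists>x. (\<lambda>ys. s * \<alpha> ys) = interior_product (g x) \<Omega>" using scale y by metis
  qed
  then show "spin7_lcp br (pullback g \<Omega>) \<longleftrightarrow> spin7_lcp br' \<Omega>"
    unfolding spin7_lcp_def Lambda3_8_def hodge int \<alpha>_def[symmetric] by (simp add: pullback_eq_iff[OF surj])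
  have s\<alpha>: "altform 3 (\<lambda>ys. s * \<alpha> ys)" using altform_scale[OF \<alpha>, of "\<lambda>_. s"] by simp
  have "wedge (\<lambda>ys. s * \<alpha> ys) \<Omega> = (\<lambda>ys. s * wedge \<alpha> \<Omega> ys)"
    by (simp add: wedge_def sum_distrib_left mult_ac)
  then show "spin7_balanced br (pullback g \<Omega>) \<longleftrightarrow> spin7_balanced br' \<Omega>"
    unfolding spin7_balanced_def Lambda3_48_def forms_eq_altform hodge \<alpha>_def[symmetric] mem_Collect_eq
      wedge_pullback zero
    using s(1) \<alpha> pullback_altform[OF s\<alpha> lin] by (simp add: fun_eq_iff)
qed

section \<open>Conjugation by isometries fixing e0\<close>

definition conj_map :: "(real^8 \<Rightarrow> real^8) \<Rightarrow> (real^8 \<Rightarrow> real^8) \<Rightarrow> real^8 \<Rightarrow> real^8" where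
  "conj_map h T = (\<lambda>x. h (T (inv_into UNIV h x)))"

text \<open>This is O(7) rather than SO(7); orientation is restored in
  \<open>fixing0_spin7_structure\<close>.\<close>

definition fixing0 :: "(real^8 \<Rightarrow> real^8) \<Rightarrow> bool" where
  "fixing0 h \<longleftrightarrow> orthogonal_transformation h \<and> h (basis8 0) = basis8 0"

lemma fixing0_inner: "fixing0 h \<Longrightarrow> h x \<bullet> h y = x \<bullet> y"
  and fixing0_linear: "fixing0 h \<Longrightarrow> linear h"
  by (auto simp: fixing0_def orthogonal_transformation_def)

lemma fixing0_inv_f: "fixing0 h \<Longrightarrow> inv_into UNIV h (h x) = x"
  and fixing0_f_inv: "fixing0 h \<Longrightarrow> h (inv_into UNIV h x) = x"
  by (auto simp: fixing0_def inv_f_f[OF orthogonal_transformation_inj] surj_f_inv_f[OF orthogonal_transformation_surj])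

lemma fixing0_inv: "fixing0 h \<Longrightarrow> fixing0 (inv_into UNIV h)"
  using orthogonal_transformation_inv[of h] fixing0_inv_f[of h "basis8 0"] by (auto simp: fixing0_def)

lemma fixing0_inner_0: "fixing0 h \<Longrightarrow> basis8 0 \<bullet> h x = basis8 0 \<bullet> x"
  using fixing0_inner[of h "basis8 0" x] by (simp add: fixing0_def)

lemma fixing0_compose: "fixing0 g \<Longrightarrow> fixing0 h \<Longrightarrow> fixing0 (g \<circ> h)"
  by (auto simp: fixing0_def orthogonal_transformation_compose)

lemma conj_map_ideal_map:
  assumes h: "fixing0 h" and T: "ideal_map T"
  shows "ideal_map (conj_map h T)"
  unfolding ideal_map_def conj_map_def
proof (intro conjI allI)
  have "linear (\<lambda>x. inv_into UNIV h x)" using fixing0_linear[OF fixing0_inv[OF h]] .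
  then show "linear (\<lambda>x. h (T (inv_into UNIV h x)))"
    using linear_compose[OF _ linear_compose[OF _ fixing0_linear[OF h]]] T
    unfolding ideal_map_def o_def by metis
  show "h (T (inv_into UNIV h (basis8 0))) = 0"
    using T fixing0_inv[OF h] linear_0[OF fixing0_linear[OF h]] by (simp add: ideal_map_def fixing0_def)
  show "basis8 0 \<bullet> h (T (inv_into UNIV h x)) = 0" for x
    using T by (simp add: fixing0_inner_0[OF h] ideal_map_def)
qed

lemma spin7_types_semidirect:
  assumes h: "fixing0 h" and T: "ideal_map T"
  shows "spin7_parallel (semidirect T) (pullback h Omega0) \<longleftrightarrow> spin7_parallel (semidirect (conj_map h T)) Omega0"
    "spin7_lcp (semidirect T) (pullback h Omega0) \<longleftrightarrow> spin7_lcp (semidirect (conj_map h T)) Omega0"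
    "spin7_balanced (semidirect T) (pullback h Omega0) \<longleftrightarrow> spin7_balanced (semidirect (conj_map h T)) Omega0"
proof -
  have "h (semidirect T x y) = semidirect (conj_map h T) (h x) (h y)" for x y
    unfolding semidirect_def conj_map_def fixing0_inner_0[OF h] fixing0_inv_f[OF h]
    by (simp add: linear_diff[OF fixing0_linear[OF h]] linear_cmul[OF fixing0_linear[OF h]])
  moreover have "bilinear (semidirect (conj_map h T))"
    using conj_map_ideal_map[OF h T] bilinear_semidirect by (simp add: ideal_map_def)
  moreover have "orthogonal_transformation h" using h by (simp add: fixing0_def)
  ultimately show "spin7_parallel (semidirect T) (pullback h Omega0) \<longleftrightarrow> spin7_parallel (semidirect (conj_map h T)) Omega0"
    "spin7_lcp (semidirect T) (pullback h Omega0) \<longleftrightarrow> spin7_lcp (semidirect (conj_map h T)) Omega0"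
    "spin7_balanced (semidirect T) (pullback h Omega0) \<longleftrightarrow> spin7_balanced (semidirect (conj_map h T)) Omega0"
    using spin7_types_pullback[of h "semidirect (conj_map h T)" "semidirect T" Omega0]
    by (auto simp: semidirect_self altform_Omega0)
qed

text \<open>A stabiliser \<open>k\<close> of \<open>Omega0\<close> can be cancelled from the left:
  chosen to agree with the rotation \<open>f\<close> on \<open>basis8 0\<close>, its inverse after
  \<open>f\<close> fixes that vector and yields the same form.\<close>

lemma spin7_structure_fixing0:
  assumes "spin7_structure \<Omega>"
  obtains h where "fixing0 h" "\<Omega> = pullback h Omega0"
proof -
  obtain \<phi> :: "real^8^8" where \<phi>: "rotation_matrix \<phi>" "\<Omega> = pullback (\<lambda>x. \<phi> *v x) Omega0"
    using assms by (auto simp: spin7_structure_def)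
  define f where "f = (\<lambda>x. \<phi> *v x)"
  have f: "orthogonal_transformation f"
    using \<phi>(1) by (simp add: f_def orthogonal_transformation_matrix rotation_matrix_def)
  have "norm (f (basis8 0)) = 1"
    using f by (simp add: orthogonal_transformation basis8_def)
  then obtain k where k: "orthogonal_transformation k" "k (basis8 0) = f (basis8 0)" "pullback k Omega0 = Omega0"
    by (rule Omega0_stabilizer_transitive)
  let ?k' = "inv_into UNIV k"
  have kk': "k (?k' x) = x" "?k' (k x) = x" for x
    using orthogonal_transformation_surj[OF k(1)] orthogonal_transformation_inj[OF k(1)]
    by (auto simp: surj_f_inv_f inv_f_f)
  show thesis
  proof (rule that[of "?k' \<circ> f"])
    show "fixing0 (?k' \<circ> f)"
      using orthogonal_transformation_compose[OF orthogonal_transformation_inv[OF k(1)] f] kk'(2)[of "basis8 0"]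
      by (simp add: fixing0_def k(2))
    have "Omega0 (map (?k' \<circ> f) xs) = Omega0 (map f xs)" for xs
      using fun_cong[OF k(3), of "map (?k' \<circ> f) xs"] by (simp add: pullback_def kk' o_def)
    then show "\<Omega> = pullback (?k' \<circ> f) Omega0"
      by (simp add: \<phi>(2) pullback_def f_def)
  qed
qed

text \<open>Pulling back along a map of determinant -1 need not give a Spin(7) structure. The form
  may be changed as long as the conjugate of \<open>T\<close> is kept, because that conjugate alone
  decides the type.\<close>

lemma fixing0_spin7_structure:
  assumes h: "fixing0 h" and T: "ideal_map T"
  obtains g where "fixing0 g" "spin7_structure (pullback g Omega0)" "conj_map g T = conj_map h T"
proof -
  have struct: "spin7_structure (pullback g Omega0)" if g: "fixing0 g" and det: "Determinants.det (matrix g) = 1" for g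
  proof -
    have "orthogonal_matrix (matrix g)"
      using g orthogonal_transformation_matrix by (auto simp: fixing0_def)
    moreover have "g = (\<lambda>x. matrix g *v x)"
      using matrix_works[OF linear_matrix_vector_mul_eq[THEN iffD2, OF fixing0_linear[OF g]]] by (rule ext[OF sym])
    ultimately show ?thesis
      unfolding spin7_structure_def rotation_matrix_def using det by metis
  qed
  have "orthogonal_matrix (matrix h)"
    using h orthogonal_transformation_matrix by (auto simp: fixing0_def)
  then consider "Determinants.det (matrix h) = 1" | "Determinants.det (matrix h) = - 1" using det_orthogonal_matrix by blast
  then show thesis
  proof cases
    case 1
    then show ?thesis using that[OF h struct[OF h]] by blast
  next
    case 2
    \<comment> \<open>\<open>- 1\<close> on \<open>\<real>\<^sup>7\<close> has determinant \<open>- 1\<close> and commutes with \<open>T\<close>.\<close>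
    define r where "r x = (2 * (basis8 0 \<bullet> x)) *\<^sub>R basis8 0 - x" for x :: "real^8"
    have lin: "linear r"
      by (auto simp: r_def linear_iff inner_add_right algebra_simps)
    have "r x \<bullet> r x = x \<bullet> x" for x
      by (simp add: r_def inner_diff_left inner_diff_right inner_commute inner_basis8)
    then have r: "fixing0 r"
      using lin by (auto simp: fixing0_def orthogonal_transformation norm_eq_sqrt_inner)
        (simp add: r_def inner_basis8 scaleR_2)
    have entries: "matrix r $ i $ j = (if i = j then (if i = 0 then 1 else - 1) else 0)" for i j
      by (simp add: matrix_def r_def basis8_def inner_axis_axis) (auto simp: axis_def)
    have "Determinants.det (matrix r) = (\<Prod>i\<in>UNIV. matrix r $ i $ i)"
      by (rule det_diagonal) (simp add: entries)
    also have "\<dots> = (\<Prod>i<8. if (of_nat i :: 8) = 0 then 1 else - 1)"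
      unfolding entries by (subst prod.reindex_bij_betw[OF bij_of_nat_8, symmetric]) simp
    also have "\<dots> = (\<Prod>i<8::nat. if i = 0 then 1 else - 1)"
      by (rule prod.cong) (use of_nat_8_eq_iff[of _ 0] in auto)
    also have "\<dots> = - 1" by (simp add: eval_nat_numeral)
    finally have "Determinants.det (matrix (h \<circ> r)) = 1"
      using 2 fixing0_linear[OF h] lin by (simp add: matrix_compose det_mul)
    then have "spin7_structure (pullback (h \<circ> r) Omega0)"
      by (rule struct[OF fixing0_compose[OF h r]])
    moreover have "conj_map (h \<circ> r) T = conj_map h T"
    proof
      fix x
      have rr: "r (r y) = y" for y
        by (simp add: r_def inner_diff_right inner_basis8)
      have "inv_into UNIV (h \<circ> r) x = r (inv_into UNIV h x)"
        by (rule inv_f_eq) (use orthogonal_transformation_inj[of "h \<circ> r"] fixing0_compose[OF h r] in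
            \<open>auto simp: fixing0_def rr fixing0_f_inv[OF h]\<close>)
      moreover have "r (T (r y)) = T y" for y
      proof -
        have "T (r y) = - T y"
          using T by (simp add: r_def ideal_map_def linear_diff linear_cmul)
        then show ?thesis using T by (simp add: r_def ideal_map_def)
      qed
      ultimately show "conj_map (h \<circ> r) T x = conj_map h T x" by (simp add: conj_map_def)
    qed
    ultimately show ?thesis using that fixing0_compose[OF h r] by blast
  qed
qed

text \<open>Abstracting over a predicate \<Phi> of the three types lets one reduction serve all four
  existence statements, including those with negations.\<close>

lemma spin7_structure_exists_iff:
  assumes T: "ideal_map T"
  shows "(\<exists>\<Omega>. spin7_structure \<Omega> \<and>
      \<Phi> (spin7_parallel (semidirect T) \<Omega>) (spin7_lcp (semidirect T) \<Omega>) (spin7_balanced (semidirect T) \<Omega>)) \<longleftrightarrow>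
    (\<exists>h. fixing0 h \<and> \<Phi> (spin7_parallel (semidirect (conj_map h T)) Omega0)
      (spin7_lcp (semidirect (conj_map h T)) Omega0) (spin7_balanced (semidirect (conj_map h T)) Omega0))"
    (is "?L \<longleftrightarrow> ?R")
proof
  assume ?L
  then obtain \<Omega> where \<Omega>: "spin7_structure \<Omega>"
    "\<Phi> (spin7_parallel (semidirect T) \<Omega>) (spin7_lcp (semidirect T) \<Omega>) (spin7_balanced (semidirect T) \<Omega>)" by blast
  obtain h where h: "fixing0 h" "\<Omega> = pullback h Omega0" by (rule spin7_structure_fixing0[OF \<Omega>(1)])
  show ?R using \<Omega>(2) h(1) unfolding h(2) spin7_types_semidirect[OF h(1) T] by blast
next
  assume ?R
  then obtain h where h: "fixing0 h" "\<Phi> (spin7_parallel (semidirect (conj_map h T)) Omega0)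
      (spin7_lcp (semidirect (conj_map h T)) Omega0) (spin7_balanced (semidirect (conj_map h T)) Omega0)" by blast
  obtain g where g: "fixing0 g" "spin7_structure (pullback g Omega0)" "conj_map g T = conj_map h T"
    by (rule fixing0_spin7_structure[OF h(1) T])
  show ?L
    by (rule exI[of _ "pullback g Omega0"], unfold spin7_types_semidirect[OF g(1) T] g(3)) (use g(2) h(2) in blast)
qed


subsection \<open>Normal form of skew-symmetric maps\<close>

lemma unit_vector_orthogonal:
  fixes F :: "(real^8) set"
  assumes "finite F" "card F < 8"
  obtains x where "norm x = 1" "\<And>f. f \<in> F \<Longrightarrow> f \<bullet> x = 0"
proof -
  have "dim F < DIM(real^8)"
    using dim_le_card'[OF assms(1)] assms(2) by simp
  then obtain v where v: "v \<noteq> 0" "\<And>y. y \<in> span F \<Longrightarrow> v \<bullet> y = 0"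
    using orthogonal_to_subspace_exists unfolding Linear_Algebra.orthogonal_def by metis
  show thesis
    by (rule that[of "v /\<^sub>R norm v"]) (use v in \<open>auto simp: span_base inner_commute\<close>)
qed

lemma nonneg_quadratic_imp_linear_coeff_zero:
  fixes b c :: real
  assumes "\<And>t. 0 \<le> 2 * t * b + t\<^sup>2 * c"
  shows "b = 0"
proof (rule ccontr)
  assume "b \<noteq> 0"
  \<comment> \<open>At \<open>- b / k\<close> the quadratic is negative as soon as
    \<open>k > 0\<close> and \<open>c < 2 * k\<close>; adding 1 keeps \<open>k\<close> positive when
    \<open>c = 0\<close>.\<close>
  define k where "k = \<bar>c\<bar> + 1"
  have k: "k > 0" "c < 2 * k" by (auto simp: k_def)
  have "2 * (- b / k) * b + (- b / k)\<^sup>2 * c = b\<^sup>2 / k\<^sup>2 * (c - 2 * k)"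
    using k(1) by (simp add: field_simps power2_eq_square)
  also have "\<dots> < 0"
    using k \<open>b \<noteq> 0\<close> by (intro mult_pos_neg) auto
  finally show False using assms[of "- b / k"] by simp
qed

text \<open>A maximiser \<open>x\<close> of \<open>|S x|\<close> on the unit sphere of the invariant subspace is an eigenvector of \<open>S\<^sup>2\<close>.\<close>

lemma skew_invariant_plane:
  fixes S :: "real^8 \<Rightarrow> real^8"
  assumes S: "linear S" and skew: "\<And>x y. x \<bullet> S y = - (S x \<bullet> y)"
    and F: "finite F" "card F \<le> 6"
    and inv: "\<And>x. \<forall>f\<in>F. f \<bullet> x = 0 \<Longrightarrow> \<forall>f\<in>F. f \<bullet> S x = 0"
  obtains x y m where "0 \<le> m" "norm x = 1" "norm y = 1" "x \<bullet> y = 0"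
    "\<forall>f\<in>F. f \<bullet> x = 0" "\<forall>f\<in>F. f \<bullet> y = 0"
    "S x = m *\<^sub>R y" "S y = - m *\<^sub>R x"
proof -
  define V where "V = {x. \<forall>f\<in>F. f \<bullet> x = 0}"
  have SV: "S x \<in> V" if "x \<in> V" for x using inv that unfolding V_def by blast
  have V_add: "x + y \<in> V" if "x \<in> V" "y \<in> V" for x y using that by (simp add: V_def inner_add_right)
  have V_scale: "c *\<^sub>R x \<in> V" if "x \<in> V" for c x using that by (simp add: V_def)
  have "V = (\<Inter>f\<in>F. {x. f \<bullet> x = 0})" by (auto simp: V_def)
  then have "closed V" by (auto intro: closed_INT closed_hyperplane)
  then have compact: "compact (sphere 0 1 \<inter> V)" by (intro compact_Int_closed compact_sphere)
  obtain x0 where "norm x0 = 1" "\<And>f. f \<in> F \<Longrightarrow> f \<bullet> x0 = 0"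
    using unit_vector_orthogonal[OF F(1)] F(2) by auto
  then have "sphere 0 1 \<inter> V \<noteq> {}" by (auto simp: V_def)
  moreover have "continuous_on (sphere 0 1 \<inter> V) (\<lambda>x. norm (S x))"
    using S by (intro continuous_on_norm linear_continuous_on) (simp add: linear_conv_bounded_linear)
  ultimately obtain x where x: "x \<in> sphere 0 1 \<inter> V" "\<And>y. y \<in> sphere 0 1 \<inter> V \<Longrightarrow> norm (S y) \<le> norm (S x)"
    using continuous_attains_sup[OF compact] by blast
  define m where "m = norm (S x)"
  have nx: "norm x = 1" and xV: "x \<in> V" using x(1) by auto
  have bound: "norm (S v) \<le> m * norm v" if "v \<in> V" for v
  proof (cases "v = 0")
    case False
    have "norm (S (v /\<^sub>R norm v)) \<le> m"
      unfolding m_def by (rule x(2)) (use False V_scale[OF that] in auto)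
    then show ?thesis using False by (simp add: linear_cmul[OF S] field_simps)
  qed (simp add: linear_0[OF S])
  \<comment> \<open>The bound along \<open>x + t *\<^sub>R v\<close> is a quadratic inequality in
    \<open>t\<close> with equality at 0, so its linear coefficient vanishes.\<close>
  have first_variation: "S x \<bullet> S v = m\<^sup>2 * (x \<bullet> v)" if v: "v \<in> V" for v
  proof -
    have "m\<^sup>2 * (x \<bullet> v) - S x \<bullet> S v = 0"
    proof (rule nonneg_quadratic_imp_linear_coeff_zero)
      fix t
      have "norm (S (x + t *\<^sub>R v)) \<le> m * norm (x + t *\<^sub>R v)"
        by (rule bound) (intro V_add V_scale xV v)
      then have "(norm (S (x + t *\<^sub>R v)))\<^sup>2 \<le> (m * norm (x + t *\<^sub>R v))\<^sup>2"
        by (intro power_mono) auto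
      moreover have "(norm (S (x + t *\<^sub>R v)))\<^sup>2 = m\<^sup>2 + 2 * t * (S x \<bullet> S v) + t\<^sup>2 * (S v \<bullet> S v)"
        unfolding m_def power2_norm_eq_inner
        by (simp add: linear_add[OF S] linear_cmul[OF S] inner_add_left inner_add_right
            inner_commute power2_eq_square algebra_simps)
      moreover have "(norm (x + t *\<^sub>R v))\<^sup>2 = 1 + 2 * t * (x \<bullet> v) + t\<^sup>2 * (v \<bullet> v)"
        unfolding power2_norm_eq_inner
        using nx by (simp add: norm_eq_1 inner_add_left inner_add_right
            inner_commute power2_eq_square algebra_simps)
      ultimately show "0 \<le> 2 * t * (m\<^sup>2 * (x \<bullet> v) - S x \<bullet> S v) + t\<^sup>2 * (m\<^sup>2 * (v \<bullet> v) - S v \<bullet> S v)"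
        by (simp add: power_mult_distrib algebra_simps)
    qed
    then show ?thesis by simp
  qed
  show thesis
  proof (cases "m = 0")
    case True
    \<comment> \<open>The map is zero on the whole subspace, so any unit vector orthogonal to
      \<open>x\<close> and \<open>F\<close> completes the pair; \<open>card F \<le> 6\<close> leaves
      room for it.\<close>
    then have zero: "S v = 0" if "v \<in> V" for v using bound[OF that] by simp
    have "finite (insert x F)" "card (insert x F) < 8"
      using F by (auto simp: card_insert_if)
    then obtain y where y: "norm y = 1" "\<And>f. f \<in> insert x F \<Longrightarrow> f \<bullet> y = 0"
      by (rule unit_vector_orthogonal) blast
    then have "y \<in> V" by (simp add: V_def)
    show thesis
      by (rule that[of 0 x y]) (use nx xV y zero \<open>y \<in> V\<close> in \<open>auto simp: V_def\<close>)
  next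
    case False
    then have m: "m > 0" using norm_ge_zero[of "S x"] unfolding m_def by linarith
    define z where "z = S (S x) + m\<^sup>2 *\<^sub>R x"
    have zV: "z \<in> V" unfolding z_def by (intro V_add V_scale SV xV)
    \<comment> \<open>The vector \<open>z\<close> lies in the subspace and is orthogonal to all of
      it, hence to itself.\<close>
    have "z \<bullet> v = 0" if "v \<in> V" for v
      using first_variation[OF that] skew[of "S x" v] by (simp add: z_def inner_add_left)
    from this[OF zV] have "z = 0" by simp
    then have SS: "S (S x) = - (m\<^sup>2 *\<^sub>R x)" by (simp add: z_def eq_neg_iff_add_eq_0)
    have "x \<bullet> S x = 0" using skew[of x x] inner_commute[of x "S x"] by linarith
    show thesis
    proof (rule that[of m x "S x /\<^sub>R m"])
      show "S (S x /\<^sub>R m) = - m *\<^sub>R x"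
        using m by (simp add: linear_cmul[OF S] SS power2_eq_square)
      show "norm (S x /\<^sub>R m) = 1" using m by (simp add: m_def)
    qed (use m nx xV SV[OF xV] \<open>x \<bullet> S x = 0\<close> in \<open>auto simp: V_def\<close>)
  qed
qed

text \<open>One rotation rate for each of three planes, and a kernel vector \<open>e 1\<close>
  because 7 is odd. The frame starts with \<open>basis8 0\<close> so that
  \<open>orthonormal_frame_map\<close> gives an element of O(7).\<close>

definition skew_normal_form :: "(real^8 \<Rightarrow> real^8) \<Rightarrow> (nat \<Rightarrow> real^8) \<Rightarrow> real \<Rightarrow> real \<Rightarrow> real \<Rightarrow> bool" where
  "skew_normal_form S e m1 m2 m3 \<longleftrightarrow>
     (\<forall>i<8. \<forall>j<8. e i \<bullet> e j = (if i = j then 1 else 0)) \<and> e 0 = basis8 0 \<and> S (e 1) = 0 \<and>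
     S (e 2) = m1 *\<^sub>R e 3 \<and> S (e 3) = - m1 *\<^sub>R e 2 \<and>
     S (e 4) = m2 *\<^sub>R e 5 \<and> S (e 5) = - m2 *\<^sub>R e 4 \<and>
     S (e 6) = m3 *\<^sub>R e 7 \<and> S (e 7) = - m3 *\<^sub>R e 6"

lemma all_less_8: "(\<forall>i<8. P i) \<longleftrightarrow> P 0 \<and> P 1 \<and> P 2 \<and> P 3 \<and> P 4 \<and> P 5 \<and> P 6 \<and> P (7::nat)"
proof -
  have "i < 8 \<longleftrightarrow> i = 0 \<or> i = 1 \<or> i = 2 \<or> i = 3 \<or> i = 4 \<or> i = 5 \<or> i = 6 \<or> i = 7" for i :: nat by arith
  then show ?thesis by (simp only:) blast
qed

lemma orthonormal_frame_map:
  assumes e: "\<forall>i<8. \<forall>j<8. e i \<bullet> e j = (if i = j then 1 else 0)" "e 0 = basis8 0"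
  obtains f where "fixing0 f" "\<And>i. i < 8 \<Longrightarrow> f (basis8 i) = e i"
proof -
  define f where "f x = (\<Sum>i<8. (basis8 i \<bullet> x) *\<^sub>R e i)" for x
  have lin: "linear f"
    by (auto simp: f_def linear_iff inner_add_right scaleR_add_left sum.distrib scaleR_sum_right)
  have f: "f (basis8 j) = e j" if "j < 8" for j
  proof -
    have "f (basis8 j) = (\<Sum>i<8. if i = j then e j else 0)"
      unfolding f_def by (rule sum.cong) (use that in \<open>auto simp: inner_basis8\<close>)
    then show ?thesis using that by simp
  qed
  have "f x \<bullet> f x = x \<bullet> x" for x
  proof -
    have "f x \<bullet> f x = (\<Sum>i<8. \<Sum>j<8. (basis8 i \<bullet> x) * (basis8 j \<bullet> x) * (e j \<bullet> e i))"
      unfolding f_def by (simp add: inner_sum_left inner_sum_right sum_distrib_left mult.assoc)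
    also have "\<dots> = (\<Sum>i<8. \<Sum>j<8. if j = i then (basis8 i \<bullet> x) * (basis8 i \<bullet> x) else 0)"
      by (rule sum.cong[OF refl], rule sum.cong[OF refl]) (use e(1) in auto)
    also have "\<dots> = (\<Sum>i<8. (basis8 i \<bullet> x) * (basis8 i \<bullet> x))"
      by (rule sum.cong[OF refl]) simp
    finally show ?thesis by (simp only: inner_eq_sum_basis8[of x x])
  qed
  then have "orthogonal_transformation f"
    using lin by (simp add: orthogonal_transformation norm_eq_sqrt_inner)
  then show thesis using that[of f] f e(2) by (simp add: fixing0_def)
qed

text \<open>Invariant planes are split off three times, each in the orthogonal complement of the
  vectors already found; skewness keeps that complement invariant.\<close>

lemma skew_normal_form_exists:
  assumes S: "ideal_map S" and skew: "\<And>x y. x \<bullet> S y = - (S x \<bullet> y)"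
  obtains e m1 m2 m3 where "0 \<le> m1" "0 \<le> m2" "0 \<le> m3" "skew_normal_form S e m1 m2 m3"
proof -
  have lin: "linear S" and S0: "S (basis8 0) = 0" "basis8 0 \<bullet> S x = 0" for x
    using S by (auto simp: ideal_map_def)
  have n0: "norm (basis8 0) = 1" by (simp add: basis8_def)
  note plane = skew_invariant_plane[OF lin skew]
  have inv1: "\<forall>f\<in>{basis8 0}. f \<bullet> S x = 0" if "\<forall>f\<in>{basis8 0}. f \<bullet> x = 0" for x
    using that S0 by simp
  obtain x1 y1 m1 where 1: "0 \<le> m1" "norm x1 = 1" "norm y1 = 1" "x1 \<bullet> y1 = 0"
    "\<forall>f\<in>{basis8 0}. f \<bullet> x1 = 0" "\<forall>f\<in>{basis8 0}. f \<bullet> y1 = 0"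
    "S x1 = m1 *\<^sub>R y1" "S y1 = - m1 *\<^sub>R x1"
    using card_length[of "[basis8 0]"] by (rule_tac plane[OF _ _ inv1]) auto
  have inv2: "\<forall>f\<in>{basis8 0, x1, y1}. f \<bullet> S x = 0" if "\<forall>f\<in>{basis8 0, x1, y1}. f \<bullet> x = 0" for x
    using that S0 1(7,8) skew[of x1] skew[of y1] by simp
  obtain x2 y2 m2 where 2: "0 \<le> m2" "norm x2 = 1" "norm y2 = 1" "x2 \<bullet> y2 = 0"
    "\<forall>f\<in>{basis8 0, x1, y1}. f \<bullet> x2 = 0" "\<forall>f\<in>{basis8 0, x1, y1}. f \<bullet> y2 = 0"
    "S x2 = m2 *\<^sub>R y2" "S y2 = - m2 *\<^sub>R x2"
    using card_length[of "[basis8 0, x1, y1]"] by (rule_tac plane[OF _ _ inv2]) auto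
  have inv3: "\<forall>f\<in>{basis8 0, x1, y1, x2, y2}. f \<bullet> S x = 0" if "\<forall>f\<in>{basis8 0, x1, y1, x2, y2}. f \<bullet> x = 0" for x
    using that S0 1(7,8) 2(7,8) skew[of x1] skew[of y1] skew[of x2] skew[of y2] by simp
  obtain x3 y3 m3 where 3: "0 \<le> m3" "norm x3 = 1" "norm y3 = 1" "x3 \<bullet> y3 = 0"
    "\<forall>f\<in>{basis8 0, x1, y1, x2, y2}. f \<bullet> x3 = 0" "\<forall>f\<in>{basis8 0, x1, y1, x2, y2}. f \<bullet> y3 = 0"
    "S x3 = m3 *\<^sub>R y3" "S y3 = - m3 *\<^sub>R x3"
    using card_length[of "[basis8 0, x1, y1, x2, y2]"] by (rule_tac plane[OF _ _ inv3]) auto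
  have "card {basis8 0, x1, y1, x2, y2, x3, y3} < 8"
    using card_length[of "[basis8 0, x1, y1, x2, y2, x3, y3]"] by simp
  then obtain z where z: "norm z = 1" "\<forall>f\<in>{basis8 0, x1, y1, x2, y2, x3, y3}. f \<bullet> z = 0"
    using unit_vector_orthogonal[of "{basis8 0, x1, y1, x2, y2, x3, y3}"] by (metis finite.emptyI finite_insert)
  define e where "e i = [basis8 0, z, x1, y1, x2, y2, x3, y3] ! i" for i
  have e: "e 0 = basis8 0" "e 1 = z" "e 2 = x1" "e 3 = y1" "e 4 = x2" "e 5 = y2" "e 6 = x3" "e 7 = y3"
    by (simp_all add: e_def)
  have sq: "basis8 0 \<bullet> basis8 0 = 1" "z \<bullet> z = 1" "x1 \<bullet> x1 = 1" "y1 \<bullet> y1 = 1" "x2 \<bullet> x2 = 1" "y2 \<bullet> y2 = 1"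
      "x3 \<bullet> x3 = 1" "y3 \<bullet> y3 = 1"
    using n0 z(1) 1(2,3) 2(2,3) 3(2,3) by (simp_all add: norm_eq_1)
  have orth: "basis8 0 \<bullet> z = 0" "x1 \<bullet> z = 0" "y1 \<bullet> z = 0" "x2 \<bullet> z = 0" "y2 \<bullet> z = 0" "x3 \<bullet> z = 0" "y3 \<bullet> z = 0"
      "basis8 0 \<bullet> x1 = 0" "basis8 0 \<bullet> y1 = 0" "basis8 0 \<bullet> x2 = 0" "basis8 0 \<bullet> y2 = 0"
      "basis8 0 \<bullet> x3 = 0" "basis8 0 \<bullet> y3 = 0" "x1 \<bullet> y1 = 0" "x2 \<bullet> y2 = 0" "x3 \<bullet> y3 = 0"
      "x1 \<bullet> x2 = 0" "y1 \<bullet> x2 = 0" "x1 \<bullet> y2 = 0" "y1 \<bullet> y2 = 0" "x1 \<bullet> x3 = 0" "y1 \<bullet> x3 = 0"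
      "x1 \<bullet> y3 = 0" "y1 \<bullet> y3 = 0" "x2 \<bullet> x3 = 0" "y2 \<bullet> x3 = 0" "x2 \<bullet> y3 = 0" "y2 \<bullet> y3 = 0"
    using z(2) 1(4,5,6) 2(4,5,6) 3(4,5,6) by simp_all
  have orthonormal: "\<forall>i<8. \<forall>j<8. e i \<bullet> e j = (if i = j then 1 else 0)"
    unfolding all_less_8 e by (simp add: sq orth orth[THEN trans[OF inner_commute]])
  obtain f where f: "fixing0 f" "\<And>i. i < 8 \<Longrightarrow> f (basis8 i) = e i"
    using orthonormal_frame_map[OF orthonormal e(1)] by blast
  have zz: "z \<bullet> S z = 0" using skew[of z z] inner_commute[of z "S z"] by linarith
  \<comment> \<open>Orthogonality to the entire frame forces \<open>S z = 0\<close>.\<close>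
  have "\<forall>i<8. e i \<bullet> S z = 0"
    unfolding all_less_8 e
    by (simp add: S0 zz skew[of x1] skew[of y1] skew[of x2] skew[of y2] skew[of x3] skew[of y3]
        1(7,8) 2(7,8) 3(7,8) orth)
  then have "basis8 i \<bullet> inv_into UNIV f (S z) = 0" if "i < 8" for i
    using fixing0_inner[OF f(1), of "basis8 i" "inv_into UNIV f (S z)"] that
    by (simp add: fixing0_f_inv[OF f(1)] f(2))
  then have "inv_into UNIV f (S z) = 0" by (intro basis8_eqI) simp
  then have "S z = 0"
    using fixing0_f_inv[OF f(1), of "S z"] linear_0[OF fixing0_linear[OF f(1)]] by simp
  then have "skew_normal_form S e m1 m2 m3"
    using orthonormal 1(7,8) 2(7,8) 3(7,8) by (simp only: skew_normal_form_def e)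
  then show thesis using that 1(1) 2(1) 3(1) by blast
qed

text \<open>Reordering the planes lets the rate that is the sum of the other two come first.\<close>

lemma skew_normal_form_swap:
  assumes "skew_normal_form S e m1 m2 m3"
  shows "skew_normal_form S (\<lambda>i. e ([0, 1, 4, 5, 2, 3, 6, 7] ! i)) m2 m1 m3"
    "skew_normal_form S (\<lambda>i. e ([0, 1, 6, 7, 4, 5, 2, 3] ! i)) m3 m2 m1"
proof -
  have e: "i < 8 \<Longrightarrow> j < 8 \<Longrightarrow> e i \<bullet> e j = (if i = j then 1 else 0)" for i j
    using assms unfolding skew_normal_form_def by blast
  have orth: "\<forall>i<8. \<forall>j<8. e (p ! i) \<bullet> e (p ! j) = (if i = j then 1 else 0)"
    if p: "\<forall>i<8. p ! i < 8 \<and> (\<forall>j<8. p ! i = p ! j \<longleftrightarrow> i = j)" for p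
  proof (intro allI impI)
    fix i j :: nat assume "i < 8" "j < 8"
    then have "p ! i < 8" "p ! j < 8" "p ! i = p ! j \<longleftrightarrow> i = j" using p by blast+
    then show "e (p ! i) \<bullet> e (p ! j) = (if i = j then 1 else 0)" by (simp only: e)
  qed
  note nf = assms[unfolded skew_normal_form_def, THEN conjunct2]
  have p: "\<forall>i<8. [0, 1, 4, 5, 2, 3, 6, 7] ! i < (8::nat) \<and>
      (\<forall>j<8. [0, 1, 4, 5, 2, 3, 6, 7] ! i = [0, 1, 4, 5, 2, 3, 6, 7 :: nat] ! j \<longleftrightarrow> i = j)"
    "\<forall>i<8. [0, 1, 6, 7, 4, 5, 2, 3] ! i < (8::nat) \<and>
      (\<forall>j<8. [0, 1, 6, 7, 4, 5, 2, 3] ! i = [0, 1, 6, 7, 4, 5, 2, 3 :: nat] ! j \<longleftrightarrow> i = j)"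
    unfolding all_less_8 by simp_all
  show "skew_normal_form S (\<lambda>i. e ([0, 1, 4, 5, 2, 3, 6, 7] ! i)) m2 m1 m3"
    unfolding skew_normal_form_def using orth[OF p(1)] nf by (intro conjI) simp_all
  show "skew_normal_form S (\<lambda>i. e ([0, 1, 6, 7, 4, 5, 2, 3] ! i)) m3 m2 m1"
    unfolding skew_normal_form_def using orth[OF p(2)] nf by (intro conjI) simp_all
qed


subsection \<open>Eigenvalues of elements of the stabiliser algebra\<close>

lemma coeff8_conj_map:
  assumes h: "fixing0 h"
  shows "coeff8 (conj_map h T) i j = inv_into UNIV h (basis8 i) \<bullet> T (inv_into UNIV h (basis8 j))"
  using fixing0_inner[OF h, of "inv_into UNIV h (basis8 i)"] by (simp add: coeff8_def conj_map_def fixing0_f_inv[OF h])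

lemma sum_inner_fixing0:
  assumes f: "fixing0 f" and M: "linear M"
  shows "(\<Sum>i<8. M (f (basis8 i)) \<bullet> M (f (basis8 i))) = (\<Sum>i<8. M (basis8 i) \<bullet> (M (basis8 i) :: real^8))"
  by (rule orthonormal_trace)
    (use M f in \<open>auto simp: fixing0_def linear_iff inner_add_left inner_add_right\<close>)

text \<open>This is \<open>4 tr C\<^sup>4 = (tr C\<^sup>2)\<^sup>2\<close>, as \<open>C\<close> and \<open>C\<^sup>2\<close> are skew-symmetric and symmetric respectively.\<close>

lemma g2_relations_quartic:
  assumes C0: "\<And>i. C 0 i = 0" and skew: "\<And>i j. C i j = - C j i" and g2: "g2_relations C"
  shows "4 * (\<Sum>i<8. \<Sum>k<8. (\<Sum>l<8. C k l * C l i)\<^sup>2) = (\<Sum>i<8. \<Sum>k<8. (C k i)\<^sup>2)\<^sup>2"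
proof -
  \<comment> \<open>Fourteen free entries, the dimension of g2; the relations express the other
    seven upper entries through them, and the claim becomes a polynomial identity.\<close>
  define a14 a15 a16 a17 a24 a25 a26 a27 a45 a46 a47 a56 a57 a67
    where "a14 = C 1 4" and "a15 = C 1 5" and "a16 = C 1 6" and "a17 = C 1 7"
      and "a24 = C 2 4" and "a25 = C 2 5" and "a26 = C 2 6" and "a27 = C 2 7"
      and "a45 = C 4 5" and "a46 = C 4 6" and "a47 = C 4 7" and "a56 = C 5 6" and "a57 = C 5 7" and "a67 = C 6 7"
  note defs = a14_def a15_def a16_def a17_def a24_def a25_def a26_def a27_def a45_def a46_def a47_def a56_def a57_def a67_def
  have upper: "C 2 3 = a45 + a67" "C 1 3 = a57 - a46" "C 1 2 = a47 + a56" "C 3 7 = - a15 - a26"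
    "C 3 6 = a14 + a27" "C 3 5 = a17 - a24" "C 3 4 = a25 - a16"
    using g2 unfolding g2_relations_def defs by linarith+
  note upper = upper defs[symmetric]
  have lower: "C i 0 = 0" "C i i = 0" for i
    using C0[of i] skew[of i 0] skew[of i i] by simp_all
  note lower = lower skew[of 2 1] skew[of 3 1] skew[of 4 1] skew[of 5 1] skew[of 6 1] skew[of 7 1]
    skew[of 3 2] skew[of 4 2] skew[of 5 2] skew[of 6 2] skew[of 7 2]
    skew[of 4 3] skew[of 5 3] skew[of 6 3] skew[of 7 3] skew[of 5 4] skew[of 6 4] skew[of 7 4]
    skew[of 6 5] skew[of 7 5] skew[of 7 6]
  show ?thesis
    unfolding sum_lessThan_8 C0 lower upper
    by (simp only: mult_zero_left mult_zero_right add_0 add_0_right minus_zero power_zero_numeral; Groebner_Basis.algebra)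
qed

lemma skew_normal_form_frame:
  assumes "skew_normal_form S e m1 m2 m3"
  obtains f where "fixing0 f" "\<And>i. i < 8 \<Longrightarrow> f (basis8 i) = e i"
  using orthonormal_frame_map[of e] assms unfolding skew_normal_form_def by blast

text \<open>Sums of squared entries of \<open>C\<close> and of its square do not depend on the
  orthonormal frame, so they are evaluated in the normal form, as twice the sum of the squares and
  of the fourth powers of the rates.\<close>

lemma g2_relations_eigenvalue_relation:
  assumes S: "ideal_map S" and skew: "\<And>x y. x \<bullet> S y = - (S x \<bullet> y)"
    and nf: "skew_normal_form S e m1 m2 m3" and h: "fixing0 h"
    and g2: "g2_relations (coeff8 (conj_map h S))"
  shows "2 * (m1 ^ 4 + m2 ^ 4 + m3 ^ 4) = (m1\<^sup>2 + m2\<^sup>2 + m3\<^sup>2)\<^sup>2"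
proof -
  define R where "R = conj_map h S"
  define C where "C = coeff8 R"
  obtain f where f: "fixing0 f" "\<And>i. i < 8 \<Longrightarrow> f (basis8 i) = e i"
    using skew_normal_form_frame[OF nf] by blast
  have lin: "linear S" using S by (simp add: ideal_map_def)
  have R: "ideal_map R" unfolding R_def by (rule conj_map_ideal_map[OF h S])
  have linR: "linear R" using R by (simp add: ideal_map_def)
  have orth: "e i \<bullet> e j = (if i = j then 1 else 0)" if "i < 8" "j < 8" for i j
    using nf that unfolding skew_normal_form_def by blast
  have Se: "S (e 0) = 0" "S (e 1) = 0" "S (e 2) = m1 *\<^sub>R e 3" "S (e 3) = - m1 *\<^sub>R e 2"
    "S (e 4) = m2 *\<^sub>R e 5" "S (e 5) = - m2 *\<^sub>R e 4" "S (e 6) = m3 *\<^sub>R e 7" "S (e 7) = - m3 *\<^sub>R e 6"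
    using nf S unfolding skew_normal_form_def ideal_map_def by simp_all
  have frame: "(\<Sum>i<8. M (basis8 i) \<bullet> M (basis8 i)) = (\<Sum>i<8. M (e i) \<bullet> M (e i))"
    if "linear M" for M :: "real^8 \<Rightarrow> real^8"
    unfolding sum_inner_fixing0[OF f(1) that, symmetric] by (rule sum.cong) (simp_all add: f(2))
  have conj: "(\<Sum>i<8. h (M (inv_into UNIV h (basis8 i))) \<bullet> h (M (inv_into UNIV h (basis8 i)))) = (\<Sum>i<8. M (e i) \<bullet> M (e i))"
    if "linear M" for M :: "real^8 \<Rightarrow> real^8"
    unfolding fixing0_inner[OF h] sum_inner_fixing0[OF fixing0_inv[OF h] that] by (rule frame[OF that])
  have "(\<Sum>i<8. \<Sum>k<8. (C k i)\<^sup>2) = (\<Sum>i<8. R (basis8 i) \<bullet> R (basis8 i))"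
    by (rule sum.cong[OF refl]) (subst inner_eq_sum_basis8, simp only: C_def coeff8_def power2_eq_square)
  also have "\<dots> = (\<Sum>i<8. S (e i) \<bullet> S (e i))"
    unfolding R_def conj_map_def by (rule conj[OF lin])
  also have "\<dots> = 2 * (m1\<^sup>2 + m2\<^sup>2 + m3\<^sup>2)"
    unfolding sum_lessThan_8 Se by (simp add: orth power2_eq_square)
  finally have sq: "(\<Sum>i<8. \<Sum>k<8. (C k i)\<^sup>2) = 2 * (m1\<^sup>2 + m2\<^sup>2 + m3\<^sup>2)" .
  have RR: "basis8 k \<bullet> R (R (basis8 i)) = (\<Sum>l<8. C k l * C l i)" for i k
    by (subst linear_basis8[OF linR, of "R (basis8 i)"])
      (simp add: inner_sum_right C_def coeff8_def mult.commute)
  have "(\<Sum>i<8. \<Sum>k<8. (\<Sum>l<8. C k l * C l i)\<^sup>2) = (\<Sum>i<8. R (R (basis8 i)) \<bullet> R (R (basis8 i)))"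
    by (rule sum.cong[OF refl]) (subst inner_eq_sum_basis8, simp only: RR power2_eq_square)
  also have "\<dots> = (\<Sum>i<8. S (S (e i)) \<bullet> S (S (e i)))"
    using conj[OF linear_compose[OF lin lin]] unfolding R_def conj_map_def fixing0_inv_f[OF h] by (simp add: o_def)
  also have "\<dots> = 2 * (m1 ^ 4 + m2 ^ 4 + m3 ^ 4)"
    unfolding sum_lessThan_8 Se
    by (simp add: linear_cmul[OF lin] linear_neg[OF lin] linear_0[OF lin] Se orth power4_eq_xxxx del: One_nat_def)
  finally have quad: "(\<Sum>i<8. \<Sum>k<8. (\<Sum>l<8. C k l * C l i)\<^sup>2) = 2 * (m1 ^ 4 + m2 ^ 4 + m3 ^ 4)" .
  have "4 * (2 * (m1 ^ 4 + m2 ^ 4 + m3 ^ 4)) = (2 * (m1\<^sup>2 + m2\<^sup>2 + m3\<^sup>2))\<^sup>2"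
    unfolding sq[symmetric] quad[symmetric]
  proof (rule g2_relations_quartic)
    show "C 0 i = 0" for i using R by (simp add: C_def coeff8_def ideal_map_def)
    show "C i j = - C j i" for i j
      unfolding C_def R_def coeff8_conj_map[OF h] by (subst skew) (simp only: inner_commute)
    show "g2_relations C" using g2 by (simp add: C_def R_def)
  qed
  then show ?thesis by Groebner_Basis.algebra
qed

lemma quartic_relation_cases:
  fixes a b c :: real
  assumes "2 * (a ^ 4 + b ^ 4 + c ^ 4) = (a\<^sup>2 + b\<^sup>2 + c\<^sup>2)\<^sup>2" "0 \<le> a" "0 \<le> b" "0 \<le> c"
  shows "a = b + c \<or> b = a + c \<or> c = b + a"
proof -
  \<comment> \<open>If the factor \<open>a + b + c\<close> is the one that vanishes, nonnegativity
    makes all three zero and the conclusion is immediate.\<close>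
  have "(a + b + c) * (b + c - a) * (a + c - b) * (b + a - c) = 0"
    using assms(1) by Groebner_Basis.algebra
  then show ?thesis using assms(2-4) by auto
qed

lemma skew_normal_form_sum:
  assumes nf: "skew_normal_form S e m1 m2 m3" and m: "0 \<le> m1" "0 \<le> m2" "0 \<le> m3"
    and rel: "2 * (m1 ^ 4 + m2 ^ 4 + m3 ^ 4) = (m1\<^sup>2 + m2\<^sup>2 + m3\<^sup>2)\<^sup>2"
  obtains e' a b where "0 \<le> a" "a \<le> b" "skew_normal_form S e' (a + b) a b"
proof -
  have "\<exists>e' a b. 0 \<le> a \<and> 0 \<le> b \<and> skew_normal_form S e' (a + b) a b"
    using quartic_relation_cases[OF rel m] skew_normal_form_swap[OF nf] nf m by metis
  then obtain e' a b where e': "0 \<le> a" "0 \<le> b" "skew_normal_form S e' (a + b) a b" by blast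
  show thesis
  proof (cases "a \<le> b")
    case False
    obtain e'' where "skew_normal_form S e'' (a + b) b a"
      using e'(3) skew_normal_form_swap by blast
    then show thesis using that[of b a e''] e' False by (simp add: add.commute)
  qed (use that e' in blast)
qed

text \<open>In the frame \<open>e\<close> only the (2,3), (4,5) and (6,7) blocks can be nonzero, so
  the one nontrivial relation is W 2 3 = W 4 5 + W 6 7; this is why the sum sits on the first plane.
  Conjugating by the inverse of the frame map gives the entries in that frame.\<close>

lemma g2_relations_normal_form:
  assumes nf: "skew_normal_form S e (a + b) a b"
  obtains h where "fixing0 h" "g2_relations (coeff8 (conj_map h S))"
proof -
  obtain f where f: "fixing0 f" "\<And>i. i < 8 \<Longrightarrow> f (basis8 i) = e i"
    using skew_normal_form_frame[OF nf] by blast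
  have "bij f" using f(1) by (auto simp: fixing0_def orthogonal_transformation_bij)
  then have inv: "inv_into UNIV (inv_into UNIV f) = f" by (rule inv_inv_eq)
  have orth: "e i \<bullet> e j = (if i = j then 1 else 0)" if "i < 8" "j < 8" for i j
    using nf that unfolding skew_normal_form_def by blast
  have Se: "S (e 1) = 0" "S (e 2) = (a + b) *\<^sub>R e 3" "S (e 3) = - (a + b) *\<^sub>R e 2"
    "S (e 4) = a *\<^sub>R e 5" "S (e 5) = - a *\<^sub>R e 4" "S (e 6) = b *\<^sub>R e 7" "S (e 7) = - b *\<^sub>R e 6"
    using nf unfolding skew_normal_form_def by simp_all
  show thesis
  proof (rule that[of "inv_into UNIV f"])
    show "fixing0 (inv_into UNIV f)" by (rule fixing0_inv[OF f(1)])
    show "g2_relations (coeff8 (conj_map (inv_into UNIV f) S))"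
      unfolding g2_relations_def coeff8_conj_map[OF fixing0_inv[OF f(1)]] inv
      by (simp add: f(2) Se orth del: One_nat_def)
  qed
qed

section \<open>Complex diagonalisation and eigenvalue multisets\<close>

definition coeff_mat :: "(real^8 \<Rightarrow> real^8) \<Rightarrow> real mat" where
  "coeff_mat S = Matrix.mat 7 7 (\<lambda>(i, j). coeff8 S (i + 1) (j + 1))"

lemma sum_ideal_components:
  assumes "basis8 0 \<bullet> x = 0"
  shows "(\<Sum>k<7. (basis8 (Suc k) \<bullet> x) * (basis8 (Suc k) \<bullet> y)) = x \<bullet> y"
  unfolding inner_eq_sum_basis8[of x y] using assms
  by (simp add: sum.lessThan_Suc_shift[of _ 7, simplified])

lemma complex_eigenvalues_normal_form:
  assumes S: "ideal_map S" and nf: "skew_normal_form S e m1 m2 m3"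
  shows "complex_eigenvalues (coeff_mat S) =
    {#0, m1 * \<i>, - (m1 * \<i>), m2 * \<i>, - (m2 * \<i>), m3 * \<i>, - (m3 * \<i>)#}"
proof -
  have orth: "e i \<bullet> e j = (if i = j then 1 else 0)" if "i < 8" "j < 8" for i j
    using nf that unfolding skew_normal_form_def by blast
  have e0: "e 0 = basis8 0" using nf unfolding skew_normal_form_def by blast
  have lin: "linear S" using S by (simp add: ideal_map_def)
  have Se: "S (e 1) = 0" "S (e 2) = m1 *\<^sub>R e 3" "S (e 3) = - m1 *\<^sub>R e 2"
    "S (e 4) = m2 *\<^sub>R e 5" "S (e 5) = - m2 *\<^sub>R e 4" "S (e 6) = m3 *\<^sub>R e 7" "S (e 7) = - m3 *\<^sub>R e 6"
    using nf unfolding skew_normal_form_def by simp_all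
  \<comment> \<open>\<open>u l + i v l\<close> is an eigenvector of \<open>S\<close> for the eigenvalue \<open>i \<sigma> l\<close>.\<close>
  define u where "u l = [e 1, e 2, e 2, e 4, e 4, e 6, e 6] ! l" for l
  define v where "v l = [0, - e 3, e 3, - e 5, e 5, - e 7, e 7] ! l" for l
  define \<sigma> where "\<sigma> l = [0, m1, - m1, m2, - m2, m3, - m3] ! l" for l
  define A where "A = map_mat complex_of_real (coeff_mat S)"
  define Q where "Q = Matrix.mat 7 7 (\<lambda>(k, l). Complex (basis8 (Suc k) \<bullet> u l) (basis8 (Suc k) \<bullet> v l))"
  \<comment> \<open>The columns of \<open>Q\<close> are orthogonal for the Hermitian product, of
    squared length 1 for the kernel vector and 2 for the others; so the inverse is the conjugate
    transpose with all rows but the first halved.\<close>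
  define P where "P = Matrix.mat 7 7 (\<lambda>(l, k). (if l = 0 then 1 else 1 / 2) *
    Complex (basis8 (Suc k) \<bullet> u l) (- (basis8 (Suc k) \<bullet> v l)))"
  define D where "D = Matrix.mat 7 7 (\<lambda>(k, l). if k = l then Complex 0 (\<sigma> l) else 0)"
  have carrier: "A \<in> carrier_mat 7 7" "Q \<in> carrier_mat 7 7" "P \<in> carrier_mat 7 7" "D \<in> carrier_mat 7 7"
    by (simp_all add: A_def coeff_mat_def Q_def P_def D_def)
  have less_7: "l < 7 \<Longrightarrow> l = 0 \<or> l = 1 \<or> l = 2 \<or> l = 3 \<or> l = 4 \<or> l = 5 \<or> l = 6" for l :: nat
    by arith
  have ideal: "basis8 0 \<bullet> u l = 0" "basis8 0 \<bullet> v l = 0" if "l < 7" for l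
    using less_7[OF that] unfolding e0[symmetric] by (auto simp: u_def v_def orth)
  have PQ: "P * Q = 1\<^sub>m 7"
  proof (rule eq_matI)
    fix j l assume "j < dim_row (1\<^sub>m 7 :: complex mat)" "l < dim_col (1\<^sub>m 7 :: complex mat)"
    then have jl: "j < 7" "l < 7" by simp_all
    have "(P * Q) $$ (j, l) = (\<Sum>k<7. (if j = 0 then 1 else 1 / 2) *
        Complex (basis8 (Suc k) \<bullet> u j) (- (basis8 (Suc k) \<bullet> v j)) * Complex (basis8 (Suc k) \<bullet> u l) (basis8 (Suc k) \<bullet> v l))"
      using jl by (simp add: P_def Q_def scalar_prod_def lessThan_atLeast0)
    also have "\<dots> = (if j = 0 then 1 else 1 / 2) * Complex
        ((\<Sum>k<7. (basis8 (Suc k) \<bullet> u j) * (basis8 (Suc k) \<bullet> u l)) + (\<Sum>k<7. (basis8 (Suc k) \<bullet> v j) * (basis8 (Suc k) \<bullet> v l)))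
        ((\<Sum>k<7. (basis8 (Suc k) \<bullet> u j) * (basis8 (Suc k) \<bullet> v l)) - (\<Sum>k<7. (basis8 (Suc k) \<bullet> v j) * (basis8 (Suc k) \<bullet> u l)))"
      by (simp add: complex_eq_iff sum_distrib_left sum.distrib sum_subtractf algebra_simps)
    also have "\<dots> = (if j = 0 then 1 else 1 / 2) * Complex (u j \<bullet> u l + v j \<bullet> v l) (u j \<bullet> v l - v j \<bullet> u l)"
      unfolding sum_ideal_components[OF ideal(1)[OF jl(1)]] sum_ideal_components[OF ideal(2)[OF jl(1)]] ..
    also have "\<dots> = (if j = l then 1 else 0)"
      using less_7[OF jl(1)] less_7[OF jl(2)] by (auto simp: u_def v_def orth complex_eq_iff)
    finally show "(P * Q) $$ (j, l) = 1\<^sub>m 7 $$ (j, l)" using jl by simp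
  qed (simp_all add: P_def Q_def)
  have QP: "Q * P = 1\<^sub>m 7"
    by (rule mat_mult_left_right_inverse[OF carrier(3,2) PQ])
  have AQ: "A * Q = Q * D"
  proof (rule eq_matI)
    fix k l assume "k < dim_row (Q * D)" "l < dim_col (Q * D)"
    then have kl: "k < 7" "l < 7" by (simp_all add: Q_def D_def)
    have comp: "(\<Sum>j<7. coeff8 S (Suc k) (Suc j) * (basis8 (Suc j) \<bullet> x)) = basis8 (Suc k) \<bullet> S x"
      if "basis8 0 \<bullet> x = 0" for x
    proof -
      have "basis8 (Suc k) \<bullet> S x = (\<Sum>j<8. (basis8 j \<bullet> x) * coeff8 S (Suc k) j)"
        by (subst linear_basis8[OF lin]) (simp add: inner_sum_right coeff8_def)
      also have "\<dots> = (\<Sum>j<7. coeff8 S (Suc k) (Suc j) * (basis8 (Suc j) \<bullet> x))"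
        using that by (simp add: sum.lessThan_Suc_shift[of _ 7, simplified] mult.commute)
      finally show ?thesis by simp
    qed
    have Suv: "S (u l) = - \<sigma> l *\<^sub>R v l" "S (v l) = \<sigma> l *\<^sub>R u l"
      using less_7[OF kl(2)] by (auto simp: u_def v_def \<sigma>_def Se linear_neg[OF lin] linear_0[OF lin] simp del: One_nat_def)
    have "(A * Q) $$ (k, l) = (\<Sum>j<7. complex_of_real (coeff8 S (Suc k) (Suc j)) *
        Complex (basis8 (Suc j) \<bullet> u l) (basis8 (Suc j) \<bullet> v l))"
      using kl by (simp add: A_def coeff_mat_def Q_def scalar_prod_def lessThan_atLeast0)
    also have "\<dots> = Complex (\<Sum>j<7. coeff8 S (Suc k) (Suc j) * (basis8 (Suc j) \<bullet> u l))
        (\<Sum>j<7. coeff8 S (Suc k) (Suc j) * (basis8 (Suc j) \<bullet> v l))"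
      by (simp add: complex_eq_iff)
    also have "\<dots> = Complex (basis8 (Suc k) \<bullet> S (u l)) (basis8 (Suc k) \<bullet> S (v l))"
      unfolding comp[OF ideal(1)[OF kl(2)]] comp[OF ideal(2)[OF kl(2)]] ..
    also have "\<dots> = Complex (basis8 (Suc k) \<bullet> u l) (basis8 (Suc k) \<bullet> v l) * Complex 0 (\<sigma> l)"
      by (simp add: Suv complex_eq_iff mult.commute)
    also have "\<dots> = (\<Sum>j<7. if j = l then Complex (basis8 (Suc k) \<bullet> u l) (basis8 (Suc k) \<bullet> v l) * Complex 0 (\<sigma> l) else 0)"
      using kl by simp
    also have "\<dots> = (\<Sum>j<7. Complex (basis8 (Suc k) \<bullet> u j) (basis8 (Suc k) \<bullet> v j) * (if j = l then Complex 0 (\<sigma> l) else 0))"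
      by (rule sum.cong) auto
    also have "\<dots> = (Q * D) $$ (k, l)"
      using kl by (simp add: Q_def D_def scalar_prod_def lessThan_atLeast0)
    finally show "(A * Q) $$ (k, l) = (Q * D) $$ (k, l)" .
  qed (simp_all add: A_def coeff_mat_def Q_def D_def)
  have "A = A * (Q * P)" using carrier by (simp add: QP)
  also have "\<dots> = (A * Q) * P" using carrier by (simp add: assoc_mult_mat[of _ 7 7 _ 7 _ 7])
  finally have "similar_mat A D"
    using carrier PQ QP by (intro similar_matI[of A D Q P 7]) (simp_all add: AQ)
  then have "char_poly A = char_poly D" by (rule char_poly_similar)
  also have "\<dots> = (\<Prod>a\<leftarrow>diag_mat D. [:- a, 1:])"
    by (rule char_poly_upper_triangular[OF carrier(4)]) (auto simp: D_def)
  also have "diag_mat D = map (\<lambda>l. Complex 0 (\<sigma> l)) [0, 1, 2, 3, 4, 5, 6]"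
  proof -
    have "[0..<7] = [0, 1, 2, 3, 4, 5, 6 :: nat]" by code_simp
    then show ?thesis by (simp add: diag_mat_def D_def)
  qed
  finally have "char_poly A = (\<Prod>a\<leftarrow>[0, m1 * \<i>, - (m1 * \<i>), m2 * \<i>, - (m2 * \<i>), m3 * \<i>, - (m3 * \<i>)]. [:- a, 1:])"
    by (simp add: \<sigma>_def Complex_eq mult.commute)
  moreover have "proots (\<Prod>a\<leftarrow>as. [:- a, 1:]) = mset as" for as :: "complex list"
  proof (induction as)
    case (Cons a as)
    have "(\<Prod>a\<leftarrow>as. [:- a, 1:]) \<noteq> 0" by (auto simp: prod_list_zero_iff)
    then have "proots ([:- a, 1:] * (\<Prod>a\<leftarrow>as. [:- a, 1:])) = proots [:- a, 1:] + proots (\<Prod>a\<leftarrow>as. [:- a, 1:])"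
      by (intro proots_mult) auto
    then show ?case using Cons by (simp only: list.map prod_list.Cons proots_linear_factor) simp
  qed simp
  ultimately show ?thesis unfolding complex_eigenvalues_def A_def by (simp only: mset.simps)
qed

text \<open>Power sums of the multisets replace a case analysis matching the eigenvalues, and these
  two are the quantities in the quartic relation.\<close>

lemma power_sums_eigenvalues:
  fixes a b c x y z :: complex
  assumes eq: "{#0, a * \<i>, - (a * \<i>), b * \<i>, - (b * \<i>), c * \<i>, - (c * \<i>)#} =
    {#0, x * \<i>, - (x * \<i>), y * \<i>, - (y * \<i>), z * \<i>, - (z * \<i>)#}"
  shows "a\<^sup>2 + b\<^sup>2 + c\<^sup>2 = x\<^sup>2 + y\<^sup>2 + z\<^sup>2" "a ^ 4 + b ^ 4 + c ^ 4 = x ^ 4 + y ^ 4 + z ^ 4"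
proof -
  have "2 * (- (a\<^sup>2) - b\<^sup>2 - c\<^sup>2) = 2 * (- (x\<^sup>2) - y\<^sup>2 - z\<^sup>2)"
    using arg_cong[OF eq, of "\<lambda>M. \<Sum>z\<in>#M. z\<^sup>2"] by (simp add: power_mult_distrib algebra_simps)
  then have "2 * (a\<^sup>2 + b\<^sup>2 + c\<^sup>2) = 2 * (x\<^sup>2 + y\<^sup>2 + z\<^sup>2)" by Groebner_Basis.algebra
  then show "a\<^sup>2 + b\<^sup>2 + c\<^sup>2 = x\<^sup>2 + y\<^sup>2 + z\<^sup>2" by (metis mult_cancel_left zero_neq_numeral)
  have "2 * (a ^ 4 + b ^ 4 + c ^ 4) = 2 * (x ^ 4 + y ^ 4 + z ^ 4)"
    using arg_cong[OF eq, of "\<lambda>M. \<Sum>z\<in>#M. z ^ 4"] by (simp add: power_mult_distrib algebra_simps)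
  then show "a ^ 4 + b ^ 4 + c ^ 4 = x ^ 4 + y ^ 4 + z ^ 4" by (metis mult_cancel_left zero_neq_numeral)
qed

text \<open>Both directions pass through the quartic relation among the rates of a fixed normal
  form: it follows from g2 by invariance and from the eigenvalues by power sums, and
  \<open>skew_normal_form_sum\<close> then produces rates a + b, a, b.\<close>

lemma g2_conjugate_iff_eigenvalues:
  assumes S: "ideal_map S" and skew: "\<And>x y. x \<bullet> S y = - (S x \<bullet> y)"
  shows "(\<exists>h. fixing0 h \<and> g2_relations (coeff8 (conj_map h S))) \<longleftrightarrow>
    (\<exists>l1 l2. 0 \<le> l1 \<and> l1 \<le> l2 \<and> complex_eigenvalues (coeff_mat S) = spin7_eigenvalues l1 l2)"
proof -
  obtain e m1 m2 m3 where m: "0 \<le> m1" "0 \<le> m2" "0 \<le> m3" and nf: "skew_normal_form S e m1 m2 m3"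
    by (rule skew_normal_form_exists[OF S skew])
  show ?thesis
  proof
    assume "\<exists>h. fixing0 h \<and> g2_relations (coeff8 (conj_map h S))"
    then have "2 * (m1 ^ 4 + m2 ^ 4 + m3 ^ 4) = (m1\<^sup>2 + m2\<^sup>2 + m3\<^sup>2)\<^sup>2"
      using g2_relations_eigenvalue_relation[OF S skew nf] by blast
    then obtain e' a b where "0 \<le> a" "a \<le> b" "skew_normal_form S e' (a + b) a b"
      by (rule skew_normal_form_sum[OF nf m])
    moreover from this(3) have "complex_eigenvalues (coeff_mat S) = spin7_eigenvalues a b"
      by (simp add: complex_eigenvalues_normal_form[OF S] spin7_eigenvalues_def add_mset_commute)
    ultimately show "\<exists>l1 l2. 0 \<le> l1 \<and> l1 \<le> l2 \<and> complex_eigenvalues (coeff_mat S) = spin7_eigenvalues l1 l2"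
      by blast
  next
    assume "\<exists>l1 l2. 0 \<le> l1 \<and> l1 \<le> l2 \<and> complex_eigenvalues (coeff_mat S) = spin7_eigenvalues l1 l2"
    then obtain l1 l2 where l: "{#0, m1 * \<i>, - (m1 * \<i>), m2 * \<i>, - (m2 * \<i>), m3 * \<i>, - (m3 * \<i>)#} = spin7_eigenvalues l1 l2"
      unfolding complex_eigenvalues_normal_form[OF S nf] by blast
    note power_sums = power_sums_eigenvalues[OF l[unfolded spin7_eigenvalues_def of_real_add]]
    have "complex_of_real (m1\<^sup>2 + m2\<^sup>2 + m3\<^sup>2) = complex_of_real (l1\<^sup>2 + l2\<^sup>2 + (l1 + l2)\<^sup>2)"
      using power_sums(1) by simp
    then have sq: "m1\<^sup>2 + m2\<^sup>2 + m3\<^sup>2 = l1\<^sup>2 + l2\<^sup>2 + (l1 + l2)\<^sup>2" by (simp only: of_real_eq_iff)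
    have "complex_of_real (m1 ^ 4 + m2 ^ 4 + m3 ^ 4) = complex_of_real (l1 ^ 4 + l2 ^ 4 + (l1 + l2) ^ 4)"
      using power_sums(2) by simp
    then have quad: "m1 ^ 4 + m2 ^ 4 + m3 ^ 4 = l1 ^ 4 + l2 ^ 4 + (l1 + l2) ^ 4" by (simp only: of_real_eq_iff)
    have "2 * (m1 ^ 4 + m2 ^ 4 + m3 ^ 4) = (m1\<^sup>2 + m2\<^sup>2 + m3\<^sup>2)\<^sup>2"
      unfolding sq quad by Groebner_Basis.algebra
    then obtain e' a b where "skew_normal_form S e' (a + b) a b"
      by (rule skew_normal_form_sum[OF nf m])
    then show "\<exists>h. fixing0 h \<and> g2_relations (coeff8 (conj_map h S))"
      using g2_relations_normal_form by blast
  qed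
qed


subsection \<open>Unimodularity\<close>

text \<open>In the expansion of \<open>T (basis8 i)\<close> the term along \<open>basis8 0\<close>
  is zero, and any other index except \<open>i\<close> repeats a vector of \<open>us\<close> or
  \<open>vs\<close>.\<close>

lemma altform_diagonal:
  assumes \<omega>: "altform k \<omega>" and T: "ideal_map T" and us: "{1..7} - {i} \<subseteq> set us \<union> set vs" and i: "i \<in> {1..7}"
  shows "\<omega> (map basis8 us @ T (basis8 i) # map basis8 vs) = coeff8 T i i * \<omega> (map basis8 us @ basis8 i # map basis8 vs)"
proof -
  have "\<omega> (map basis8 us @ T (basis8 i) # map basis8 vs) =
      (\<Sum>m<8. (basis8 m \<bullet> T (basis8 i)) *\<^sub>R \<omega> (map basis8 us @ basis8 m # map basis8 vs))"
    by (rule linear_basis8[OF altform_linear[OF \<omega>]])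
  also have "\<dots> = (\<Sum>m<8. if m = i then coeff8 T i i * \<omega> (map basis8 us @ basis8 i # map basis8 vs) else 0)"
  proof (rule sum.cong[OF refl])
    fix m :: nat assume m: "m \<in> {..<8}"
    consider "m = i" | "m = 0" "m \<noteq> i" | "m \<in> {1..7} - {i}" using m by force
    then show "(basis8 m \<bullet> T (basis8 i)) *\<^sub>R \<omega> (map basis8 us @ basis8 m # map basis8 vs) =
        (if m = i then coeff8 T i i * \<omega> (map basis8 us @ basis8 i # map basis8 vs) else 0)"
    proof cases
      case 1
      then show ?thesis by (simp add: coeff8_def)
    next
      case 2
      then show ?thesis using T by (simp add: ideal_map_def)
    next
      case 3
      then have "\<not> distinct (map basis8 us @ basis8 m # map basis8 vs)" using us by auto
      then show ?thesis using 3 altform_not_distinct[OF \<omega>] by simp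
    qed
  qed
  also have "\<dots> = coeff8 T i i * \<omega> (map basis8 us @ basis8 i # map basis8 vs)"
    using i by simp
  finally show ?thesis .
qed

text \<open>On the top power of the ideal \<open>act T\<close> is multiplication by the trace, so d
  sends a 7-form to minus the trace times its value on the ideal.\<close>

lemma unimodular_semidirect_iff:
  assumes T: "ideal_map T"
  shows "unimodular8 (semidirect T) \<longleftrightarrow> (\<Sum>i=1..7. coeff8 T i i) = 0"
proof -
  let ?I = "[1, 2, 3, 4, 5, 6, 7] :: nat list"
  define t where "t = (\<Sum>i=1..7. coeff8 T i i)"
  have t: "t = coeff8 T 1 1 + coeff8 T 2 2 + coeff8 T 3 3 + coeff8 T 4 4 + coeff8 T 5 5 + coeff8 T 6 6 + coeff8 T 7 7"
    unfolding t_def atLeastAtMost_1_7 by (simp del: One_nat_def)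
  have d: "ext_deriv (semidirect T) \<eta> (map basis8 (0 # ?I)) = - t * \<eta> (map basis8 ?I)"
    if \<eta>: "altform 7 \<eta>" for \<eta>
  proof -
    note diag = altform_diagonal[OF \<eta> T]
    have "act T \<eta> (map basis8 ?I) = t * \<eta> (map basis8 ?I)"
      using diag[of 1 "[]" "[2, 3, 4, 5, 6, 7]"] diag[of 2 "[1]" "[3, 4, 5, 6, 7]"] diag[of 3 "[1, 2]" "[4, 5, 6, 7]"]
        diag[of 4 "[1, 2, 3]" "[5, 6, 7]"] diag[of 5 "[1, 2, 3, 4]" "[6, 7]"] diag[of 6 "[1, 2, 3, 4, 5]" "[7]"]
        diag[of 7 "[1, 2, 3, 4, 5, 6]" "[]"]
      unfolding t atLeastAtMost_1_7 by (simp add: distrib_right insert_Diff_if del: One_nat_def)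
    then show ?thesis
      using ext_deriv_semidirect(2)[OF T \<eta>, of ?I] by (simp del: list.map One_nat_def)
  qed
  have "(\<exists>\<eta>\<in>forms 7. ext_deriv (semidirect T) \<eta> = vol8) \<longleftrightarrow> t \<noteq> 0"
  proof
    assume "\<exists>\<eta>\<in>forms 7. ext_deriv (semidirect T) \<eta> = vol8"
    then obtain \<eta> where \<eta>: "altform 7 \<eta>" "ext_deriv (semidirect T) \<eta> = vol8"
      by (auto simp: forms_eq_altform)
    have "- t * \<eta> (map basis8 ?I) = 1"
      unfolding d[OF \<eta>(1), symmetric] \<eta>(2) by (rule vol8_basis)
    then show "t \<noteq> 0" by auto
  next
    assume "t \<noteq> 0"
    \<comment> \<open>Contraction of the volume form with \<open>basis8 0\<close>; the factor
      \<open>- 1 / t\<close> offsets the \<open>- t\<close> produced by d.\<close>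
    define \<eta> where "\<eta> = (\<lambda>xs. - 1 / t * vol8 (basis8 0 # xs))"
    have \<eta>: "altform 7 \<eta>"
      using altform_scale[OF altform_contract[OF altform_vol8, of "basis8 0"], of "\<lambda>_. - 1 / t"] by (simp add: \<eta>_def)
    have "ext_deriv (semidirect T) \<eta> = vol8"
    proof (rule altform_eqI[OF _ altform_vol8])
      show "altform 8 (ext_deriv (semidirect T) \<eta>)"
        using ext_deriv_altform[OF \<eta> bilinear_semidirect semidirect_self] T by (simp add: ideal_map_def)
      fix I assume "I \<in> set (filter (\<lambda>I. length I = 8) (subseqs [0..<8]))"
      then have I: "I = 0 # ?I" unfolding subseqs_upt_8_8 by simp
      have "\<eta> (map basis8 ?I) = - 1 / t"
        using vol8_basis by (simp add: \<eta>_def)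
      then show "ext_deriv (semidirect T) \<eta> (map basis8 I) = vol8 (map basis8 I)"
        unfolding I d[OF \<eta>] using vol8_basis \<open>t \<noteq> 0\<close> by simp
    qed
    then show "\<exists>\<eta>\<in>forms 7. ext_deriv (semidirect T) \<eta> = vol8"
      using \<eta> by (auto simp: forms_eq_altform)
  qed
  then show ?thesis by (simp add: unimodular8_def t_def)
qed


subsection \<open>Symmetric and skew-symmetric parts\<close>

text \<open>A coordinate-free form, from which invariance under conjugation is visible. The right
  side is the inner product of the projections to the ideal, as \<open>T\<close> vanishes on
  \<open>basis8 0\<close>.\<close>

lemma symmetric_scalar_coeff8_iff:
  assumes T: "ideal_map T"
  shows "symmetric_scalar c (coeff8 T) \<longleftrightarrow>
    (\<forall>x y. x \<bullet> T y + y \<bullet> T x = 2 * c * (x \<bullet> y - (basis8 0 \<bullet> x) * (basis8 0 \<bullet> y)))"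
proof
  assume sym: "symmetric_scalar c (coeff8 T)"
  have lin: "linear T" and T0: "T (basis8 0) = 0" "basis8 0 \<bullet> T x = 0" for x
    using T by (auto simp: ideal_map_def)
  define B where "B x y = x \<bullet> T y + y \<bullet> T x - 2 * c * (x \<bullet> y - (basis8 0 \<bullet> x) * (basis8 0 \<bullet> y))" for x y
  have linB: "linear (\<lambda>x. B x y)" "linear (B x)" for x y
    by (auto simp: B_def linear_iff linear_add[OF lin] linear_cmul[OF lin] inner_add_left inner_add_right algebra_simps)
  have basis: "B (basis8 i) (basis8 j) = 0" if ij: "i < 8" "j < 8" for i j
  proof (cases "i = 0 \<or> j = 0")
    case True
    then show ?thesis using ij by (auto simp: B_def T0 inner_basis8)
  next
    case False
    then have "i \<in> {1..7}" "j \<in> {1..7}" using ij by auto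
    then have "coeff8 T i j + coeff8 T j i = (if i = j then 2 * c else 0)"
      using sym unfolding symmetric_scalar_def by blast
    then show ?thesis using ij False by (auto simp: B_def coeff8_def inner_basis8)
  qed
  have "B x y = 0" for x y
  proof -
    have "B (basis8 i) y = 0" if "i < 8" for i
      using linear_basis8[OF linB(2), of "basis8 i" y] basis[OF that] by simp
    then show ?thesis using linear_basis8[OF linB(1), of x y] by simp
  qed
  then show "\<forall>x y. x \<bullet> T y + y \<bullet> T x = 2 * c * (x \<bullet> y - (basis8 0 \<bullet> x) * (basis8 0 \<bullet> y))"
    by (simp add: B_def)
next
  assume sym: "\<forall>x y. x \<bullet> T y + y \<bullet> T x = 2 * c * (x \<bullet> y - (basis8 0 \<bullet> x) * (basis8 0 \<bullet> y))"
  show "symmetric_scalar c (coeff8 T)"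
    unfolding symmetric_scalar_def
  proof (intro ballI)
    fix i j :: nat assume "i \<in> {1..7}" "j \<in> {1..7}"
    then show "coeff8 T i j + coeff8 T j i = (if i = j then 2 * c else 0)"
      using sym[rule_format, of "basis8 i" "basis8 j"] by (simp add: coeff8_def inner_basis8)
  qed
qed

lemma symmetric_scalar_conj_map:
  assumes h: "fixing0 h" and T: "ideal_map T"
  shows "symmetric_scalar c (coeff8 (conj_map h T)) \<longleftrightarrow> symmetric_scalar c (coeff8 T)"
proof -
  let ?h' = "inv_into UNIV h"
  have move: "x \<bullet> conj_map h T y = ?h' x \<bullet> T (?h' y)" for x y
    using fixing0_inner[OF h, of "?h' x"] by (simp add: conj_map_def fixing0_f_inv[OF h])
  have "(\<forall>x y. P (?h' x) (?h' y)) \<longleftrightarrow> (\<forall>x y. P x y)" for P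
    using fixing0_inv_f[OF h] by metis
  from this[of "\<lambda>x y. x \<bullet> T y + y \<bullet> T x = 2 * c * (x \<bullet> y - (basis8 0 \<bullet> x) * (basis8 0 \<bullet> y))"]
  show ?thesis
    unfolding symmetric_scalar_coeff8_iff[OF T] symmetric_scalar_coeff8_iff[OF conj_map_ideal_map[OF h T]] move
      fixing0_inner[OF fixing0_inv[OF h]] fixing0_inner_0[OF fixing0_inv[OF h]] .
qed

lemma trace_conj_map:
  assumes h: "fixing0 h" and T: "ideal_map T"
  shows "(\<Sum>i=1..7. coeff8 (conj_map h T) i i) = (\<Sum>i=1..7. coeff8 T i i)"
proof -
  have trace: "(\<Sum>i=1..7. coeff8 R i i) = (\<Sum>i<8. basis8 i \<bullet> R (basis8 i))" if "ideal_map R" for R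
    using that unfolding atLeastAtMost_1_7 sum_lessThan_8
    by (simp add: ideal_map_def coeff8_def add.assoc del: One_nat_def)
  have lin: "linear T" using T by (simp add: ideal_map_def)
  have "(\<Sum>i<8. basis8 i \<bullet> conj_map h T (basis8 i)) =
      (\<Sum>i<8. inv_into UNIV h (basis8 i) \<bullet> T (inv_into UNIV h (basis8 i)))"
    using coeff8_conj_map[OF h, of T] by (simp only: coeff8_def)
  also have "\<dots> = (\<Sum>i<8. basis8 i \<bullet> T (basis8 i))"
  proof (rule orthonormal_trace[where B = "\<lambda>x y. x \<bullet> T y"])
    show "orthogonal_transformation (inv_into UNIV h)" using fixing0_inv[OF h] by (simp add: fixing0_def)
  qed (use lin in \<open>auto simp: linear_iff inner_add_left inner_add_right\<close>)
  finally show ?thesis unfolding trace[OF T] trace[OF conj_map_ideal_map[OF h T]] .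
qed

definition skew_map :: "(real^8 \<Rightarrow> real^8) \<Rightarrow> real^8 \<Rightarrow> real^8" where
  "skew_map T x = (1 / 2) *\<^sub>R (T x - adjoint T x)"

lemma inner_skew_map:
  assumes "linear T" shows "x \<bullet> skew_map T y = (x \<bullet> T y - y \<bullet> T x) / 2"
  using adjoint_works[OF assms, of x y] by (simp add: skew_map_def inner_diff_right inner_commute)

lemma ideal_map_skew_map:
  assumes T: "ideal_map T" shows "ideal_map (skew_map T)"
proof -
  have lin: "linear T" and T0: "T (basis8 0) = 0" "basis8 0 \<bullet> T x = 0" for x
    using T by (auto simp: ideal_map_def)
  show ?thesis
    unfolding ideal_map_def
  proof (intro conjI allI)
    show "linear (skew_map T)"
      unfolding skew_map_def using linear_compose_sub[OF lin adjoint_linear[OF lin]]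
      by (rule linear_compose_scale_right)
    show "skew_map T (basis8 0) = 0"
      by (rule basis8_eqI) (simp add: inner_skew_map[OF lin] T0)
    show "basis8 0 \<bullet> skew_map T x = 0" for x
      by (simp add: inner_skew_map[OF lin] T0)
  qed
qed

text \<open>The two matrices differ by the factor 2, and the relations are linear and
  homogeneous.\<close>

lemma g2_relations_conj_map_skew_map:
  assumes h: "fixing0 h" and T: "ideal_map T"
  shows "g2_relations (\<lambda>i j. coeff8 (conj_map h T) i j - coeff8 (conj_map h T) j i) \<longleftrightarrow>
    g2_relations (coeff8 (conj_map h (skew_map T)))"
proof -
  have lin: "linear T" using T by (simp add: ideal_map_def)
  define W where "W = coeff8 (conj_map h (skew_map T))"
  have "coeff8 (conj_map h T) i j - coeff8 (conj_map h T) j i = 2 * W i j" for i j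
    unfolding W_def coeff8_conj_map[OF h] inner_skew_map[OF lin] by simp
  then show ?thesis unfolding g2_relations_def W_def[symmetric] by auto
qed

lemma skew_part_ad0_mat:
  assumes "linear (br (basis8 0))"
  shows "skew_part (ad0_mat br) = coeff_mat (skew_map (br (basis8 0)))"
  by (rule eq_matI)
    (simp_all add: skew_part_def ad0_mat_def coeff_mat_def coeff8_def inner_skew_map[OF assms])

lemma sym_part_ad0_mat:
  "sym_part (ad0_mat br) = h \<cdot>\<^sub>m 1\<^sub>m 7 \<longleftrightarrow> symmetric_scalar h (coeff8 (br (basis8 0)))"
proof -
  let ?E = "coeff8 (br (basis8 0))"
  have "sym_part (ad0_mat br) = h \<cdot>\<^sub>m 1\<^sub>m 7 \<longleftrightarrow>
      (\<forall>i<7. \<forall>j<7. ?E (Suc i) (Suc j) + ?E (Suc j) (Suc i) = (if i = j then 2 * h else 0))"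
  proof
    assume eq: "sym_part (ad0_mat br) = h \<cdot>\<^sub>m 1\<^sub>m 7"
    show "\<forall>i<7. \<forall>j<7. ?E (Suc i) (Suc j) + ?E (Suc j) (Suc i) = (if i = j then 2 * h else 0)"
    proof (intro allI impI)
      fix i j :: nat assume "i < 7" "j < 7"
      then show "?E (Suc i) (Suc j) + ?E (Suc j) (Suc i) = (if i = j then 2 * h else 0)"
        using arg_cong[OF eq, of "\<lambda>A. A $$ (i, j)"]
        by (auto simp: sym_part_def ad0_mat_def coeff8_def split: if_splits)
    qed
  next
    assume "\<forall>i<7. \<forall>j<7. ?E (Suc i) (Suc j) + ?E (Suc j) (Suc i) = (if i = j then 2 * h else 0)"
    then show "sym_part (ad0_mat br) = h \<cdot>\<^sub>m 1\<^sub>m 7"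
      by (intro eq_matI) (auto simp: sym_part_def ad0_mat_def coeff8_def)
  qed
  also have "\<dots> \<longleftrightarrow> (\<forall>i\<in>Suc ` {..<7}. \<forall>j\<in>Suc ` {..<7}. ?E i j + ?E j i = (if i = j then 2 * h else 0))"
    by auto
  also have "Suc ` {..<7} = {1..7}" by (simp add: lessThan_atLeast0 image_Suc_atLeastLessThan atLeastLessThanSuc_atLeastAtMost numeral_eq_Suc)
  finally show ?thesis by (simp only: symmetric_scalar_def)
qed

lemma symmetric_scalar_unique: "symmetric_scalar a E \<Longrightarrow> symmetric_scalar b E \<Longrightarrow> a = b"
  unfolding symmetric_scalar_def atLeastAtMost_1_7 by auto

text \<open>
  Each entry \<open>W i j\<close> occurs in exactly one relation, in which no other entry involves \<open>i\<close>; so the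
  relations for \<open>W\<close> and for its conjugate by the reflection in \<open>e\<^sub>i\<close> cannot both hold unless
  row \<open>i\<close> vanishes.
\<close>

lemma g2_relations_reflections:
  assumes skew: "\<And>i j. W i j = - W j i" and g2: "g2_relations W"
    and flip: "\<And>k. k \<in> {1..7} \<Longrightarrow>
      g2_relations (\<lambda>i j. (if i = k then - 1 else 1) * (if j = k then - 1 else 1) * W i j)"
  shows "\<forall>i\<in>{1..7}. \<forall>j\<in>{1..7}. W i j = 0"
proof -
  have diag: "W i i = 0" for i using skew[of i i] by simp
  have upper: "W 1 2 = 0" "W 1 3 = 0" "W 1 4 = 0" "W 1 5 = 0" "W 1 6 = 0" "W 1 7 = 0"
    "W 2 3 = 0" "W 2 4 = 0" "W 2 5 = 0" "W 2 6 = 0" "W 2 7 = 0" "W 3 4 = 0" "W 3 5 = 0" "W 3 6 = 0" "W 3 7 = 0"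
    "W 4 5 = 0" "W 4 6 = 0" "W 4 7 = 0" "W 5 6 = 0" "W 5 7 = 0" "W 6 7 = 0"
    \<comment> \<open>An entry \<open>W i j\<close> with \<open>i < j\<close> is isolated by
      comparing its relation with the one reflected in index \<open>i\<close>, where
      \<open>i \<le> 6\<close>.\<close>
    using g2 flip[of 1] flip[of 2] flip[of 3] flip[of 4] flip[of 5] flip[of 6]
    unfolding g2_relations_def by (simp_all del: One_nat_def)
  have "W j i = 0" if "W i j = 0" for i j using skew[of j i] that by simp
  note lower = upper[THEN this]
  show ?thesis
    unfolding atLeastAtMost_1_7 by (simp add: diag upper lower del: One_nat_def)
qed

text \<open>If all conjugates satisfied the relations, those by the identity and the coordinate
  reflections would force the matrix to vanish. The reflections have determinant -1, which
  \<open>fixing0\<close> admits.\<close>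

lemma not_g2_conjugate:
  assumes S: "ideal_map S" and skew: "\<And>x y. x \<bullet> S y = - (S x \<bullet> y)" and nz: "coeff_mat S \<noteq> 0\<^sub>m 7 7"
  obtains h where "fixing0 h" "\<not> g2_relations (coeff8 (conj_map h S))"
proof -
  have "\<exists>h. fixing0 h \<and> \<not> g2_relations (coeff8 (conj_map h S))"
  proof (rule ccontr)
    assume "\<not> ?thesis"
    then have all: "g2_relations (coeff8 (conj_map h S))" if "fixing0 h" for h using that by blast
    have "\<forall>i\<in>{1..7}. \<forall>j\<in>{1..7}. coeff8 S i j = 0"
    proof (rule g2_relations_reflections)
      show "coeff8 S i j = - coeff8 S j i" for i j
        unfolding coeff8_def by (subst skew) (simp only: inner_commute)
      have "fixing0 (\<lambda>x. x)" by (simp add: fixing0_def orthogonal_transformation_def linear_iff)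
      from all[OF this] show "g2_relations (coeff8 S)" by (simp add: conj_map_def inv_f_eq)
      fix k :: nat assume k: "k \<in> {1..7}"
      define r where "r x = x - (2 * (basis8 k \<bullet> x)) *\<^sub>R basis8 k" for x :: "real^8"
      have bk: "basis8 k \<bullet> basis8 k = 1" "basis8 0 \<bullet> basis8 k = 0" "basis8 k \<bullet> basis8 0 = 0"
        using k by (auto simp: inner_basis8)
      have "r x \<bullet> r y = x \<bullet> y" for x y
        by (simp add: r_def inner_diff_left inner_diff_right bk inner_commute)
      moreover have "linear r" by (auto simp: r_def linear_iff inner_add_right algebra_simps)
      ultimately have r: "fixing0 r"
        by (simp add: fixing0_def orthogonal_transformation_def) (simp add: r_def bk)
      have "r (r x) = x" for x by (simp add: r_def inner_diff_right bk)
      then have inv: "inv_into UNIV r x = r x" for x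
        using fixing0_inv_f[OF r, of "r x"] by simp
      have rb: "r (basis8 i) = (if i = k then - 1 else 1) *\<^sub>R basis8 i" if "i < 8" for i
        using that k by (auto simp: r_def inner_basis8 scaleR_2)
      have S_lin: "linear S" using S by (simp add: ideal_map_def)
      have "coeff8 (conj_map r S) i j = (if i = k then - 1 else 1) * (if j = k then - 1 else 1) * coeff8 S i j"
        if "i < 8" "j < 8" for i j
        unfolding coeff8_conj_map[OF r] inv rb[OF that(1)] rb[OF that(2)]
        by (simp add: linear_cmul[OF S_lin] linear_neg[OF S_lin] coeff8_def)
      then show "g2_relations (\<lambda>i j. (if i = k then - 1 else 1) * (if j = k then - 1 else 1) * coeff8 S i j)"
        using all[OF r] unfolding g2_relations_def by (simp del: One_nat_def)
    qed
    then have "coeff_mat S = 0\<^sub>m 7 7" by (intro eq_matI) (auto simp: coeff_mat_def)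
    then show False using nz by simp
  qed
  then show thesis using that by blast
qed


theorem theorem1p3:
  fixes br :: "real^8 \<Rightarrow> real^8 \<Rightarrow> real^8"
  assumes "lie_bracket br"
    and "abelian_ideal br (span (basis8 ` {1..7}))"
  shows
    "((\<exists>\<Omega>. spin7_structure \<Omega> \<and> spin7_parallel br \<Omega>) \<longleftrightarrow>
        sym_part (ad0_mat br) = 0\<^sub>m 7 7 \<and>
        (\<exists>l1 l2. 0 \<le> l1 \<and> l1 \<le> l2 \<and>
           complex_eigenvalues (skew_part (ad0_mat br)) = spin7_eigenvalues l1 l2)) \<and>
     ((\<exists>\<Omega>. spin7_structure \<Omega> \<and> spin7_lcp br \<Omega> \<and> \<not> spin7_parallel br \<Omega>) \<longleftrightarrow>
        (\<exists>h. h \<noteq> 0 \<and> sym_part (ad0_mat br) = h \<cdot>\<^sub>m 1\<^sub>m 7) \<and>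
        (\<exists>l1 l2. 0 \<le> l1 \<and> l1 \<le> l2 \<and>
           complex_eigenvalues (skew_part (ad0_mat br)) = spin7_eigenvalues l1 l2)) \<and>
     ((\<exists>\<Omega>. spin7_structure \<Omega> \<and> spin7_balanced br \<Omega>) \<longleftrightarrow>
        unimodular8 br \<and>
        (\<exists>l1 l2. 0 \<le> l1 \<and> l1 \<le> l2 \<and>
           complex_eigenvalues (skew_part (ad0_mat br)) = spin7_eigenvalues l1 l2)) \<and>
     (skew_part (ad0_mat br) \<noteq> 0\<^sub>m 7 7 \<longrightarrow>
        (\<exists>\<Omega>. spin7_structure \<Omega> \<and> spin7_mixed br \<Omega>))"
proof -
  define T where "T = br (basis8 0)"
  have T: "ideal_map T" and br: "br = semidirect T"
    using abelian_ideal_semidirect[OF assms] by (simp_all add: T_def)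
  have lin: "linear T" using T by (simp add: ideal_map_def)
  define S where "S = skew_map T"
  have S: "ideal_map S" unfolding S_def by (rule ideal_map_skew_map[OF T])
  have skew: "x \<bullet> S y = - (S x \<bullet> y)" for x y
    unfolding S_def inner_commute[of "skew_map T x"] inner_skew_map[OF lin] by (simp add: field_simps)
  have skew_part: "skew_part (ad0_mat br) = coeff_mat S"
    unfolding S_def T_def by (rule skew_part_ad0_mat) (use lin in \<open>simp add: T_def\<close>)
  have sym_part: "sym_part (ad0_mat br) = c \<cdot>\<^sub>m 1\<^sub>m 7 \<longleftrightarrow> symmetric_scalar c (coeff8 T)" for c
    unfolding T_def by (rule sym_part_ad0_mat)
  have "(0 :: real) \<cdot>\<^sub>m 1\<^sub>m 7 = 0\<^sub>m 7 7" by (intro eq_matI) auto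
  then have sym_part_0: "sym_part (ad0_mat br) = 0\<^sub>m 7 7 \<longleftrightarrow> symmetric_scalar 0 (coeff8 T)"
    using sym_part[of 0] by simp
  let ?sym = "\<lambda>c. symmetric_scalar c (coeff8 T)"
  let ?tr = "(\<Sum>i=1..7. coeff8 T i i) = 0"
  let ?g2 = "\<lambda>h. g2_relations (coeff8 (conj_map h S))"
  \<comment> \<open>The map \<open>h\<close> enters only through the g2 condition, the symmetric
    part and the trace being invariant. Each existence claim thus separates into a condition on
    \<open>T\<close> and the existence of a suitable \<open>h\<close>.\<close>
  have types: "spin7_parallel (semidirect (conj_map h T)) Omega0 \<longleftrightarrow> ?sym 0 \<and> ?g2 h"
    "spin7_lcp (semidirect (conj_map h T)) Omega0 \<longleftrightarrow> (\<exists>c. ?sym c) \<and> ?g2 h"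
    "spin7_balanced (semidirect (conj_map h T)) Omega0 \<longleftrightarrow> ?tr \<and> ?g2 h" if h: "fixing0 h" for h
    unfolding parallel_semidirect_iff[OF conj_map_ideal_map[OF h T]]
      lcp_semidirect_iff[OF conj_map_ideal_map[OF h T]] balanced_semidirect_iff[OF conj_map_ideal_map[OF h T]]
      symmetric_scalar_conj_map[OF h T] trace_conj_map[OF h T] g2_relations_conj_map_skew_map[OF h T] S_def
    by blast+
  note reduce = spin7_structure_exists_iff[OF T, folded br]
  have eigen: "(\<exists>l1 l2. 0 \<le> l1 \<and> l1 \<le> l2 \<and>
      complex_eigenvalues (coeff_mat S) = spin7_eigenvalues l1 l2) \<longleftrightarrow> (\<exists>h. fixing0 h \<and> ?g2 h)"
    by (rule g2_conjugate_iff_eigenvalues[OF S skew, symmetric])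
  have parallel: "(\<exists>\<Omega>. spin7_structure \<Omega> \<and> spin7_parallel br \<Omega>) \<longleftrightarrow> ?sym 0 \<and> (\<exists>h. fixing0 h \<and> ?g2 h)"
    unfolding reduce[where \<Phi> = "\<lambda>p l b. p"] using types(1) by blast
  \<comment> \<open>Given the g2 condition, non-parallel means that the scalar, which is unique, is
    nonzero.\<close>
  have lcp: "(\<exists>\<Omega>. spin7_structure \<Omega> \<and> spin7_lcp br \<Omega> \<and> \<not> spin7_parallel br \<Omega>) \<longleftrightarrow>
      (\<exists>c. c \<noteq> 0 \<and> ?sym c) \<and> (\<exists>h. fixing0 h \<and> ?g2 h)"
    unfolding reduce[where \<Phi> = "\<lambda>p l b. l \<and> \<not> p"] using types(1,2) symmetric_scalar_unique by metis
  have balanced: "(\<exists>\<Omega>. spin7_structure \<Omega> \<and> spin7_balanced br \<Omega>) \<longleftrightarrow> ?tr \<and> (\<exists>h. fixing0 h \<and> ?g2 h)"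
    unfolding reduce[where \<Phi> = "\<lambda>p l b. b"] using types(3) by blast
  \<comment> \<open>Each type includes the g2 condition, so a single \<open>h\<close> violating it
    excludes all three.\<close>
  have mixed: "\<exists>\<Omega>. spin7_structure \<Omega> \<and> spin7_mixed br \<Omega>" if nz: "coeff_mat S \<noteq> 0\<^sub>m 7 7"
  proof -
    obtain h where "fixing0 h" "\<not> ?g2 h" by (rule not_g2_conjugate[OF S skew nz])
    then show ?thesis
      unfolding spin7_mixed_def reduce[where \<Phi> = "\<lambda>p l b. \<not> p \<and> \<not> l \<and> \<not> b"] using types by blast
  qed
  have unimodular: "unimodular8 br \<longleftrightarrow> ?tr" unfolding br by (rule unimodular_semidirect_iff[OF T])
  show ?thesis
    unfolding parallel lcp balanced sym_part_0 sym_part unimodular skew_part eigen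
    by (intro conjI refl impI mixed)
qed

end
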